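(* Let $Q:\mathbb{C}\to\mathbb{R}$ be a smooth subharmonic admissible external field in the plane. Let $z_1,\dots,z_n\in\mathbb{C}$, let $q_1,\dots,q_n>0$, set $q=\sum_{j=1}^n q_j$, and let $V(z):=(1+q)Q(z)+\sum_{j=1}^n q_j\ln|z-z_j|^{-1}$. Let $S_Q$ be the support of the equilibrium measure $\mu_Q$ in the plane in the presence of $Q$, and let $S_V$ be the support of the equilibrium measure $\mu_V$ in the plane in the presence of $V$. Assume that $\mu_Q$ and $\mu_V$ do not have singular parts supported on the boundaries of $S_Q$ and $S_V$, respectively. Then the following hold. (i) Suppose that $\partial S_Q$ has Lebesgue measure $0$, that $z_1,\dots,z_n$ are interior points of $S_Q$, and that the positive intensities $q_1,\dots,q_n$ are small, in the sense that $S_V=S_Q\setminus\Omega$ for an open set $\Omega\subset S_Q$. Then each connected component $\mathcal{O}$ of $\Omega$ is a quadrature domain for the weighted area measure $\Delta Q\,dA$, and its quadrature nodes are all the points among $z_1,\dots,z_n$ that lie in $\mathcal{O}$. (ii) Suppose that $S_V$ is smooth and simply connected, with $z_1,\dots,z_n$ in the exterior of $S_V$. Let $\alpha$ be an interior point of $S_V$. Let $S_V^c:=\hat{\mathbb{C}}\setminus S_V$ be the exterior of $S_V$, and let $(S_V^c)^*$ be the image of $S_V^c$ under the conformal mapping $z\mapsto t:=(z-\alpha)^{-1}$. Then $(S_V^c)^*$ is a quadrature domain with respect to the boundary measure $t^{-1}\,\partial Q(t^{-1}+\alpha)\,dt$, and its quadrature nodes are the points $(z_j-\alpha)^{-1}$,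 $j=1,\dots,n$.
   Context: An external field $Q:\mathbb{C}\to\mathbb{R}\cup\{\infty\}$ is admissible if $\exp(-Q)$ is upper-semicontinuous, is positive on a set of positive logarithmic capacity, and satisfies $|z|\exp(-Q(z))\to0$ as $|z|\to\infty$. For an admissible $Q$, the equilibrium measure $\mu_Q$ is the unique probability measure $\mu$ on $\mathbb{C}$ minimizing the weighted logarithmic energy $\iint\ln\frac{1}{|w-z|}\,d\mu(w)\,d\mu(z)+2\int Q\,d\mu$. On the interior of $S_Q$ the equilibrium measure is $(2\pi)^{-1}\Delta Q\,dA$, where $dA$ is Lebesgue area measure. "No singular part on the boundary" means $\mu_Q=\frac{1}{2\pi}\Delta Q\,dA|_{S_Q}$ and, likewise, $\mu_V=\frac{1+q}{2\pi}\Delta Q\,dA|_{S_V}$. Here $\partial=\frac12(\partial_x-i\partial_y)$ and $\hat{\mathbb{C}}$ is the Riemann sphere. "$S_V$ is smooth and simply connected" means that $S_V$ is the closure of a bounded simply connected domain with $\mathcal{C}^\infty$ smooth boundary. For an open set $\Omega$, $\mathcal{A}^\infty(\Omega)$ denotes the analytic functions on $\Omega$ that are $\mathcal{C}^\infty$ smooth up to the boundary; this is the default test class for quadrature identities. A domain $\Omega$ is a quadrature domain with respect to a (possibly complex) measure $\nu$ (a weighted area measure on $\Omega$ or a weighted boundary measure along the positively oriented $\partial\Omega$) if there are finitely many points $w_j\in\Omega$ (the quadrature nodes) and constants $c_{jk}$ such that $$\int f\,d\nu=\sum_j\sum_{k=0}^{n_j}c_{jk}f^{(k)}(w_j)\quad\text{for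 all } f\in\mathcal{A}^\infty(\Omega),$$ where the integral is over $\Omega$ or $\partial\Omega$ respectively. *)

theory Defs
  imports "HOL-Probability.Probability" "HOL-Complex_Analysis.Complex_Analysis"
begin

primrec C_k :: "nat \<Rightarrow> ('a::real_normed_vector \<Rightarrow> 'b::real_normed_vector) \<Rightarrow> bool" where
  "C_k 0 f \<longleftrightarrow> continuous_on UNIV f"
| "C_k (Suc k) f \<longleftrightarrow> (\<forall>x. f differentiable (at x)) \<and> (\<forall>v. C_k k (\<lambda>x. frechet_derivative f (at x) v))"

definition smooth :: "('a::real_normed_vector \<Rightarrow> 'b::real_normed_vector) \<Rightarrow> bool" where
  "smooth f \<longleftrightarrow> (\<forall>k. C_k k f)"

definition pd_x :: "(complex \<Rightarrow> real) \<Rightarrow> complex \<Rightarrow> real" where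
  "pd_x f z = frechet_derivative f (at z) 1"

definition pd_y :: "(complex \<Rightarrow> real) \<Rightarrow> complex \<Rightarrow> real" where
  "pd_y f z = frechet_derivative f (at z) \<i>"

definition laplacian :: "(complex \<Rightarrow> real) \<Rightarrow> complex \<Rightarrow> real" where
  "laplacian f z = pd_x (pd_x f) z + pd_y (pd_y f) z"

definition wirtinger :: "(complex \<Rightarrow> real) \<Rightarrow> complex \<Rightarrow> complex" where
  "wirtinger f z = (1/2) * (of_real (pd_x f z) - \<i> * of_real (pd_y f z))"

definition upper_semicontinuous :: "('a::topological_space \<Rightarrow> 'b::linorder) \<Rightarrow> bool" where
  "upper_semicontinuous f \<longleftrightarrow> (\<forall>c. open {x. f x < c})"

text \<open>A finite-valued subharmonic function is automatically integrable over circles; the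
  integrability clause only prevents the circle mean from taking a default value.\<close>

definition subharmonic :: "(complex \<Rightarrow> real) \<Rightarrow> bool" where
  "subharmonic u \<longleftrightarrow> upper_semicontinuous u \<and>
     (\<forall>z. \<forall>r>0. (\<lambda>\<theta>. u (z + of_real r * cis \<theta>)) integrable_on {0..2*pi} \<and>
        u z \<le> (1 / (2*pi)) * integral {0..2*pi} (\<lambda>\<theta>. u (z + of_real r * cis \<theta>)))"

definition log_kernel :: "complex \<Rightarrow> complex \<Rightarrow> ereal" where
  "log_kernel w z = (if w = z then \<infinity> else ereal (ln (1 / cmod (w - z))))"

text \<open>Integral of an extended-real function as positive part minus negative part. As
  \<open>\<infinity> - \<infinity> = \<infinity>\<close> in type \<^typ>\<open>ereal\<close>, an undefined energy counts as \<open>\<infinity>\<close> below, so that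
  measures whose energy is undefined never are minimizers.\<close>

definition ereal_integral :: "'a measure \<Rightarrow> ('a \<Rightarrow> ereal) \<Rightarrow> ereal" where
  "ereal_integral M f =
     enn2ereal (\<integral>\<^sup>+x. e2ennreal (f x) \<partial>M) - enn2ereal (\<integral>\<^sup>+x. e2ennreal (- f x) \<partial>M)"

definition prob_measures :: "complex measure set" where
  "prob_measures = {\<mu>. prob_space \<mu> \<and> sets \<mu> = sets borel}"

definition log_energy :: "complex measure \<Rightarrow> ereal" where
  "log_energy \<mu> = ereal_integral (\<mu> \<Otimes>\<^sub>M \<mu>) (\<lambda>(w, z). log_kernel w z)"

definition weighted_energy :: "(complex \<Rightarrow> ereal) \<Rightarrow> complex measure \<Rightarrow> ereal" where
  "weighted_energy Q \<mu> = log_energy \<mu> + 2 * ereal_integral \<mu> Q"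

definition exp_ereal :: "ereal \<Rightarrow> ereal" where
  "exp_ereal x = (if x = \<infinity> then \<infinity> else if x = -\<infinity> then 0 else ereal (exp (real_of_ereal x)))"

definition log_capacity :: "complex set \<Rightarrow> ereal" where
  "log_capacity E = exp_ereal (- (INF \<mu> \<in> {\<mu> \<in> prob_measures. \<exists>K. compact K \<and> K \<subseteq> E \<and> emeasure \<mu> K = 1}.
     log_energy \<mu>))"

definition admissible :: "(complex \<Rightarrow> ereal) \<Rightarrow> bool" where
  "admissible Q \<longleftrightarrow> (\<forall>z. Q z \<noteq> -\<infinity>) \<and>
     upper_semicontinuous (\<lambda>z. exp_ereal (- Q z)) \<and>
     log_capacity {z. exp_ereal (- Q z) > 0} > 0 \<and>
     ((\<lambda>z. ereal (cmod z) * exp_ereal (- Q z)) \<longlongrightarrow> 0) at_infinity"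

definition energy_minimizer :: "(complex \<Rightarrow> ereal) \<Rightarrow> complex measure \<Rightarrow> bool" where
  "energy_minimizer Q \<mu> \<longleftrightarrow> \<mu> \<in> prob_measures \<and>
     (\<forall>\<nu>\<in>prob_measures. weighted_energy Q \<mu> \<le> weighted_energy Q \<nu>)"

definition equilibrium_measure :: "(complex \<Rightarrow> ereal) \<Rightarrow> complex measure \<Rightarrow> bool" where
  "equilibrium_measure Q \<mu> \<longleftrightarrow> energy_minimizer Q \<mu> \<and> (\<forall>\<nu>. energy_minimizer Q \<nu> \<longrightarrow> \<nu> = \<mu>)"

definition measure_support :: "'a::topological_space measure \<Rightarrow> 'a set" where
  "measure_support \<mu> = {x. \<forall>U. open U \<longrightarrow> x \<in> U \<longrightarrow> emeasure \<mu> U > 0}"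

definition smooth_jordan_curve :: "complex set \<Rightarrow> bool" where
  "smooth_jordan_curve C \<longleftrightarrow> (\<exists>\<gamma>::real \<Rightarrow> complex. smooth \<gamma> \<and>
     (\<forall>s. vector_derivative \<gamma> (at s) \<noteq> 0) \<and> (\<forall>s. \<gamma> (s + 1) = \<gamma> s) \<and>
     inj_on \<gamma> {0..<1} \<and> C = \<gamma> ` {0..1})"

definition smooth_boundary :: "complex set \<Rightarrow> bool" where
  "smooth_boundary D \<longleftrightarrow> (\<exists>\<Gamma>. finite \<Gamma> \<and> pairwise disjnt \<Gamma> \<and>
     (\<forall>C\<in>\<Gamma>. smooth_jordan_curve C) \<and> frontier D = \<Union>\<Gamma>)"

definition smooth_and_simply_connected :: "complex set \<Rightarrow> bool" where
  "smooth_and_simply_connected S \<longleftrightarrow> (\<exists>D. open D \<and> connected D \<and> D \<noteq> {} \<and> bounded D \<and>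
     simply_connected D \<and> smooth_boundary D \<and> S = closure D)"

text \<open>\<^term>\<open>None\<close> is the point at infinity.\<close>

type_synonym riemann_sphere = "complex option"

definition sphere_exterior :: "complex set \<Rightarrow> riemann_sphere set" where
  "sphere_exterior S = - (Some ` S)"

text \<open>The map \<open>z \<mapsto> (z - \<alpha>)\<^sup>-\<^sup>1\<close>, used only on sets that omit the pole \<open>\<alpha>\<close>.\<close>

fun sphere_inversion :: "complex \<Rightarrow> riemann_sphere \<Rightarrow> complex" where
  "sphere_inversion \<alpha> None = 0"
| "sphere_inversion \<alpha> (Some z) = inverse (z - \<alpha>)"

text \<open>Smoothness up to the boundary: every derivative extends continuously to the closure. The
  values of \<open>f\<close> on the boundary are those of the continuous extension.\<close>

definition A_infty :: "complex set \<Rightarrow> (complex \<Rightarrow> complex) set" where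
  "A_infty \<Omega> = {f. f holomorphic_on \<Omega> \<and> (\<exists>F. (\<forall>z\<in>closure \<Omega>. F 0 z = f z) \<and>
     (\<forall>k. continuous_on (closure \<Omega>) (F k) \<and> (\<forall>z\<in>\<Omega>. F k z = (deriv ^^ k) f z)))}"

definition has_area_integral ::
    "complex set \<Rightarrow> (complex \<Rightarrow> complex) \<Rightarrow> (complex \<Rightarrow> complex) \<Rightarrow> complex \<Rightarrow> bool" where
  "has_area_integral \<Omega> \<rho> f I \<longleftrightarrow> set_integrable lborel \<Omega> (\<lambda>z. f z * \<rho> z) \<and>
     (LINT z:\<Omega>|lborel. f z * \<rho> z) = I"

definition positive_boundary_path :: "complex set \<Rightarrow> (real \<Rightarrow> complex) \<Rightarrow> bool" where
  "positive_boundary_path \<Omega> \<gamma> \<longleftrightarrow> valid_path \<gamma> \<and> simple_path \<gamma> \<and> pathfinish \<gamma> = pathstart \<gamma> \<and>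
     path_image \<gamma> = frontier \<Omega> \<and> (\<forall>w\<in>\<Omega>. winding_number \<gamma> w = 1)"

text \<open>Integration over the positively oriented boundary of a domain bounded by one rectifiable
  Jordan curve. The value does not depend on the parametrization; requiring that one exists
  keeps the universal quantifier from being vacuous.\<close>

definition has_boundary_integral ::
    "complex set \<Rightarrow> (complex \<Rightarrow> complex) \<Rightarrow> (complex \<Rightarrow> complex) \<Rightarrow> complex \<Rightarrow> bool" where
  "has_boundary_integral \<Omega> \<rho> f I \<longleftrightarrow> (\<exists>\<gamma>. positive_boundary_path \<Omega> \<gamma>) \<and>
     (\<forall>\<gamma>. positive_boundary_path \<Omega> \<gamma> \<longrightarrow> ((\<lambda>t. f t * \<rho> t) has_contour_integral I) \<gamma>)"

text \<open>Here \<open>L f I\<close> reads: the integral of \<open>f\<close> exists and equals \<open>I\<close>. Every node must carry a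
  nonzero coefficient, so that \<open>W\<close> is the exact set of nodes and is determined by \<open>\<Omega>\<close> and
  \<open>L\<close>.\<close>

definition quadrature_domain ::
    "complex set \<Rightarrow> ((complex \<Rightarrow> complex) \<Rightarrow> complex \<Rightarrow> bool) \<Rightarrow> complex set \<Rightarrow> bool" where
  "quadrature_domain \<Omega> L W \<longleftrightarrow> open \<Omega> \<and> connected \<Omega> \<and> \<Omega> \<noteq> {} \<and> finite W \<and> W \<subseteq> \<Omega> \<and>
     (\<exists>(N :: complex \<Rightarrow> nat) (c :: complex \<Rightarrow> nat \<Rightarrow> complex).
        (\<forall>w\<in>W. \<exists>k\<le>N w. c w k \<noteq> 0) \<and>
        (\<forall>f\<in>A_infty \<Omega>. L f (\<Sum>w\<in>W. \<Sum>k\<le>N w. c w k * (deriv ^^ k) f w)))"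

end

theory Submission
  imports Defs
begin

text \<open>
  The first variation of the energy gives the Frostman conditions: the effective potential
  \<open>w = p + V - F\<close>, where \<open>p\<close> is the logarithmic potential of \<open>\<mu>V\<close> and \<open>F\<close> a constant, is nonnegative and vanishes on \<open>SV\<close>,
  hence so does its gradient.

  For (i), apply the divergence theorem to \<open>f \<theta>(w) \<partial>w\<close> on a component \<open>U\<close> of \<open>\<Omega>\<close>, where \<open>f\<close> is holomorphic
  and the smooth step \<open>\<theta>\<close> vanishes near \<open>0\<close>; since \<open>w = 0\<close> on the frontier of \<open>U\<close>, there is no boundary term. The
  result is the quadrature identity up to the integral of \<open>f \<theta>'(w) \<bar>\<partial>w\<bar>\<^sup>2\<close>. The weight of this error term is
  nonnegative, and for \<open>f = 1\<close> on all of \<open>\<Omega>\<close> it tends to \<open>0\<close> as \<open>\<theta>\<close> tends to the unit step, because \<open>\<mu>Q\<close> and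
  \<open>\<mu>V\<close> have the same total mass.

  For (ii), the vanishing of \<open>\<partial>w\<close> on \<open>SV\<close> expresses \<open>2 (1 + q) \<partial>Q\<close> there as the Cauchy transform of \<open>\<mu>V\<close>, which is
  holomorphic off \<open>SV\<close>, plus the sum of \<open>q j / (x - z j)\<close>. After inversion the integrand extends
  meromorphically with simple poles at the nodes, and Cauchy's formula applies once the boundary path is
  pushed inward.\<close>

subsection \<open>Cauchy transforms and logarithmic potentials\<close>

text \<open>In (i) the frontier of \<open>\<Omega>\<close> may be wild, so neither a boundary
  integral nor an exhaustion by nice domains is at hand. The superlevel sets of w serve instead:
  they contain punctured neighbourhoods of the nodes, where w tends to infinity, and their closures
  stay off the frontier, so the cut-off field extends by 0 to the plane. The cutoff only sees w > 0,
  but the zero set of w may reach into \<open>\<Omega>\<close>; it is null where \<Delta>Q > 0,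
  since there w has Laplacian (1 + q) \<Delta>Q. No estimate of the gradient of w by w near the
  frontier is made; the mass balance replaces it.

  In (ii) every piecewise C1 parametrization of the boundary counts; its derivative may vanish, and
  may be unbounded near finitely many parameters. Dominated convergence along the pushed paths
  therefore needs integrable speed. As such a path need not follow the regular parametrization,
  tangent and normal are functions on the curve; the normal, merely continuous, is replaced by a
  polynomial so that pushed paths remain piecewise C1.\<close>

lemma distr_norm_complex:
  "distr lborel borel (norm :: complex \<Rightarrow> real) =
     density lborel (\<lambda>r. ennreal (2 * pi * r) * indicator {0..} r)" (is "?M = ?N")
\<comment> \<open>Half-lines generate the Borel sets and are stable under intersection, so it
  suffices that both measures give \<pi> a^2, the area of a disc, to \<open>{..a}\<close>.\<close>
proof (rule measure_eqI_generator_eq[where E = "range (\<lambda>a::real. {..a})" and \<Omega> = UNIV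
      and A = "\<lambda>n::nat. {..real n}"])
  have M: "emeasure ?M {..a} = ennreal (pi * a\<^sup>2)" if "a \<ge> 0" for a
  proof -
    have "emeasure ?M {..a} = emeasure lborel (norm -` {..a} :: complex set)"
      by (subst emeasure_distr) auto
    also have "norm -` {..a} = cball (0::complex) a" by auto
    finally show ?thesis using that by (simp add: emeasure_cball unit_ball_vol_2)
  qed
  have N: "emeasure ?N {..a} = ennreal (pi * a\<^sup>2)" if "a \<ge> 0" for a
  proof -
    have "emeasure ?N {..a} = (\<integral>\<^sup>+r. ennreal (2 * pi * r) * indicator {0..a} r \<partial>lborel)"
      by (subst emeasure_density) (auto intro!: nn_integral_cong split: split_indicator)
    also have "\<dots> = ennreal (pi * a\<^sup>2 - pi * 0\<^sup>2)"
      by (rule nn_integral_FTC_Icc[where F = "\<lambda>r. pi * r\<^sup>2"])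
        (use that in \<open>auto intro!: derivative_eq_intros\<close>)
    finally show ?thesis by simp
  qed
  show "emeasure ?M X = emeasure ?N X" if "X \<in> range (\<lambda>a::real. {..a})" for X
  proof -
    from that obtain a where X: "X = {..a}" by blast
    show ?thesis
    proof (cases "a \<ge> 0")
      case False
      then have *: "norm -` {..a} = ({} :: complex set)"
        by (smt (verit) atMost_iff equals0I norm_ge_zero vimageE)
      have "emeasure ?M {..a} = 0"
        by (subst emeasure_distr) (simp_all add: *)
      moreover have "emeasure ?N {..a} = 0"
      proof -
        have "emeasure ?N {..a} = (\<integral>\<^sup>+r. ennreal (2 * pi * r) * indicator {0..} r * indicator {..a} r \<partial>lborel)"
          by (rule emeasure_density) auto
        also have "\<dots> = (\<integral>\<^sup>+r. 0 \<partial>(lborel :: real measure))"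
          using False by (intro nn_integral_cong) (auto split: split_indicator)
        finally show ?thesis by simp
      qed
      ultimately show ?thesis using X by simp
    qed (simp add: X M N)
  qed
  show "Int_stable (range (\<lambda>a::real. {..a}))"
    by (auto simp: Int_stable_def)
  show "sets ?M = sigma_sets UNIV (range (\<lambda>a::real. {..a}))"
    by (simp add: borel_eq_atMost)
  show "sets ?N = sigma_sets UNIV (range (\<lambda>a::real. {..a}))"
    by (simp add: borel_eq_atMost)
  show "(\<Union>n::nat. {..real n}) = UNIV"
    using real_arch_simple by auto
  show "emeasure ?M {..real i} \<noteq> \<infinity>" for i
    by (simp add: M)
qed auto

lemma nn_integral_norm_complex:
  assumes [measurable]: "g \<in> borel_measurable borel"
  shows "(\<integral>\<^sup>+u. g (norm (u::complex)) \<partial>lborel) = (\<integral>\<^sup>+r. ennreal (2 * pi * r) * g r * indicator {0..} r \<partial>lborel)"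
proof -
  have "(\<integral>\<^sup>+u. g (norm (u::complex)) \<partial>lborel) = integral\<^sup>N (distr lborel borel (norm::complex\<Rightarrow>real)) g"
    by (subst nn_integral_distr) auto
  then show ?thesis
    by (simp add: distr_norm_complex nn_integral_density mult_ac)
qed

lemma nn_integral_inverse_norm:
  assumes "d \<ge> 0"
  shows "(\<integral>\<^sup>+u. ennreal (inverse (norm (u::complex))) * indicator (cball 0 d) u \<partial>lborel) = ennreal (2 * pi * d)"
proof -
  have "(\<integral>\<^sup>+u. ennreal (inverse (norm (u::complex))) * indicator (cball 0 d) u \<partial>lborel) =
      (\<integral>\<^sup>+u. (\<lambda>r. ennreal (inverse r) * indicator {..d} r) (norm (u::complex)) \<partial>lborel)"
    by (intro nn_integral_cong) (auto split: split_indicator)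
  also have "\<dots> = (\<integral>\<^sup>+r. ennreal (2 * pi * r) * (ennreal (inverse r) * indicator {..d} r) * indicator {0..} r \<partial>lborel)"
    by (rule nn_integral_norm_complex) auto
  also have "\<dots> = (\<integral>\<^sup>+r. ennreal (2 * pi) * indicator {0..d} r \<partial>lborel)"
  proof (rule nn_integral_cong_AE)
    have "AE r in lborel. r \<noteq> (0::real)" by (rule AE_lborel_singleton)
    then show "AE r in lborel. ennreal (2 * pi * r) * (ennreal (inverse r) * indicator {..d} r) * indicator {0..} r
        = ennreal (2 * pi) * indicator {0..d} r"
      by eventually_elim (auto split: split_indicator simp: ennreal_mult[symmetric])
  qed
  also have "\<dots> = ennreal (2 * pi * d)"
    using assms by (simp add: nn_integral_cmult_indicator ennreal_mult)
  finally show ?thesis .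
qed

text \<open>Scaled to radius r and multiplied by 4 / r^2, this bump has mass 2 \<pi> for every r. In
  \<open>green\<close> it appears as the smeared form of a point mass 2 \<pi> at a node, so its
  exact integral fixes the quadrature coefficients.\<close>

lemma has_bochner_integral_paraboloid:
  "has_bochner_integral lborel (\<lambda>u::complex. max 0 (1 - (norm u)\<^sup>2)) (pi / 2)"
proof (rule has_bochner_integral_nn_integral)
  have "(\<integral>\<^sup>+u. ennreal (max 0 (1 - (norm (u::complex))\<^sup>2)) \<partial>lborel) =
      (\<integral>\<^sup>+r. ennreal (2 * pi * r) * ennreal (max 0 (1 - r\<^sup>2)) * indicator {0..} r \<partial>lborel)"
    by (rule nn_integral_norm_complex[of "\<lambda>r. ennreal (max 0 (1 - r\<^sup>2))"]) auto
  also have "\<dots> = (\<integral>\<^sup>+r. ennreal (2 * pi * (r - r^3)) * indicator {0..1} r \<partial>lborel)"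
  proof (intro nn_integral_cong)
    fix r :: real
    have "max 0 (1 - r\<^sup>2) = 0" if "r > 1"
      using that by (simp add: power2_eq_square max_def) (smt (verit) mult_less_cancel_left2)
    moreover have "ennreal (2 * pi * r) * ennreal (max 0 (1 - r\<^sup>2)) = ennreal (2 * pi * (r - r^3))"
      if "0 \<le> r" "r \<le> 1"
    proof -
      have "max 0 (1 - r\<^sup>2) = 1 - r\<^sup>2" using that by (simp add: power_le_one max_def)
      then show ?thesis
        using that by (simp add: ennreal_mult''[symmetric] power_le_one algebra_simps power3_eq_cube power2_eq_square)
    qed
    ultimately show "ennreal (2 * pi * r) * ennreal (max 0 (1 - r\<^sup>2)) * indicator {0..} r =
       ennreal (2 * pi * (r - r^3)) * indicator {0..1} r"
      by (cases "r > 1") (auto split: split_indicator)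
  qed
  also have "\<dots> = ennreal (2 * pi * (1\<^sup>2 / 2 - 1 ^ 4 / 4) - 2 * pi * (0\<^sup>2 / 2 - 0 ^ 4 / 4))"
  proof (rule nn_integral_FTC_Icc[where F = "\<lambda>r. 2 * pi * (r\<^sup>2 / 2 - r ^ 4 / 4)"])
    show "((\<lambda>r. 2 * pi * (r\<^sup>2 / 2 - r ^ 4 / 4)) has_real_derivative 2 * pi * (x - x ^ 3)) (at x)" for x
      by (auto intro!: derivative_eq_intros)
    show "0 \<le> 2 * pi * (x - x ^ 3)" if "x \<in> {0..1}" for x::real
      using that power_decreasing[of 1 3 x] by simp
  qed auto
  finally show "(\<integral>\<^sup>+u. ennreal (max 0 (1 - (norm (u::complex))\<^sup>2)) \<partial>lborel) = ennreal (pi / 2)"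
    by simp
qed auto

lemma cball_borel [measurable]: "cball x d \<in> sets borel"
  by (rule borel_closed) simp

lemma nn_integral_lborel_reflect:
  fixes z :: "'a::euclidean_space"
  assumes [measurable]: "f \<in> borel_measurable borel"
  shows "(\<integral>\<^sup>+w. f (z - w) \<partial>lborel) = integral\<^sup>N lborel f"
proof -
  have "integral\<^sup>N lborel f = integral\<^sup>N (density (distr lborel borel (\<lambda>w. z + (-1) *\<^sub>R w)) (\<lambda>_. \<bar>-1::real\<bar>^DIM('a))) f"
    using lborel_affine[of "-1" z] by simp
  also have "\<dots> = (\<integral>\<^sup>+w. f (z - w) \<partial>lborel)"
    by (simp add: density_1 nn_integral_distr)
  finally show ?thesis ..
qed

text \<open>In polar coordinates the factor r of the area element cancels the singularity. The value
  is linear in d and independent of z, which makes truncation errors uniform.\<close>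

lemma nn_integral_cauchy_kernel:
  fixes z :: complex
  assumes "d \<ge> 0"
  shows "(\<integral>\<^sup>+w. ennreal (1 / norm (z - w)) * indicator (cball z d) w \<partial>lborel) = ennreal (2 * pi * d)"
proof -
  have "(\<integral>\<^sup>+w. ennreal (1 / norm (z - w)) * indicator (cball z d) w \<partial>lborel) =
      (\<integral>\<^sup>+w. (\<lambda>u. ennreal (inverse (norm u)) * indicator (cball 0 d) u) (z - w) \<partial>lborel)"
    by (intro nn_integral_cong) (auto split: split_indicator simp: dist_norm norm_minus_commute inverse_eq_divide)
  also have "\<dots> = ennreal (2 * pi * d)"
    by (subst nn_integral_lborel_reflect) (measurable, rule nn_integral_inverse_norm[OF assms])
  finally show ?thesis .
qed

text \<open>Reduces integrability of the logarithmic kernel to that of the Cauchy kernel. At 0 both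
  sides vanish, by the conventions for \<open>ln 0\<close> and \<open>1 / 0\<close>.\<close>

lemma abs_ln_le_add_inverse:
  fixes x :: real
  shows "x \<ge> 0 \<Longrightarrow> \<bar>ln x\<bar> \<le> x + 1 / x"
proof (cases "x = 0")
  case False
  assume "x \<ge> 0"
  with False have "x > 0" by simp
  have "ln x \<le> x" using ln_le_minus_one[OF \<open>x > 0\<close>] by simp
  moreover have "- ln x \<le> 1 / x"
    using ln_le_minus_one[of "1 / x"] \<open>x > 0\<close> by (simp add: ln_div)
  ultimately show ?thesis using \<open>x > 0\<close> by (simp add: abs_if add_increasing2 add_increasing)
qed simp

text \<open>Real differentials are written as h \<mapsto> Re (X h) with a complex X. Here X = 1 / z,
  so that integration against a density produces the Cauchy transform.\<close>

lemma has_derivative_ln_norm: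
  fixes z :: complex
  assumes "z \<noteq> 0"
  shows "((\<lambda>z. ln (norm z)) has_derivative (\<lambda>h. Re (h / z))) (at z)"
proof -
  have "((\<lambda>z. ln (norm z)) has_derivative (\<lambda>h. (sgn z \<bullet> h) * inverse (norm z))) (at z)"
    using assms
    by (auto intro!: derivative_eq_intros has_derivative_norm simp: field_simps inner_commute)
  moreover have "(sgn z \<bullet> h) * inverse (norm z) = Re (h / z)" for h
  proof -
    have "(sgn z \<bullet> h) * inverse (norm z) = (Re z * Re h + Im z * Im h) / (norm z)\<^sup>2"
      by (simp add: sgn_div_norm inner_complex_def divide_inverse power2_eq_square algebra_simps)
    also have "\<dots> = Re (h / z)"
      by (simp add: Re_divide cmod_power2 mult_ac)
    finally show ?thesis .
  qed
  ultimately show ?thesis by simp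
qed

section \<open>Potentials of bounded, compactly supported densities\<close>

definition cauchy_transform :: "(complex \<Rightarrow> real) \<Rightarrow> complex \<Rightarrow> complex" where
  "cauchy_transform \<rho> z = (LINT w|lborel. of_real (\<rho> w) / (z - w))"

definition log_potential :: "(complex \<Rightarrow> real) \<Rightarrow> complex \<Rightarrow> real" where
  "log_potential \<rho> z = (LINT w|lborel. - ln (norm (z - w)) * \<rho> w)"

text \<open>The test densities of the first variation are of this kind by construction. The
  equilibrium density is shown to be so only in \<open>equilibrium.bounded_density\<close>, once its
  support is known to be bounded.\<close>

locale bounded_density =
  fixes \<rho> :: "complex \<Rightarrow> real" and M R :: real
  assumes meas[measurable]: "\<rho> \<in> borel_measurable borel"
    and nonneg: "\<And>w. 0 \<le> \<rho> w"
    and bound: "\<And>w. \<rho> w \<le> M"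
    and supp: "\<And>w. norm w > R \<Longrightarrow> \<rho> w = 0"
    and R0: "R \<ge> 0"
begin

lemma M0: "M \<ge> 0"
  using nonneg[of 0] bound[of 0] by simp

lemma le_indicator: "\<rho> w \<le> M * indicator (cball 0 R) w"
  using bound[of w] supp[of w] by (auto split: split_indicator)

lemma integrable_density: "integrable lborel \<rho>"
proof (rule Bochner_Integration.integrable_bound)
  have "integrable lborel (indicator (cball 0 R) :: complex \<Rightarrow> real)"
    by (rule integrable_real_indicator) (simp_all add: emeasure_cball R0)
  then show "integrable lborel (\<lambda>w::complex. M * indicator (cball 0 R) w :: real)"
    by (rule integrable_mult_right)
  have "norm (\<rho> w) \<le> norm (M * indicator (cball 0 R) w :: real)" for w
    using le_indicator[of w] nonneg[of w] by simp
  then show "AE w in lborel. norm (\<rho> w) \<le> norm (M * indicator (cball 0 R) w :: real)"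
    by simp
qed measurable

lemma nn_integral_kernel_near:
  assumes "d \<ge> 0"
  shows "(\<integral>\<^sup>+w. ennreal (\<rho> w / norm (z - w)) * indicator (cball z d) w \<partial>lborel) \<le> ennreal (2 * pi * M * d)"
proof -
  have "(\<integral>\<^sup>+w. ennreal (\<rho> w / norm (z - w)) * indicator (cball z d) w \<partial>lborel) \<le>
     (\<integral>\<^sup>+w. ennreal M * (ennreal (1 / norm (z - w)) * indicator (cball z d) w) \<partial>lborel)"
    using M0 nonneg bound
    by (intro nn_integral_mono) (auto split: split_indicator simp: ennreal_mult''[symmetric] divide_right_mono intro!: ennreal_leI)
  also have "\<dots> = ennreal M * ennreal (2 * pi * d)"
    by (subst nn_integral_cmult) (measurable, subst nn_integral_cauchy_kernel[OF assms], rule refl)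
  finally show ?thesis using M0 assms by (simp add: ennreal_mult''[symmetric] mult_ac)
qed

lemma nn_integral_kernel:
  "(\<integral>\<^sup>+w. ennreal (\<rho> w / norm (z - w)) \<partial>lborel) \<le> ennreal (2 * pi * M * (R + norm z))"
proof -
  have "ennreal (\<rho> w / norm (z - w)) \<le> ennreal (\<rho> w / norm (z - w)) * indicator (cball z (R + norm z)) w" for w
  proof (cases "norm w \<le> R")
    case True
    have "dist z w \<le> R + norm z"
      using True norm_triangle_ineq4[of z w] by (simp add: dist_norm)
    then show ?thesis by simp
  qed (simp add: supp)
  then have "(\<integral>\<^sup>+w. ennreal (\<rho> w / norm (z - w)) \<partial>lborel) \<le>
      (\<integral>\<^sup>+w. ennreal (\<rho> w / norm (z - w)) * indicator (cball z (R + norm z)) w \<partial>lborel)"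
    by (intro nn_integral_mono)
  also have "\<dots> \<le> ennreal (2 * pi * M * (R + norm z))"
    by (rule nn_integral_kernel_near) (simp add: R0)
  finally show ?thesis .
qed

lemma integrable_kernel: "integrable lborel (\<lambda>w. \<rho> w / norm (z - w))"
proof (rule integrableI_nonneg)
  show "(\<integral>\<^sup>+w. ennreal (\<rho> w / norm (z - w)) \<partial>lborel) < \<infinity>"
    using nn_integral_kernel[of z] ennreal_less_top order_le_less_trans by (metis infinity_ennreal_def)
  show "AE w in lborel. 0 \<le> \<rho> w / norm (z - w)"
    by (simp add: nonneg)
qed measurable

lemma integrable_cauchy: "integrable lborel (\<lambda>w. of_real (\<rho> w) / (z - w))"
proof (rule Bochner_Integration.integrable_bound[OF integrable_kernel[of z]])
  show "AE w in lborel. norm (of_real (\<rho> w) / (z - w)) \<le> norm (\<rho> w / norm (z - w))"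
    by (simp add: norm_divide)
qed measurable

lemma integrable_log: "integrable lborel (\<lambda>w. - ln (norm (z - w)) * \<rho> w)"
proof (rule Bochner_Integration.integrable_bound)
  show "integrable lborel (\<lambda>w. \<rho> w / norm (z - w) + (norm z + R) * \<rho> w)"
    by (intro Bochner_Integration.integrable_add integrable_mult_right integrable_kernel integrable_density)
  have "norm (- ln (norm (z - w)) * \<rho> w) \<le> norm (\<rho> w / norm (z - w) + (norm z + R) * \<rho> w)" for w
  proof (cases "norm w \<le> R")
    case True
    have "\<bar>ln (norm (z - w))\<bar> \<le> norm (z - w) + 1 / norm (z - w)"
      by (rule abs_ln_le_add_inverse) simp
    also have "\<dots> \<le> norm z + R + 1 / norm (z - w)"
      using True norm_triangle_ineq4[of z w] by linarith
    finally have "\<bar>ln (norm (z - w))\<bar> * \<rho> w \<le> (norm z + R + 1 / norm (z - w)) * \<rho> w"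
      by (intro mult_right_mono) (auto simp: nonneg)
    then show ?thesis using nonneg[of w] R0 by (simp add: abs_mult algebra_simps)
  qed (simp add: supp)
  then show "AE w in lborel. norm (- ln (norm (z - w)) * \<rho> w) \<le> norm (\<rho> w / norm (z - w) + (norm z + R) * \<rho> w)"
    by simp
qed measurable

text \<open>The transform is the uniform limit of the transforms with kernel truncated at distance
  \<open>1 / Suc n\<close> from the singularity.\<close>

lemma continuous_cauchy_transform: "continuous_on UNIV (cauchy_transform \<rho>)"
proof (rule uniform_limit_theorem)
  \<comment> \<open>As 1 / u = cnj u / |u|^2, bounding the modulus in the denominator from below
    gives a continuous kernel, at most \<open>Suc n\<close> in modulus, that agrees with 1 / u
    outside the small disc.\<close>
  define \<kappa> where "\<kappa> n u = cnj u / (of_real (max (norm u) (1 / real (Suc n))))\<^sup>2" for n and u :: complex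
  have \<kappa>_cont: "continuous_on UNIV (\<kappa> n)" for n
    unfolding \<kappa>_def by (intro continuous_intros) (auto simp: max_def)
  then have [measurable]: "\<kappa> n \<in> borel_measurable borel" for n
    by (rule borel_measurable_continuous_onI)
  have \<kappa>_far: "\<kappa> n u = 1 / u" if "norm u \<ge> 1 / real (Suc n)" for n u
  proof -
    have "u \<noteq> 0" using that by (auto simp: field_simps)
    then show ?thesis
      using that complex_div_cnj[of 1 u] by (simp add: \<kappa>_def max_def)
  qed
  have \<kappa>_le: "norm (\<kappa> n u) \<le> real (Suc n)" for n u
  proof -
    let ?m = "max (norm u) (1 / real (Suc n))"
    have m: "?m > 0" by (rule less_max_iff_disj[THEN iffD2]) simp
    have "norm (\<kappa> n u) = norm u / ?m\<^sup>2"
      unfolding \<kappa>_def norm_divide norm_power norm_of_real complex_mod_cnj using m by simp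
    also have "\<dots> \<le> ?m / ?m\<^sup>2" by (intro divide_right_mono) auto
    also have "\<dots> = 1 / ?m" using m by (simp add: power2_eq_square)
    also have "\<dots> \<le> 1 / (1 / real (Suc n))" by (intro divide_left_mono) (use m in auto)
    finally show ?thesis by simp
  qed
  define f where "f n z = (LINT w|lborel. of_real (\<rho> w) * \<kappa> n (z - w))" for n z
  have int\<kappa>: "integrable lborel (\<lambda>w. of_real (\<rho> w) * \<kappa> n (z - w))" for n z
  proof (rule Bochner_Integration.integrable_bound)
    show "integrable lborel (\<lambda>w. \<rho> w * real (Suc n))" by (intro integrable_mult_left integrable_density)
    show "AE w in lborel. norm (of_real (\<rho> w) * \<kappa> n (z - w)) \<le> norm (\<rho> w * real (Suc n))"
      using \<kappa>_le nonneg by (auto simp: norm_mult intro!: mult_left_mono)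
  qed measurable
  show "\<forall>\<^sub>F n in sequentially. continuous_on UNIV (f n)"
  proof (intro always_eventually allI)
    fix n
    show "continuous_on UNIV (f n)"
      unfolding continuous_on_sequentially f_def o_def
    proof (intro ballI allI impI)
      fix a and x :: "nat \<Rightarrow> complex" assume x: "(\<forall>n. x n \<in> UNIV) \<and> x \<longlonglongrightarrow> a"
      show "(\<lambda>k. LINT w|lborel. of_real (\<rho> w) * \<kappa> n (x k - w)) \<longlonglongrightarrow> (LINT w|lborel. of_real (\<rho> w) * \<kappa> n (a - w))"
      proof (rule integral_dominated_convergence)
        show "integrable lborel (\<lambda>w. \<rho> w * real (Suc n))" by (intro integrable_mult_left integrable_density)
        show "AE w in lborel. norm (of_real (\<rho> w) * \<kappa> n (x k - w)) \<le> \<rho> w * real (Suc n)" for k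
          using \<kappa>_le nonneg by (auto simp: norm_mult intro!: mult_left_mono)
        show "AE w in lborel. (\<lambda>k. of_real (\<rho> w) * \<kappa> n (x k - w)) \<longlonglongrightarrow> of_real (\<rho> w) * \<kappa> n (a - w)"
        proof (intro AE_I2 tendsto_intros)
          fix w
          have "(\<lambda>k. x k - w) \<longlonglongrightarrow> a - w" using x by (intro tendsto_intros) auto
          then show "(\<lambda>k. \<kappa> n (x k - w)) \<longlonglongrightarrow> \<kappa> n (a - w)"
            by (rule continuous_on_tendsto_compose[OF \<kappa>_cont[of n]]) auto
        qed
      qed measurable
    qed
  qed
  have near: "norm (1 / u - \<kappa> n u) \<le> 2 / norm u * indicator (cball 0 (1 / real (Suc n))) u" for n u
  proof (cases "norm u \<ge> 1 / real (Suc n) \<or> u = 0")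
    case False
    then have u: "norm u < 1 / real (Suc n)" "u \<noteq> 0" by auto
    have "real (Suc n) \<le> 1 / norm u"
      using u by (simp add: field_simps)
    then have "norm (\<kappa> n u) \<le> 1 / norm u" using \<kappa>_le[of n u] by linarith
    then have "norm (1 / u - \<kappa> n u) \<le> 1 / norm u + 1 / norm u"
      using norm_triangle_ineq4[of "1 / u" "\<kappa> n u"] by (simp add: norm_divide)
    then show ?thesis using u by simp
  qed (auto simp: \<kappa>_far, auto simp: \<kappa>_def)
  have diff: "norm (f n z - cauchy_transform \<rho> z) \<le> 4 * pi * M / real (Suc n)" for n z
  proof -
    let ?d = "1 / real (Suc n)"
    have "norm (f n z - cauchy_transform \<rho> z) =
        norm (LINT w|lborel. of_real (\<rho> w) * \<kappa> n (z - w) - of_real (\<rho> w) / (z - w))"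
      unfolding f_def cauchy_transform_def
      by (subst Bochner_Integration.integral_diff[OF int\<kappa> integrable_cauchy]) (rule refl)
    also have "\<dots> \<le> (LINT w|lborel. norm (of_real (\<rho> w) * \<kappa> n (z - w) - of_real (\<rho> w) / (z - w)))"
      by simp
    finally have le: "norm (f n z - cauchy_transform \<rho> z) \<le>
        (LINT w|lborel. norm (of_real (\<rho> w) * \<kappa> n (z - w) - of_real (\<rho> w) / (z - w)))" .
    have "ennreal (LINT w|lborel. norm (of_real (\<rho> w) * \<kappa> n (z - w) - of_real (\<rho> w) / (z - w))) = (\<integral>\<^sup>+w. ennreal (norm (of_real (\<rho> w) * \<kappa> n (z - w) - of_real (\<rho> w) / (z - w))) \<partial>lborel)"
      by (rule nn_integral_eq_integral[symmetric]) (intro integrable_norm Bochner_Integration.integrable_diff int\<kappa> integrable_cauchy, simp)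
    also have "\<dots> \<le> (\<integral>\<^sup>+w. 2 * (ennreal (\<rho> w / norm (z - w)) * indicator (cball z ?d) w) \<partial>lborel)"
    proof (intro nn_integral_mono)
      fix w
      have "norm (of_real (\<rho> w) * \<kappa> n (z - w) - of_real (\<rho> w) / (z - w)) = \<rho> w * norm (1 / (z - w) - \<kappa> n (z - w))"
      proof -
        have "of_real (\<rho> w) * \<kappa> n (z - w) - of_real (\<rho> w) / (z - w) = of_real (\<rho> w) * (\<kappa> n (z - w) - 1 / (z - w))"
          by (simp add: right_diff_distrib)
        also have "norm \<dots> = \<bar>\<rho> w\<bar> * norm (\<kappa> n (z - w) - 1 / (z - w))"
          by (simp only: norm_mult norm_of_real real_norm_def)
        finally show ?thesis using nonneg[of w] by (simp add: norm_minus_commute)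
      qed
      also have "\<dots> \<le> \<rho> w * (2 / norm (z - w) * indicator (cball 0 ?d) (z - w))"
        using near[of "z - w" n] nonneg by (intro mult_left_mono) auto
      also have "ennreal \<dots> = 2 * (ennreal (\<rho> w / norm (z - w)) * indicator (cball z ?d) w)"
        using nonneg[of w] by (auto split: split_indicator simp: dist_norm norm_minus_commute numeral_mult_ennreal)
      finally show "ennreal (norm (of_real (\<rho> w) * \<kappa> n (z - w) - of_real (\<rho> w) / (z - w))) \<le>
         2 * (ennreal (\<rho> w / norm (z - w)) * indicator (cball z ?d) w)"
        by (simp add: ennreal_leI)
    qed
    also have "\<dots> = 2 * (\<integral>\<^sup>+w. (ennreal (\<rho> w / norm (z - w)) * indicator (cball z ?d) w) \<partial>lborel)"
      by (rule nn_integral_cmult) measurable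
    also have "\<dots> \<le> 2 * ennreal (2 * pi * M * ?d)"
      by (intro mult_left_mono nn_integral_kernel_near) auto
    also have "\<dots> = ennreal (4 * pi * M / real (Suc n))"
      using M0 by (simp add: numeral_mult_ennreal)
    finally have "(LINT w|lborel. norm (of_real (\<rho> w) * \<kappa> n (z - w) - of_real (\<rho> w) / (z - w))) \<le> 4 * pi * M / real (Suc n)"
      using M0 by (simp add: ennreal_le_iff)
    with le show ?thesis by linarith
  qed
  show "uniform_limit UNIV f (cauchy_transform \<rho>) sequentially"
  proof (rule uniform_limitI)
    fix e :: real assume "e > 0"
    have "(\<lambda>n. 4 * pi * M * inverse (real (Suc n))) \<longlonglongrightarrow> 4 * pi * M * 0"
      by (intro tendsto_intros LIMSEQ_inverse_real_of_nat)
    then have "\<forall>\<^sub>F n in sequentially. 4 * pi * M * inverse (real (Suc n)) < e"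
      using \<open>e > 0\<close> by (intro order_tendstoD(2)) auto
    then show "\<forall>\<^sub>F n in sequentially. \<forall>z\<in>UNIV. dist (f n z) (cauchy_transform \<rho> z) < e"
    proof eventually_elim
      case (elim n)
      then show ?case
        using diff[of n] by (auto simp: dist_norm divide_inverse intro: order_le_less_trans)
    qed
  qed
qed simp

end

text \<open>The fundamental theorem of calculus for ln |z + s h - w| in s needs the segment to miss
  w. A line has area 0, so almost every w is admissible.\<close>

lemma AE_not_on_line:
  fixes z h :: complex
  assumes "h \<noteq> 0"
  shows "AE w in lborel. \<forall>s::real. w \<noteq> z + of_real s * h"
proof -
  have "negligible {x. (\<i> * h) \<bullet> x = (\<i> * h) \<bullet> z}"
    by (rule negligible_hyperplane) (use assms in simp)
  then have "{x. (\<i> * h) \<bullet> x = (\<i> * h) \<bullet> z} \<in> null_sets lebesgue"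
    by (simp add: negligible_iff_null_sets)
  moreover have "{x. (\<i> * h) \<bullet> x = (\<i> * h) \<bullet> z} \<in> sets lborel"
    by measurable
  ultimately have "{x. (\<i> * h) \<bullet> x = (\<i> * h) \<bullet> z} \<in> null_sets lborel"
    by (simp add: null_sets_completion_iff)
  then have "AE x in lborel. x \<notin> {x. (\<i> * h) \<bullet> x = (\<i> * h) \<bullet> z}"
    by (rule AE_not_in)
  then show ?thesis
    by eventually_elim (auto simp: inner_complex_def algebra_simps)
qed

lemma ln_norm_diff_eq_integral:
  fixes z h w :: complex
  assumes "\<forall>s::real. w \<noteq> z + of_real s * h"
  shows "(LINT s|lborel. Re (h / (z + of_real s * h - w)) * indicator {0..1} s) = ln (norm (z + h - w)) - ln (norm (z - w))"
proof -
  have ne: "z + of_real s * h - w \<noteq> 0" for s :: real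
    using assms by auto
  have "(LINT s|lborel. Re (h / (z + of_real s * h - w)) * indicator {0..1} s) =
      ln (norm (z + of_real 1 * h - w)) - ln (norm (z + of_real 0 * h - w))"
  proof (rule integral_FTC_Icc_real[where F = "\<lambda>s. ln (norm (z + of_real s * h - w))"])
    fix s :: real
    have "((\<lambda>s. z + of_real s * h - w) has_derivative (\<lambda>x. of_real x * h)) (at s)"
      by (auto intro!: derivative_eq_intros)
    from has_derivative_compose[OF this has_derivative_ln_norm[OF ne]]
    show "DERIV (\<lambda>s. ln (norm (z + of_real s * h - w))) s :> Re (h / (z + of_real s * h - w))"
      unfolding has_field_derivative_def
      by (rule has_derivative_eq_rhs) (auto simp: fun_eq_iff simp flip: times_divide_eq_right)
    show "isCont (\<lambda>s. Re (h / (z + of_real s * h - w))) s"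
    proof (rule isCont_Re)
      show "isCont (\<lambda>s. h / (z + of_real s * h - w)) s"
        by (intro continuous_intros ne)
    qed
  qed simp
  then show ?thesis by simp
qed

context bounded_density
begin

text \<open>Differentiating under the integral is awkward because the singularity moves with the
  point. Integrating the derivative along the segment and exchanging the integrals by Fubini only
  needs the kernel to be integrable uniformly in the point, which \<open>nn_integral_kernel\<close>
  provides.\<close>

lemma log_potential_diff:
  "log_potential \<rho> (z + h) - log_potential \<rho> z =
     - (LINT s|lborel. Re (h * cauchy_transform \<rho> (z + of_real s * h)) * indicator {0..1} s)"
proof (cases "h = 0")
  case False
  define f where "f = (\<lambda>(w, s::real). Re (h / (z + of_real s * h - w)) * indicator {0..1} s * \<rho> w)"
  have f_meas: "f \<in> borel_measurable (lborel \<Otimes>\<^sub>M lborel)"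
    unfolding f_def by measurable
  define B where "B = norm h * (2 * pi * M * (R + (norm z + norm h)))"
  have f_le: "norm (f (w, s)) \<le> norm h * (\<rho> w / norm (z + of_real s * h - w)) * indicator {0..1} s" for w s
    using nonneg[of w] abs_Re_le_cmod[of "h / (z + of_real s * h - w)"]
      mult_right_mono[of "\<bar>Re (h / (z + of_real s * h - w))\<bar>" "norm (h / (z + of_real s * h - w))" "\<rho> w"]
    by (auto simp: f_def abs_mult norm_divide split: split_indicator)
  have int_s: "(\<integral>\<^sup>+w. ennreal (norm (f (w, s))) \<partial>lborel) \<le> ennreal B * indicator {0..1} s" for s
  proof (cases "s \<in> {0..1}")
    case True
    have "(\<integral>\<^sup>+w. ennreal (norm (f (w, s))) \<partial>lborel) \<le> (\<integral>\<^sup>+w. ennreal (norm h) * ennreal (\<rho> w / norm (z + of_real s * h - w)) \<partial>lborel)"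
      using f_le[of _ s] nonneg True by (intro nn_integral_mono) (auto simp: ennreal_mult''[symmetric] intro!: ennreal_leI)
    also have "\<dots> = ennreal (norm h) * (\<integral>\<^sup>+w. ennreal (\<rho> w / norm (z + of_real s * h - w)) \<partial>lborel)"
      by (rule nn_integral_cmult) measurable
    also have "\<dots> \<le> ennreal (norm h) * ennreal (2 * pi * M * (R + norm (z + of_real s * h)))"
      by (intro mult_left_mono nn_integral_kernel) simp
    also have "\<dots> = ennreal (norm h * (2 * pi * M * (R + norm (z + of_real s * h))))"
      using M0 R0 by (simp add: ennreal_mult''[symmetric])
    also have "\<dots> \<le> ennreal B"
    proof -
      have "norm (z + of_real s * h) \<le> norm z + \<bar>s\<bar> * norm h"
        using norm_triangle_ineq[of z "of_real s * h"] by (simp add: norm_mult)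
      moreover have "\<bar>s\<bar> * norm h \<le> norm h"
        using True by (intro mult_left_le_one_le) auto
      ultimately have "norm (z + of_real s * h) \<le> norm z + norm h" by simp
      then show ?thesis
        unfolding B_def using M0 R0 by (intro ennreal_leI mult_left_mono) auto
    qed
    finally show ?thesis using True by simp
  qed (simp add: f_def)
  have f_int: "integrable (lborel \<Otimes>\<^sub>M lborel) f"
  proof (rule integrableI_bounded[OF f_meas])
    have "(\<integral>\<^sup>+x. ennreal (norm (f x)) \<partial>(lborel \<Otimes>\<^sub>M lborel)) = (\<integral>\<^sup>+s. \<integral>\<^sup>+w. ennreal (norm (f (w, s))) \<partial>lborel \<partial>lborel)"
      by (rule lborel_pair.nn_integral_snd[symmetric]) (use f_meas in measurable)
    also have "\<dots> \<le> (\<integral>\<^sup>+s. ennreal B * indicator {0..1::real} s \<partial>lborel)"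
      by (intro nn_integral_mono int_s)
    also have "\<dots> = ennreal B"
      by (simp add: nn_integral_cmult_indicator)
    finally show "(\<integral>\<^sup>+x. ennreal (norm (f x)) \<partial>(lborel \<Otimes>\<^sub>M lborel)) < \<infinity>"
      using ennreal_less_top order_le_less_trans by (metis infinity_ennreal_def)
  qed
  have "(LINT w|lborel. LINT s|lborel. f (w, s)) = (LINT w|lborel. (ln (norm (z + h - w)) - ln (norm (z - w))) * \<rho> w)"
  proof (rule integral_cong_AE)
    show "AE w in lborel. (LINT s|lborel. f (w, s)) = (ln (norm (z + h - w)) - ln (norm (z - w))) * \<rho> w"
      using AE_not_on_line[OF False, of z]
    proof eventually_elim
      case (elim w)
      have "(LINT s|lborel. f (w, s)) = (LINT s|lborel. Re (h / (z + of_real s * h - w)) * indicator {0..1} s) * \<rho> w"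
        by (simp add: f_def)
      then show ?case using ln_norm_diff_eq_integral[OF elim] by simp
    qed
    show "(\<lambda>w. LINT s|lborel. f (w, s)) \<in> borel_measurable lborel"
      using f_meas by measurable
  qed measurable
  also have "\<dots> = - (log_potential \<rho> (z + h) - log_potential \<rho> z)"
    unfolding log_potential_def
    by (subst Bochner_Integration.integral_diff[symmetric, OF integrable_log integrable_log])
       (simp add: algebra_simps flip: Bochner_Integration.integral_minus)
  finally have 1: "(LINT w|lborel. LINT s|lborel. f (w, s)) = - (log_potential \<rho> (z + h) - log_potential \<rho> z)" .
  have "(LINT w|lborel. LINT s|lborel. f (w, s)) = (LINT s|lborel. LINT w|lborel. f (w, s))"
    using lborel_pair.Fubini_integral[of "\<lambda>w s. f (w, s)"] f_int by simp
  also have "\<dots> = (LINT s|lborel. Re (h * cauchy_transform \<rho> (z + of_real s * h)) * indicator {0..1} s)"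
  proof (rule Bochner_Integration.integral_cong[OF refl])
    fix s :: real
    have "(LINT w|lborel. f (w, s)) = (LINT w|lborel. Re (h * (of_real (\<rho> w) / (z + of_real s * h - w))) * indicator {0..1} s)"
      by (rule Bochner_Integration.integral_cong) (simp_all add: f_def Re_divide algebra_simps add_divide_distrib diff_divide_distrib)
    also have "\<dots> = (LINT w|lborel. Re (h * (of_real (\<rho> w) / (z + of_real s * h - w)))) * indicator {0..1} s"
      by simp
    also have "(LINT w|lborel. Re (h * (of_real (\<rho> w) / (z + of_real s * h - w)))) =
       Re (LINT w|lborel. h * (of_real (\<rho> w) / (z + of_real s * h - w)))"
      by (rule integral_Re) (rule integrable_mult_right, rule integrable_cauchy)
    also have "(LINT w|lborel. h * (of_real (\<rho> w) / (z + of_real s * h - w))) = h * cauchy_transform \<rho> (z + of_real s * h)"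
      unfolding cauchy_transform_def by (rule integral_mult_right_zero)
    finally show "(LINT w|lborel. f (w, s)) = Re (h * cauchy_transform \<rho> (z + of_real s * h)) * indicator {0..1} s" .
  qed
  finally show ?thesis using 1 by simp
qed simp

text \<open>By \<open>log_potential_diff\<close> an increment of the potential is a mean of the
  Cauchy transform over the segment; continuity of the transform turns this mean into a
  derivative.\<close>

lemma has_derivative_log_potential:
  "(log_potential \<rho> has_derivative (\<lambda>h. - Re (h * cauchy_transform \<rho> z))) (at z)"
proof (rule has_derivativeI)
  show "bounded_linear (\<lambda>h. - Re (h * cauchy_transform \<rho> z))"
    by (intro bounded_linear_minus bounded_linear_compose[OF bounded_linear_Re] bounded_linear_mult_left)
  let ?C = "cauchy_transform \<rho>" and ?U = "log_potential \<rho>"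
  show "((\<lambda>y. (?U y - ?U z - - Re ((y - z) * ?C z)) /\<^sub>R norm (y - z)) \<longlongrightarrow> 0) (at z)"
  proof (rule LIM_I)
    fix e :: real assume "e > 0"
    have "isCont ?C z"
      using continuous_cauchy_transform by (simp add: continuous_on_eq_continuous_at)
    then obtain d where d: "d > 0" "\<And>y. norm (y - z) < d \<Longrightarrow> norm (?C y - ?C z) < e / 2"
      using \<open>e > 0\<close> unfolding continuous_at_eps_delta dist_norm by (meson half_gt_zero)
    have "norm ((?U y - ?U z - - Re ((y - z) * ?C z)) /\<^sub>R norm (y - z) - 0) < e"
      if y: "y \<noteq> z" "norm (y - z) < d" for y
    proof -
      define h where "h = y - z"
      define g where "g s = Re (h * ?C (z + of_real s * h))" for s :: real
      have g_cont: "continuous_on {0..1} g"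
        unfolding g_def
        by (intro continuous_intros continuous_on_compose2[OF continuous_cauchy_transform]) auto
      then have g_int: "integrable lborel (\<lambda>s. g s * indicator {0..1} s)"
        using borel_integrable_compact[OF compact_Icc g_cont]
        by (simp add: mult.commute)
      have 1: "integrable lborel (\<lambda>s::real. Re (h * ?C z) * indicator {0..1} s)"
        by (intro integrable_mult_right integrable_real_indicator) simp_all
      have "?U y - ?U z + Re (h * ?C z) = (LINT s|lborel. Re (h * ?C z) * indicator {0..1::real} s) - (LINT s|lborel. g s * indicator {0..1} s)"
        using log_potential_diff[of z h] by (simp add: h_def g_def)
      also have "\<dots> = (LINT s|lborel. Re (h * ?C z) * indicator {0..1} s - g s * indicator {0..1} s)"
        by (rule Bochner_Integration.integral_diff[symmetric, OF 1 g_int])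
      also have "norm \<dots> \<le> (LINT s|lborel. (norm h * (e / 2)) * indicator {0..1::real} s)"
      proof (rule order_trans[OF integral_norm_bound integral_mono])
        show "integrable lborel (\<lambda>s. norm (Re (h * ?C z) * indicator {0..1} s - g s * indicator {0..1} s))"
          by (rule integrable_norm[OF Bochner_Integration.integrable_diff[OF 1 g_int]])
        show "integrable lborel (\<lambda>s::real. norm h * (e / 2) * indicator {0..1} s)"
          by (intro integrable_mult_right integrable_real_indicator) simp_all
        fix s :: real
        show "norm (Re (h * ?C z) * indicator {0..1} s - g s * indicator {0..1} s) \<le> norm h * (e / 2) * indicator {0..1} s"
        proof (cases "s \<in> {0..1}")
          case True
          have "\<bar>s\<bar> * norm h \<le> norm h"
            using True by (intro mult_left_le_one_le) auto
          then have "norm (z + of_real s * h - z) < d"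
            using y unfolding h_def[symmetric] by (simp add: norm_mult)
          then have *: "norm (?C (z + of_real s * h) - ?C z) < e / 2" by (rule d)
          have "\<bar>Re (h * ?C z) - g s\<bar> = \<bar>Re (h * (?C z - ?C (z + of_real s * h)))\<bar>"
            by (simp add: g_def right_diff_distrib)
          also have "\<dots> \<le> norm h * norm (?C z - ?C (z + of_real s * h))"
            by (metis abs_Re_le_cmod norm_mult)
          also have "\<dots> \<le> norm h * (e / 2)"
            using * by (intro mult_left_mono) (auto simp: norm_minus_commute)
          finally show ?thesis using True by simp
        qed simp
      qed
      also have "\<dots> = norm h * (e / 2)" by simp
      finally have "\<bar>?U y - ?U z + Re (h * ?C z)\<bar> \<le> norm h * (e / 2)" by simp
      moreover have "norm h > 0" using y by (simp add: h_def)
      ultimately have "\<bar>?U y - ?U z + Re (h * ?C z)\<bar> / norm h \<le> e / 2"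
        by (simp add: field_simps)
      moreover have "norm (a /\<^sub>R norm h - 0) = \<bar>a\<bar> / norm h" for a :: real
        by (simp add: divide_inverse_commute abs_mult)
      note this[of "?U y - ?U z + Re (h * ?C z)"]
      ultimately show ?thesis
        unfolding h_def[symmetric] diff_minus_eq_add using \<open>e > 0\<close> by linarith
    qed
    then show "\<exists>s>0. \<forall>y. y \<noteq> z \<and> norm (y - z) < s \<longrightarrow>
        norm ((?U y - ?U z - - Re ((y - z) * ?C z)) /\<^sub>R norm (y - z) - 0) < e"
      using d(1) by blast
  qed
qed

lemma continuous_log_potential: "continuous_on UNIV (log_potential \<rho>)"
  using has_derivative_continuous[OF has_derivative_log_potential]
  by (simp add: continuous_on_eq_continuous_at)

text \<open>The denominator is affine in u so that one argument covers two kernels: 1 / (u - w) off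
  the support, and the inverted kernel 1 / (1 - u (w - \<alpha>)), which is also regular at u = 0.
  Since denominators are bounded away from 0, the difference quotients are dominated by a multiple
  of the density.\<close>

lemma has_field_derivative_kernel_integral:
  fixes p b :: "complex \<Rightarrow> complex" and t :: complex
  assumes [measurable]: "p \<in> borel_measurable borel" "b \<in> borel_measurable borel"
    and "e > 0" "d > 0"
    and b: "\<And>w. \<rho> w \<noteq> 0 \<Longrightarrow> norm (b w) \<le> B"
    and away: "\<And>w u. \<rho> w \<noteq> 0 \<Longrightarrow> norm (u - t) < e \<Longrightarrow> norm (p w - u * b w) \<ge> d"
  shows "((\<lambda>u. LINT w|lborel. of_real (\<rho> w) / (p w - u * b w)) has_field_derivative
           (LINT w|lborel. of_real (\<rho> w) * b w / (p w - t * b w)\<^sup>2)) (at t)"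
proof -
  let ?g = "\<lambda>u. LINT w|lborel. of_real (\<rho> w) / (p w - u * b w)"
  have int: "integrable lborel (\<lambda>w. of_real (\<rho> w) / (p w - u * b w))" if u: "norm (u - t) < e" for u
  proof (rule Bochner_Integration.integrable_bound)
    show "integrable lborel (\<lambda>w. \<rho> w * (1 / d))" by (intro integrable_mult_left integrable_density)
    have "norm (of_real (\<rho> w) / (p w - u * b w)) \<le> norm (\<rho> w * (1 / d))" for w
    proof (cases "\<rho> w = 0")
      case False
      show ?thesis using away[OF False u] \<open>d > 0\<close> nonneg[of w]
        by (auto simp: norm_divide intro!: divide_left_mono mult_pos_pos)
    qed simp
    then show "AE w in lborel. norm (of_real (\<rho> w) / (p w - u * b w)) \<le> norm (\<rho> w * (1 / d))" by simp
  qed measurable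
  have "((\<lambda>u. (?g u - ?g t) / (u - t)) \<longlongrightarrow> (LINT w|lborel. of_real (\<rho> w) * b w / (p w - t * b w)\<^sup>2)) (at t)"
    unfolding tendsto_at_iff_sequentially
  proof (intro allI impI)
    fix X :: "nat \<Rightarrow> complex"
    assume X: "\<forall>i. X i \<in> UNIV - {t}" "X \<longlonglongrightarrow> t"
    then obtain N where N: "\<And>n. n \<ge> N \<Longrightarrow> norm (X n - t) < e"
      using \<open>e > 0\<close> by (metis LIMSEQ_D)
    have *: "(?g u - ?g t) / (u - t) = (LINT w|lborel. of_real (\<rho> w) * b w / ((p w - u * b w) * (p w - t * b w)))"
      if u: "norm (u - t) < e" "u \<noteq> t" for u
    proof -
      have "?g u - ?g t = (LINT w|lborel. of_real (\<rho> w) / (p w - u * b w) - of_real (\<rho> w) / (p w - t * b w))"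
        by (rule Bochner_Integration.integral_diff[symmetric]; rule int) (use u \<open>e > 0\<close> in auto)
      also have "\<dots> = (LINT w|lborel. (u - t) * (of_real (\<rho> w) * b w / ((p w - u * b w) * (p w - t * b w))))"
      proof (rule Bochner_Integration.integral_cong[OF refl])
        fix w
        show "of_real (\<rho> w) / (p w - u * b w) - of_real (\<rho> w) / (p w - t * b w) =
          (u - t) * (of_real (\<rho> w) * b w / ((p w - u * b w) * (p w - t * b w)))"
        proof (cases "\<rho> w = 0")
          case False
          have "p w - u * b w \<noteq> 0" "p w - t * b w \<noteq> 0"
            using away[OF False u(1)] away[OF False, of t] \<open>d > 0\<close> \<open>e > 0\<close> by auto
          then show ?thesis by (simp add: field_simps)
        qed simp
      qed
      also have "\<dots> = (u - t) * (LINT w|lborel. of_real (\<rho> w) * b w / ((p w - u * b w) * (p w - t * b w)))"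
        by (rule integral_mult_right_zero)
      finally show ?thesis using u by simp
    qed
    have "(\<lambda>n. LINT w|lborel. of_real (\<rho> w) * b w / ((p w - X (n + N) * b w) * (p w - t * b w)))
        \<longlonglongrightarrow> (LINT w|lborel. of_real (\<rho> w) * b w / (p w - t * b w)\<^sup>2)"
    proof (rule integral_dominated_convergence)
      show "integrable lborel (\<lambda>w. \<rho> w * (B / (d * d)))" by (intro integrable_mult_left integrable_density)
      show "AE w in lborel. (\<lambda>n. of_real (\<rho> w) * b w / ((p w - X (n + N) * b w) * (p w - t * b w))) \<longlonglongrightarrow> of_real (\<rho> w) * b w / (p w - t * b w)\<^sup>2"
      proof (intro AE_I2)
        fix w
        show "(\<lambda>n. of_real (\<rho> w) * b w / ((p w - X (n + N) * b w) * (p w - t * b w))) \<longlonglongrightarrow> of_real (\<rho> w) * b w / (p w - t * b w)\<^sup>2"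
        proof (cases "\<rho> w = 0")
          case False
          have "p w - t * b w \<noteq> 0"
            using away[OF False, of t] \<open>d > 0\<close> \<open>e > 0\<close> by auto
          moreover have "(\<lambda>n. X (n + N)) \<longlonglongrightarrow> t" using X(2) by (rule LIMSEQ_ignore_initial_segment)
          ultimately show ?thesis
            unfolding power2_eq_square by (intro tendsto_intros) auto
        qed simp
      qed
      show "AE w in lborel. norm (of_real (\<rho> w) * b w / ((p w - X (n + N) * b w) * (p w - t * b w))) \<le> \<rho> w * (B / (d * d))" for n
      proof (intro AE_I2)
        fix w
        show "norm (of_real (\<rho> w) * b w / ((p w - X (n + N) * b w) * (p w - t * b w))) \<le> \<rho> w * (B / (d * d))"
        proof (cases "\<rho> w = 0")
          case False
          have "norm (b w) / (norm (p w - X (n + N) * b w) * norm (p w - t * b w)) \<le> B / (d * d)"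
            using b[OF False] away[OF False N, of "n + N"] away[OF False, of t] \<open>d > 0\<close> \<open>e > 0\<close>
            by (intro frac_le mult_mono mult_pos_pos) (auto intro: order_trans[OF norm_ge_zero])
          then have "\<rho> w * (norm (b w) / (norm (p w - X (n + N) * b w) * norm (p w - t * b w))) \<le> \<rho> w * (B / (d * d))"
            using nonneg by (intro mult_left_mono) auto
          then show ?thesis using nonneg[of w] by (simp add: norm_divide norm_mult)
        qed simp
      qed
    qed measurable
    moreover have "(?g (X (n + N)) - ?g t) / (X (n + N) - t) =
        (LINT w|lborel. of_real (\<rho> w) * b w / ((p w - X (n + N) * b w) * (p w - t * b w)))" for n
    proof (rule *)
      show "norm (X (n + N) - t) < e" by (rule N) simp
      show "X (n + N) \<noteq> t" using X(1) by blast
    qed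
    ultimately have "(\<lambda>n. (?g (X (n + N)) - ?g t) / (X (n + N) - t)) \<longlonglongrightarrow> (LINT w|lborel. of_real (\<rho> w) * b w / (p w - t * b w)\<^sup>2)"
      by (simp only:)
    then show "((\<lambda>u. (?g u - ?g t) / (u - t)) \<circ> X) \<longlonglongrightarrow> (LINT w|lborel. of_real (\<rho> w) * b w / (p w - t * b w)\<^sup>2)"
      unfolding o_def by (rule LIMSEQ_offset)
  qed
  then show ?thesis by (simp add: has_field_derivative_iff)
qed

lemma cauchy_transform_holomorphic:
  assumes "closed S" and S: "\<And>w. w \<notin> S \<Longrightarrow> \<rho> w = 0"
  shows "cauchy_transform \<rho> holomorphic_on - S"
proof (rule holomorphic_onI)
  fix t assume "t \<in> - S"
  then obtain e where e: "e > 0" "ball t e \<subseteq> - S"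
    using assms(1) open_contains_ball[of "- S"] by (auto simp: open_Compl)
  have "((\<lambda>u. LINT w|lborel. of_real (\<rho> w) / ((- w) - u * (- 1))) has_field_derivative
           (LINT w|lborel. of_real (\<rho> w) * (- 1) / ((- w) - t * (- 1))\<^sup>2)) (at t)"
  proof (rule has_field_derivative_kernel_integral[where e = "e / 2" and d = "e / 2" and B = 1])
    fix w u assume "\<rho> w \<noteq> 0" "norm (u - t) < e / 2"
    then have "w \<in> S" using S by auto
    then have "w \<notin> ball t e" using e by auto
    then have "e \<le> norm (t - w)" by (simp add: dist_norm)
    also have "\<dots> \<le> norm (t - u) + norm (u - w)"
      using norm_triangle_ineq[of "t - u" "u - w"] by simp
    finally show "e / 2 \<le> norm (- w - u * - 1)"
      using \<open>norm (u - t) < e / 2\<close> by (simp add: norm_minus_commute)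
  qed (use e in auto)
  then have "(cauchy_transform \<rho> has_field_derivative
           (LINT w|lborel. of_real (\<rho> w) * (- 1) / ((- w) - t * (- 1))\<^sup>2)) (at t)"
    unfolding cauchy_transform_def[abs_def] by simp
  then show "cauchy_transform \<rho> field_differentiable at t within - S"
    using field_differentiable_at_within field_differentiable_def by blast
qed

end

subsection \<open>Logarithmic energy of densities\<close>

text \<open>\<open>e2ennreal\<close> and \<open>ennreal\<close> both send negative values to 0, so
  the two sides take the same positive part; the nonnegative weight can be moved inside it.\<close>

lemma nn_integral_density_e2ennreal:
  fixes f :: "'a \<Rightarrow> ereal"
  assumes [measurable]: "\<sigma> \<in> borel_measurable N" "f \<in> borel_measurable N"
    and nn: "\<And>x. \<sigma> x \<ge> (0::real)"
    and eq: "AE x in N. f x = ereal (g x)"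
  shows "(\<integral>\<^sup>+x. e2ennreal (f x) \<partial>density N (\<lambda>x. ennreal (\<sigma> x))) = (\<integral>\<^sup>+x. ennreal (g x * \<sigma> x) \<partial>N)"
proof -
  have "(\<integral>\<^sup>+x. e2ennreal (f x) \<partial>density N (\<lambda>x. ennreal (\<sigma> x))) = (\<integral>\<^sup>+x. ennreal (\<sigma> x) * e2ennreal (f x) \<partial>N)"
    by (rule nn_integral_density) measurable
  also have "\<dots> = (\<integral>\<^sup>+x. ennreal (g x * \<sigma> x) \<partial>N)"
  proof (rule nn_integral_cong_AE)
    show "AE x in N. ennreal (\<sigma> x) * e2ennreal (f x) = ennreal (g x * \<sigma> x)"
      using eq by eventually_elim (simp add: ennreal_mult'[symmetric] nn mult.commute)
  qed
  finally show ?thesis .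
qed

lemma ereal_integral_density:
  fixes f :: "'a \<Rightarrow> ereal"
  assumes [measurable]: "\<sigma> \<in> borel_measurable N" "f \<in> borel_measurable N"
    and nn: "\<And>x. \<sigma> x \<ge> (0::real)"
    and eq: "AE x in N. f x = ereal (g x)"
  shows "ereal_integral (density N (\<lambda>x. ennreal (\<sigma> x))) f =
     enn2ereal (\<integral>\<^sup>+x. ennreal (g x * \<sigma> x) \<partial>N) - enn2ereal (\<integral>\<^sup>+x. ennreal (- (g x * \<sigma> x)) \<partial>N)"
proof -
  have eq': "AE x in N. - f x = ereal (- g x)"
    using eq by eventually_elim simp
  have "(\<integral>\<^sup>+x. e2ennreal (- f x) \<partial>density N (\<lambda>x. ennreal (\<sigma> x))) = (\<integral>\<^sup>+x. ennreal (- g x * \<sigma> x) \<partial>N)"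
    by (rule nn_integral_density_e2ennreal) (use nn eq' in auto)
  then show ?thesis
    unfolding ereal_integral_def
    by (simp add: nn_integral_density_e2ennreal[OF assms])
qed

lemma ereal_integral_density_integrable:
  fixes f :: "'a \<Rightarrow> ereal"
  assumes "\<sigma> \<in> borel_measurable N" "f \<in> borel_measurable N"
    and "\<And>x. \<sigma> x \<ge> (0::real)" "AE x in N. f x = ereal (g x)"
    and int: "integrable N (\<lambda>x. g x * \<sigma> x)"
  shows "ereal_integral (density N (\<lambda>x. ennreal (\<sigma> x))) f = ereal (integral\<^sup>L N (\<lambda>x. g x * \<sigma> x))"
proof -
  have "(\<integral>\<^sup>+x. ennreal (g x * \<sigma> x) \<partial>N) \<noteq> \<infinity>" "(\<integral>\<^sup>+x. ennreal (- (g x * \<sigma> x)) \<partial>N) \<noteq> \<infinity>"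
    using int by (auto simp: real_integrable_def)
  then show ?thesis
    unfolding ereal_integral_density[OF assms(1-4)] real_lebesgue_integral_def[OF int]
    by (cases rule: ennreal2_cases[of "(\<integral>\<^sup>+x. ennreal (g x * \<sigma> x) \<partial>N)" "(\<integral>\<^sup>+x. ennreal (- (g x * \<sigma> x)) \<partial>N)"])
       (auto simp: enn2ereal_ennreal)
qed

text \<open>An infinite positive part would make the difference infinite whatever is subtracted,
  because \<infinity> - \<infinity> = \<infinity> in \<open>ereal\<close>. Hence a value other than
  \<infinity> already bounds the positive part.\<close>

lemma ereal_integral_density_not_top:
  fixes f :: "'a \<Rightarrow> ereal"
  assumes [measurable]: "\<sigma> \<in> borel_measurable N" "f \<in> borel_measurable N" "g \<in> borel_measurable N"
    and nn: "\<And>x. \<sigma> x \<ge> (0::real)" and eq: "AE x in N. f x = ereal (g x)"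
    and fin: "ereal_integral (density N (\<lambda>x. ennreal (\<sigma> x))) f \<noteq> \<infinity>"
    and low: "(\<integral>\<^sup>+x. ennreal (- (g x * \<sigma> x)) \<partial>N) < \<infinity>"
  shows "integrable N (\<lambda>x. g x * \<sigma> x)"
proof -
  have "(\<integral>\<^sup>+x. ennreal (g x * \<sigma> x) \<partial>N) \<noteq> \<infinity>"
    using fin unfolding ereal_integral_density[OF assms(1,2) nn eq] by auto
  then show ?thesis
    using low by (auto simp: real_integrable_def)
qed

definition log_kern :: "complex \<times> complex \<Rightarrow> real" where
  "log_kern = (\<lambda>(w, z). - ln (norm (w - z)))"

definition ln1p_norm :: "complex \<Rightarrow> real" where
  "ln1p_norm x = ln (1 + norm x)"

lemma ln1p_norm_nonneg [simp]: "0 \<le> ln1p_norm x"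
  by (simp add: ln1p_norm_def)

lemma borel_measurable_ln1p_norm [measurable]: "ln1p_norm \<in> borel_measurable borel"
  unfolding ln1p_norm_def[abs_def] by measurable

lemma log_kern_measurable [measurable]: "log_kern \<in> borel_measurable (lborel \<Otimes>\<^sub>M lborel)"
  unfolding log_kern_def by measurable

text \<open>From |w - z| \<le> (1 + |w|) (1 + |z|). The bound separates the variables, so the
  negative part of the kernel is controlled by the moments of \<open>ln1p_norm\<close>.\<close>

lemma ln_norm_diff_le: "ln (norm (w - z)) \<le> ln1p_norm w + ln1p_norm z"
proof (cases "w = z")
  case False
  have "0 \<le> norm w * norm z" by simp
  moreover have "(1 + norm w) * (1 + norm z) = 1 + norm w + norm z + norm w * norm z"
    by (simp add: algebra_simps)
  ultimately have "norm (w - z) \<le> (1 + norm w) * (1 + norm z)"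
    using norm_triangle_ineq4[of w z] by linarith
  moreover have "1 + norm w > 0" "1 + norm z > 0" by (simp_all add: add_pos_nonneg)
  ultimately show ?thesis
    using False unfolding ln1p_norm_def by (subst ln_mult_pos[symmetric]) (auto simp del: ln_mult_pos)
qed simp

lemma neg_log_kern_le: "- log_kern (w, z) \<le> ln1p_norm w + ln1p_norm z"
  using ln_norm_diff_le[of w z] by (simp add: log_kern_def)

lemma abs_log_kern_le:
  "\<bar>log_kern (w, z)\<bar> \<le> ln1p_norm w + ln1p_norm z + (if norm (w - z) \<le> 1 then 1 / norm (w - z) else 0)"
proof (cases "norm (w - z) \<le> 1")
  case True
  have "- ln (norm (w - z)) \<le> 1 / norm (w - z)"
  proof (cases "w = z")
    case False
    then show ?thesis
      using ln_le_minus_one[of "1 / norm (w - z)"] by (simp add: ln_div)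
  qed simp
  moreover have "ln (norm (w - z)) \<le> 0"
    using True by (cases "w = z") auto
  ultimately show ?thesis
    using True by (simp add: log_kern_def add_increasing)
next
  case False
  then have "ln (norm (w - z)) \<ge> 0" by simp
  then show ?thesis
    using False ln_norm_diff_le[of w z] by (simp add: log_kern_def)
qed

lemma AE_lborel_pair_neq: "AE x in (lborel \<Otimes>\<^sub>M lborel :: (complex \<times> complex) measure). fst x \<noteq> snd x"
proof (rule lborel_pair.AE_pair_measure)
  show "AE x in lborel. AE y in lborel. fst (x, y) \<noteq> snd (x, y :: complex)"
  proof (rule AE_I2)
    fix x :: complex
    show "AE y in lborel. fst (x, y) \<noteq> snd (x, y)"
      using AE_lborel_singleton[of x] by eventually_elim auto
  qed
  show "{x \<in> space (lborel \<Otimes>\<^sub>M lborel). fst x \<noteq> snd (x :: complex \<times> complex)} \<in> sets (lborel \<Otimes>\<^sub>M lborel)"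
    by measurable
qed

lemma log_kernel_measurable [measurable]:
  "(\<lambda>(w, z). log_kernel w z) \<in> borel_measurable (lborel \<Otimes>\<^sub>M lborel)"
  unfolding log_kernel_def by measurable

lemma log_energy_pair_density:
  assumes [measurable]: "\<sigma> \<in> borel_measurable borel" and nn: "\<And>x. \<sigma> x \<ge> (0::real)"
    and "prob_space (density lborel (\<lambda>x. ennreal (\<sigma> x)))"
  shows "density lborel (\<lambda>x. ennreal (\<sigma> x)) \<Otimes>\<^sub>M density lborel (\<lambda>x. ennreal (\<sigma> x)) =
    density (lborel \<Otimes>\<^sub>M lborel) (\<lambda>x. ennreal (\<sigma> (fst x) * \<sigma> (snd x)))"
proof -
  interpret prob_space "density lborel (\<lambda>x. ennreal (\<sigma> x))" by fact
  have "sigma_finite_measure (density lborel (\<lambda>x. ennreal (\<sigma> x)))" by unfold_locales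
  then show ?thesis
    by (subst pair_measure_density)
       (auto simp: sigma_finite_lborel case_prod_unfold ennreal_mult''[symmetric] nn)
qed

text \<open>The kernels differ only on the diagonal, where the real one takes the value 0 instead of
  \<infinity>; the diagonal is a null set.\<close>

lemma log_kernel_eq_AE:
  "AE x in (lborel \<Otimes>\<^sub>M lborel). (case x of (w, z) \<Rightarrow> log_kernel w z) = ereal (log_kern x)"
  using AE_lborel_pair_neq
  by eventually_elim (auto simp: log_kernel_def log_kern_def ln_div)

lemma prob_space_densityI:
  assumes [measurable]: "\<sigma> \<in> borel_measurable borel" and nn: "\<And>x. \<sigma> x \<ge> (0::real)"
    and "integrable lborel \<sigma>" "integral\<^sup>L lborel \<sigma> = 1"
  shows "prob_space (density lborel (\<lambda>x::complex. ennreal (\<sigma> x)))"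
proof (rule prob_spaceI)
  have "(\<integral>\<^sup>+x. ennreal (\<sigma> x) \<partial>lborel) = ennreal (integral\<^sup>L lborel \<sigma>)"
    by (rule nn_integral_eq_integral) (use assms in auto)
  then show "emeasure (density lborel (\<lambda>x::complex. ennreal (\<sigma> x))) (space (density lborel (\<lambda>x. ennreal (\<sigma> x)))) = 1"
    by (simp add: emeasure_density assms(4))
qed

lemma integrable_of_prob_space_density:
  assumes [measurable]: "\<sigma> \<in> borel_measurable borel" and nn: "\<And>x. \<sigma> x \<ge> (0::real)"
    and "prob_space (density lborel (\<lambda>x::complex. ennreal (\<sigma> x)))"
  shows "integrable lborel \<sigma>" "integral\<^sup>L lborel \<sigma> = 1"
proof -
  interpret prob_space "density lborel (\<lambda>x. ennreal (\<sigma> x))" by fact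
  have 1: "(\<integral>\<^sup>+x. ennreal (\<sigma> x) \<partial>lborel) = 1"
    using emeasure_space_1 by (simp add: emeasure_density)
  then show "integrable lborel \<sigma>"
    by (intro integrableI_nonneg) (auto simp: nn)
  then show "integral\<^sup>L lborel \<sigma> = 1"
    using nn_integral_eq_integral[of lborel \<sigma>] 1 nn by (simp add: integral_nonneg_AE)
qed

text \<open>The integrand of the mutual energy. It is bilinear in the densities, which expands the
  energy of a convex combination into four terms.\<close>

definition mutual :: "(complex \<Rightarrow> real) \<Rightarrow> (complex \<Rightarrow> real) \<Rightarrow> complex \<times> complex \<Rightarrow> real" where
  "mutual \<rho> \<sigma> x = log_kern x * (\<rho> (fst x) * \<sigma> (snd x))"

lemma nonneg_of_small_perturbation:
  fixes a b :: real
  assumes "\<And>t. 0 < t \<Longrightarrow> t \<le> 1 \<Longrightarrow> 0 \<le> t * a + t\<^sup>2 * b"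
  shows "a \<ge> 0"
proof (rule ccontr)
  assume "\<not> a \<ge> 0"
  \<comment> \<open>Chosen so that t |b| is at most half of |a|; then a + t b is still
    negative.\<close>
  define t where "t = min 1 (- a / (2 * (\<bar>b\<bar> + 1)))"
  have t: "0 < t" "t \<le> 1" using \<open>\<not> a \<ge> 0\<close> by (auto simp: t_def divide_neg_pos)
  have "t * \<bar>b\<bar> \<le> t * (\<bar>b\<bar> + 1)" using t by simp
  also have "\<dots> \<le> - a / (2 * (\<bar>b\<bar> + 1)) * (\<bar>b\<bar> + 1)"
    by (intro mult_right_mono) (auto simp: t_def)
  also have "\<dots> = - a / 2"
  proof -
    have "\<bar>b\<bar> + 1 \<noteq> 0" by linarith
    then show ?thesis by (simp add: field_simps)
  qed
  finally have "t * b \<le> - a / 2"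
    using mult_left_mono[OF abs_ge_self[of b], of t] t by linarith
  then have "a + t * b < 0" using \<open>\<not> a \<ge> 0\<close> by linarith
  then have "t * (a + t * b) < 0" using t by (simp add: mult_pos_neg)
  then show False using assms[OF t] by (simp add: algebra_simps power2_eq_square)
qed


lemma log_energy_density_integrable:
  assumes [measurable]: "\<sigma> \<in> borel_measurable borel" and nn: "\<And>x. \<sigma> x \<ge> (0::real)"
    and prob: "prob_space (density lborel (\<lambda>x. ennreal (\<sigma> x)))"
    and int: "integrable (lborel \<Otimes>\<^sub>M lborel) (mutual \<sigma> \<sigma>)"
  shows "log_energy (density lborel (\<lambda>x. ennreal (\<sigma> x))) = ereal (integral\<^sup>L (lborel \<Otimes>\<^sub>M lborel) (mutual \<sigma> \<sigma>))"
  unfolding log_energy_def log_energy_pair_density[OF assms(1-3)]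
  by (subst ereal_integral_density_integrable[where g = log_kern])
     (use nn log_kernel_eq_AE int in \<open>auto simp: mutual_def[abs_def]\<close>)

lemma integrable_fst_snd_mult:
  fixes f g :: "complex \<Rightarrow> real"
  assumes f: "integrable lborel f" and g: "integrable lborel g"
  shows "integrable (lborel \<Otimes>\<^sub>M lborel) (\<lambda>x. f (fst x) * g (snd x))"
proof (rule lborel_pair.Fubini_integrable)
  have [measurable]: "f \<in> borel_measurable borel" "g \<in> borel_measurable borel"
    using f g by auto
  show "(\<lambda>x. f (fst x) * g (snd x)) \<in> borel_measurable (lborel \<Otimes>\<^sub>M lborel)"
    by measurable
  have "integrable lborel (\<lambda>x. \<bar>f x\<bar> * (LINT y|lborel. \<bar>g y\<bar>))"
    by (intro integrable_mult_left integrable_abs f)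
  then show "integrable lborel (\<lambda>x. LINT y|lborel. norm (f (fst (x, y)) * g (snd (x, y))))"
    by (simp add: abs_mult)
  show "AE x in lborel. integrable lborel (\<lambda>y. f (fst (x, y)) * g (snd (x, y)))"
    by (intro AE_I2) (simp add: g)
qed

lemma integrable_ln1p_norm_pair:
  assumes int: "integrable lborel \<rho>" "integrable lborel \<sigma>"
    and L: "integrable lborel (\<lambda>x. ln1p_norm x * \<rho> x)" "integrable lborel (\<lambda>x. ln1p_norm x * \<sigma> x)"
  shows "integrable (lborel \<Otimes>\<^sub>M lborel) (\<lambda>x. (ln1p_norm (fst x) + ln1p_norm (snd x)) * (\<rho> (fst x) * \<sigma> (snd x)))"
proof -
  have "integrable (lborel \<Otimes>\<^sub>M lborel) (\<lambda>x. (ln1p_norm (fst x) * \<rho> (fst x)) * \<sigma> (snd x) + \<rho> (fst x) * (ln1p_norm (snd x) * \<sigma> (snd x)))"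
    by (intro Bochner_Integration.integrable_add integrable_fst_snd_mult[OF L(1) int(2)] integrable_fst_snd_mult[OF int(1) L(2)])
  then show ?thesis by (simp add: algebra_simps)
qed

lemma (in bounded_density) integrable_mult_ln1p_norm: "integrable lborel (\<lambda>x. ln1p_norm x * \<rho> x)"
proof (rule Bochner_Integration.integrable_bound)
  show "integrable lborel (\<lambda>x. R * \<rho> x)" by (intro integrable_mult_right integrable_density)
  have "norm (ln1p_norm x * \<rho> x) \<le> norm (R * \<rho> x)" for x
  proof (cases "norm x \<le> R")
    case True
    have "ln1p_norm x \<le> norm x" unfolding ln1p_norm_def by (rule ln_add_one_self_le_self) simp
    then have "ln1p_norm x * \<rho> x \<le> R * \<rho> x" using True nonneg by (intro mult_right_mono) auto
    then show ?thesis using nonneg[of x] R0 by (simp add: abs_mult)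
  qed (simp add: supp)
  then show "AE x in lborel. norm (ln1p_norm x * \<rho> x) \<le> norm (R * \<rho> x)" by simp
qed measurable

text \<open>One bounded density is enough: the singular part of the kernel integrates over it to at
  most 2 \<pi> M, uniformly in the other variable, and the rest separates by
  \<open>ln1p_norm\<close>. This pairs a test density with the minimizer, about which no bound is
  known yet.\<close>

lemma (in bounded_density) integrable_mutual:
  assumes [measurable]: "\<sigma> \<in> borel_measurable borel" and nn: "\<And>x. \<sigma> x \<ge> (0::real)"
    and int: "integrable lborel \<sigma>" and L: "integrable lborel (\<lambda>x. ln1p_norm x * \<sigma> x)"
  shows "integrable (lborel \<Otimes>\<^sub>M lborel) (mutual \<sigma> \<rho>)"
proof (rule Bochner_Integration.integrable_bound)
  define H where "H x = \<sigma> (fst x) * (if norm (fst x - snd x) \<le> 1 then \<rho> (snd x) / norm (fst x - snd x) else 0)" for x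
  have [measurable]: "H \<in> borel_measurable (lborel \<Otimes>\<^sub>M lborel)"
    unfolding H_def by measurable
  have H0: "H x \<ge> 0" for x
    unfolding H_def using nn nonneg by simp
  have "integrable (lborel \<Otimes>\<^sub>M lborel) H"
  proof (rule integrableI_nonneg)
    have "(\<integral>\<^sup>+x. ennreal (H x) \<partial>(lborel \<Otimes>\<^sub>M lborel)) = (\<integral>\<^sup>+w. \<integral>\<^sup>+z. ennreal (H (w, z)) \<partial>lborel \<partial>lborel)"
      by (rule lborel.nn_integral_fst[symmetric]) measurable
    also have "\<dots> = (\<integral>\<^sup>+w. ennreal (\<sigma> w) * (\<integral>\<^sup>+z. ennreal (\<rho> z / norm (w - z)) * indicator (cball w 1) z \<partial>lborel) \<partial>lborel)"
    proof (rule nn_integral_cong)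
      fix w
      have "(\<integral>\<^sup>+z. ennreal (H (w, z)) \<partial>lborel) = (\<integral>\<^sup>+z. ennreal (\<sigma> w) * (ennreal (\<rho> z / norm (w - z)) * indicator (cball w 1) z) \<partial>lborel)"
        by (intro nn_integral_cong) (auto simp: H_def nn dist_norm ennreal_mult' split: split_indicator)
      also have "\<dots> = ennreal (\<sigma> w) * (\<integral>\<^sup>+z. ennreal (\<rho> z / norm (w - z)) * indicator (cball w 1) z \<partial>lborel)"
        by (rule nn_integral_cmult) measurable
      finally show "(\<integral>\<^sup>+z. ennreal (H (w, z)) \<partial>lborel) = ennreal (\<sigma> w) * (\<integral>\<^sup>+z. ennreal (\<rho> z / norm (w - z)) * indicator (cball w 1) z \<partial>lborel)" .
    qed
    also have "\<dots> \<le> (\<integral>\<^sup>+w. ennreal (\<sigma> w) * ennreal (2 * pi * M * 1) \<partial>lborel)"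
      by (intro nn_integral_mono mult_left_mono nn_integral_kernel_near) auto
    also have "\<dots> = (\<integral>\<^sup>+w. ennreal (\<sigma> w) \<partial>lborel) * ennreal (2 * pi * M * 1)"
      by (rule nn_integral_multc) measurable
    also have "(\<integral>\<^sup>+w. ennreal (\<sigma> w) \<partial>lborel) = ennreal (integral\<^sup>L lborel \<sigma>)"
      by (rule nn_integral_eq_integral[OF int]) (simp add: nn)
    also have "ennreal (integral\<^sup>L lborel \<sigma>) * ennreal (2 * pi * M * 1) < \<infinity>"
      by (simp add: ennreal_mult_less_top)
    finally show "(\<integral>\<^sup>+x. ennreal (H x) \<partial>(lborel \<Otimes>\<^sub>M lborel)) < \<infinity>" .
  qed (use H0 in auto)
  then show "integrable (lborel \<Otimes>\<^sub>M lborel) (\<lambda>x. (ln1p_norm (fst x) + ln1p_norm (snd x)) * (\<sigma> (fst x) * \<rho> (snd x)) + H x)"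
    by (intro Bochner_Integration.integrable_add integrable_ln1p_norm_pair int L integrable_density integrable_mult_ln1p_norm)
  have "norm (mutual \<sigma> \<rho> (w, z)) \<le> (ln1p_norm w + ln1p_norm z) * (\<sigma> w * \<rho> z) + H (w, z)" for w z
  proof -
    have "\<bar>log_kern (w, z)\<bar> * (\<sigma> w * \<rho> z) \<le> (ln1p_norm w + ln1p_norm z + (if norm (w - z) \<le> 1 then 1 / norm (w - z) else 0)) * (\<sigma> w * \<rho> z)"
      by (intro mult_right_mono abs_log_kern_le mult_nonneg_nonneg nn nonneg)
    also have "\<dots> = (ln1p_norm w + ln1p_norm z) * (\<sigma> w * \<rho> z) + H (w, z)"
      by (simp add: H_def algebra_simps)
    finally show ?thesis using nn[of w] nonneg[of z] by (simp add: mutual_def abs_mult)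
  qed
  then show "AE x in lborel \<Otimes>\<^sub>M lborel. norm (mutual \<sigma> \<rho> x) \<le> norm ((ln1p_norm (fst x) + ln1p_norm (snd x)) * (\<sigma> (fst x) * \<rho> (snd x)) + H x)"
    by (intro AE_I2) (metis abs_ge_self order_trans prod.collapse real_norm_def)
  show "mutual \<sigma> \<rho> \<in> borel_measurable (lborel \<Otimes>\<^sub>M lborel)"
    unfolding mutual_def[abs_def] by measurable
qed

lemma mutual_swap: "mutual \<rho> \<sigma> = (\<lambda>(x, y). mutual \<sigma> \<rho> (y, x))"
  by (auto simp: mutual_def log_kern_def norm_minus_commute fun_eq_iff)

lemma integrable_mutual_swap:
  "integrable (lborel \<Otimes>\<^sub>M lborel) (mutual \<sigma> \<rho>) \<Longrightarrow> integrable (lborel \<Otimes>\<^sub>M lborel) (mutual \<rho> \<sigma>)"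
  by (subst mutual_swap) (rule lborel_pair.integrable_product_swap)

lemma integral_mutual_swap:
  assumes "integrable (lborel \<Otimes>\<^sub>M lborel) (mutual \<sigma> \<rho>)"
  shows "integral\<^sup>L (lborel \<Otimes>\<^sub>M lborel) (mutual \<rho> \<sigma>) = integral\<^sup>L (lborel \<Otimes>\<^sub>M lborel) (mutual \<sigma> \<rho>)"
  by (subst mutual_swap) (rule lborel_pair.integral_product_swap, use assms in measurable)

lemma mutual_potential:
  assumes int: "integrable (lborel \<Otimes>\<^sub>M lborel) (mutual \<rho> \<sigma>)"
  shows "integrable lborel (\<lambda>z. log_potential \<rho> z * \<sigma> z)"
    and "(LINT z|lborel. log_potential \<rho> z * \<sigma> z) = integral\<^sup>L (lborel \<Otimes>\<^sub>M lborel) (mutual \<rho> \<sigma>)"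
proof -
  have eq: "(LINT w|lborel. mutual \<rho> \<sigma> (w, z)) = log_potential \<rho> z * \<sigma> z" for z
  proof -
    have "(LINT w|lborel. mutual \<rho> \<sigma> (w, z)) = (LINT w|lborel. (- ln (norm (z - w)) * \<rho> w) * \<sigma> z)"
      by (intro Bochner_Integration.integral_cong) (auto simp: mutual_def log_kern_def norm_minus_commute)
    also have "\<dots> = log_potential \<rho> z * \<sigma> z"
      unfolding log_potential_def by (rule integral_mult_left_zero)
    finally show ?thesis .
  qed
  have int': "integrable (lborel \<Otimes>\<^sub>M lborel) (case_prod (\<lambda>w z. mutual \<rho> \<sigma> (w, z)))"
    using int by simp
  show "integrable lborel (\<lambda>z. log_potential \<rho> z * \<sigma> z)"
    using lborel_pair.integrable_snd[OF int'] by (simp add: eq)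
  show "(LINT z|lborel. log_potential \<rho> z * \<sigma> z) = integral\<^sup>L (lborel \<Otimes>\<^sub>M lborel) (mutual \<rho> \<sigma>)"
    using lborel_pair.integral_snd[OF int'] by (simp add: eq)
qed

subsection \<open>Frostman conditions\<close>

text \<open>\<open>p\<close> is a real-valued version of the field; it may differ from
  \<open>P\<close> at the finitely many point charges, a null set. \<open>lower\<close> controls the
  negative parts of the field energy and of the logarithmic energy; \<open>growth\<close> makes the
  support bounded.\<close>

locale weighted_minimizer =
  fixes P :: "complex \<Rightarrow> ereal" and p \<rho> :: "complex \<Rightarrow> real" and Z :: "complex set" and K :: real
  assumes P_eq: "\<And>x. x \<notin> Z \<Longrightarrow> P x = ereal (p x)"
    and finite_Z: "finite Z"
    and P_meas [measurable]: "P \<in> borel_measurable borel"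
    and p_meas [measurable]: "p \<in> borel_measurable borel"
    and meas [measurable]: "\<rho> \<in> borel_measurable borel"
    and nonneg: "\<And>x. \<rho> x \<ge> 0"
    and lower: "\<And>x. ln1p_norm x - K \<le> p x"
    and local_int: "\<And>R. integrable lborel (\<lambda>x. p x * indicator (cball 0 R) x)"
    and growth: "\<And>c. \<exists>R. \<forall>x. norm x > R \<longrightarrow> p x - ln1p_norm x > c"
    and minimal: "energy_minimizer P (density lborel (\<lambda>x. ennreal (\<rho> x)))"
begin

lemma P_AE: "AE x in lborel. P x = ereal (p x)"
proof -
  have "Z \<in> null_sets lborel" using finite_Z by (rule finite_imp_null_set_lborel)
  then have "AE x in lborel. x \<notin> Z" by (rule AE_not_in)
  then show ?thesis by eventually_elim (rule P_eq)
qed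

lemma prob: "prob_space (density lborel (\<lambda>x. ennreal (\<rho> x)))"
  using minimal by (simp add: energy_minimizer_def prob_measures_def)

lemma int: "integrable lborel \<rho>" and int_1: "integral\<^sup>L lborel \<rho> = 1"
  using integrable_of_prob_space_density[OF meas nonneg prob] by auto

lemma weighted_energy_density:
  assumes [measurable]: "\<sigma> \<in> borel_measurable borel" and nn: "\<And>x. \<sigma> x \<ge> (0::real)"
    and "prob_space (density lborel (\<lambda>x. ennreal (\<sigma> x)))"
    and "integrable (lborel \<Otimes>\<^sub>M lborel) (mutual \<sigma> \<sigma>)"
    and pint: "integrable lborel (\<lambda>x. p x * \<sigma> x)"
  shows "weighted_energy P (density lborel (\<lambda>x. ennreal (\<sigma> x))) =
    ereal (integral\<^sup>L (lborel \<Otimes>\<^sub>M lborel) (mutual \<sigma> \<sigma>) + 2 * (LINT x|lborel. p x * \<sigma> x))"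
proof -
  have "ereal_integral (density lborel (\<lambda>x. ennreal (\<sigma> x))) P = ereal (LINT x|lborel. p x * \<sigma> x)"
    by (rule ereal_integral_density_integrable[OF _ _ nn P_AE pint]) measurable
  then show ?thesis
    unfolding weighted_energy_def log_energy_density_integrable[OF assms(1-4)] by simp
qed

lemma energy_le:
  assumes [measurable]: "\<sigma> \<in> borel_measurable borel" and nn: "\<And>x. \<sigma> x \<ge> (0::real)"
    and "integrable lborel \<sigma>" "integral\<^sup>L lborel \<sigma> = 1"
    and "integrable (lborel \<Otimes>\<^sub>M lborel) (mutual \<sigma> \<sigma>)" "integrable lborel (\<lambda>x. p x * \<sigma> x)"
  shows "weighted_energy P (density lborel (\<lambda>x. ennreal (\<rho> x))) \<le>
    ereal (integral\<^sup>L (lborel \<Otimes>\<^sub>M lborel) (mutual \<sigma> \<sigma>) + 2 * (LINT x|lborel. p x * \<sigma> x))"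
proof -
  have prob\<sigma>: "prob_space (density lborel (\<lambda>x. ennreal (\<sigma> x)))"
    by (rule prob_space_densityI[OF assms(1-4)])
  then have "density lborel (\<lambda>x. ennreal (\<sigma> x)) \<in> prob_measures"
    by (simp add: prob_measures_def)
  then show ?thesis
    using minimal weighted_energy_density[OF assms(1,2) prob\<sigma> assms(5,6)]
    unfolding energy_minimizer_def by metis
qed

lemma integrable_field_bounded_density:
  assumes "bounded_density \<sigma> M R"
  shows "integrable lborel (\<lambda>x. p x * \<sigma> x)"
proof (rule Bochner_Integration.integrable_bound)
  interpret bounded_density \<sigma> M R by fact
  show "integrable lborel (\<lambda>x. M * (p x * indicator (cball 0 R) x))"
    by (intro integrable_mult_right local_int)
  have "norm (p x * \<sigma> x) \<le> norm (M * (p x * indicator (cball 0 R) x))" for x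
    using mult_left_mono[OF le_indicator[of x], of "\<bar>p x\<bar>"] nonneg[of x] M0
    by (simp add: abs_mult mult_ac)
  then show "AE x in lborel. norm (p x * \<sigma> x) \<le> norm (M * (p x * indicator (cball 0 R) x))"
    by simp
  show "(\<lambda>x. p x * \<sigma> x) \<in> borel_measurable lborel"
    using bounded_density.meas[OF assms] by measurable
qed

text \<open>Comparison with the uniform measure on the unit disc. Finiteness of the minimum is what
  lets integrability of the separate energy terms be read off.\<close>

lemma energy_not_top: "weighted_energy P (density lborel (\<lambda>x. ennreal (\<rho> x))) < \<infinity>"
proof -
  define \<sigma> :: "complex \<Rightarrow> real" where "\<sigma> x = 1 / pi * indicator (cball 0 1) x" for x
  have [measurable]: "\<sigma> \<in> borel_measurable borel"
    unfolding \<sigma>_def[abs_def] by measurable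
  interpret \<sigma>: bounded_density \<sigma> "1 / pi" 1
    by unfold_locales (auto simp: \<sigma>_def split: split_indicator)
  have "integral\<^sup>L lborel \<sigma> = 1"
    unfolding \<sigma>_def by (simp add: content_cball unit_ball_vol_2)
  then have "weighted_energy P (density lborel (\<lambda>x. ennreal (\<rho> x))) \<le>
    ereal (integral\<^sup>L (lborel \<Otimes>\<^sub>M lborel) (mutual \<sigma> \<sigma>) + 2 * (LINT x|lborel. p x * \<sigma> x))"
    by (intro energy_le \<sigma>.meas \<sigma>.nonneg \<sigma>.integrable_density \<sigma>.integrable_mutual \<sigma>.integrable_mult_ln1p_norm
        integrable_field_bounded_density[OF \<sigma>.bounded_density_axioms])
  also have "\<dots> < \<infinity>" by simp
  finally show ?thesis .
qed

lemma field_int: "integrable lborel (\<lambda>x. p x * \<rho> x)"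
proof (rule ereal_integral_density_not_top[OF _ _ _ nonneg P_AE])
  \<comment> \<open>In \<open>ereal\<close> a sum with a summand \<infinity> is \<infinity>, even if
    the other one is -\<infinity>; hence neither summand is \<infinity>.\<close>
  have "log_energy (density lborel (\<lambda>x. ennreal (\<rho> x))) + 2 * ereal_integral (density lborel (\<lambda>x. ennreal (\<rho> x))) P \<noteq> \<infinity>"
    using energy_not_top unfolding weighted_energy_def by auto
  then show "ereal_integral (density lborel (\<lambda>x. ennreal (\<rho> x))) P \<noteq> \<infinity>"
    by auto
  have "(\<integral>\<^sup>+x. ennreal (- (p x * \<rho> x)) \<partial>lborel) \<le> (\<integral>\<^sup>+x. ennreal (\<bar>K\<bar> * \<rho> x) \<partial>lborel)"
  proof (intro nn_integral_mono ennreal_leI)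
    fix x
    have "- p x \<le> \<bar>K\<bar>" using lower[of x] ln1p_norm_nonneg[of x] by linarith
    then have "- p x * \<rho> x \<le> \<bar>K\<bar> * \<rho> x" using nonneg by (rule mult_right_mono)
    then show "- (p x * \<rho> x) \<le> \<bar>K\<bar> * \<rho> x" by simp
  qed
  also have "\<dots> = ennreal (LINT x|lborel. \<bar>K\<bar> * \<rho> x)"
    by (rule nn_integral_eq_integral) (auto intro!: integrable_mult_right int simp: nonneg)
  also have "\<dots> < \<infinity>" by simp
  finally show "(\<integral>\<^sup>+x. ennreal (- (p x * \<rho> x)) \<partial>lborel) < \<infinity>" .
qed measurable

lemma ln1p_norm_int: "integrable lborel (\<lambda>x. ln1p_norm x * \<rho> x)"
proof (rule Bochner_Integration.integrable_bound)
  show "integrable lborel (\<lambda>x. p x * \<rho> x + K * \<rho> x)"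
    by (intro Bochner_Integration.integrable_add integrable_mult_right field_int int)
  have "norm (ln1p_norm x * \<rho> x) \<le> norm (p x * \<rho> x + K * \<rho> x)" for x
  proof -
    have "ln1p_norm x * \<rho> x \<le> (p x + K) * \<rho> x"
      using lower[of x] by (intro mult_right_mono nonneg) linarith
    moreover have "0 \<le> ln1p_norm x * \<rho> x" using nonneg by simp
    ultimately show ?thesis by (simp add: algebra_simps)
  qed
  then show "AE x in lborel. norm (ln1p_norm x * \<rho> x) \<le> norm (p x * \<rho> x + K * \<rho> x)" by simp
qed measurable

lemma mutual_int: "integrable (lborel \<Otimes>\<^sub>M lborel) (mutual \<rho> \<rho>)"
proof -
  let ?\<mu> = "density lborel (\<lambda>x. ennreal (\<rho> x))"
  have "log_energy ?\<mu> + 2 * ereal_integral ?\<mu> P \<noteq> \<infinity>"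
    using energy_not_top unfolding weighted_energy_def by auto
  then have fin: "log_energy ?\<mu> \<noteq> \<infinity>"
    by auto
  have "integrable (lborel \<Otimes>\<^sub>M lborel) (\<lambda>x. log_kern x * (\<rho> (fst x) * \<rho> (snd x)))"
  proof (rule ereal_integral_density_not_top[OF _ _ _ _ log_kernel_eq_AE])
    show "ereal_integral (density (lborel \<Otimes>\<^sub>M lborel) (\<lambda>x. ennreal (\<rho> (fst x) * \<rho> (snd x)))) (\<lambda>(w, z). log_kernel w z) \<noteq> \<infinity>"
      using fin unfolding log_energy_def log_energy_pair_density[OF meas nonneg prob] .
    have "(\<integral>\<^sup>+x. ennreal (- (log_kern x * (\<rho> (fst x) * \<rho> (snd x)))) \<partial>(lborel \<Otimes>\<^sub>M lborel)) \<le>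
       (\<integral>\<^sup>+x. ennreal ((ln1p_norm (fst x) + ln1p_norm (snd x)) * (\<rho> (fst x) * \<rho> (snd x))) \<partial>(lborel \<Otimes>\<^sub>M lborel))"
    proof (intro nn_integral_mono ennreal_leI)
      fix x :: "complex \<times> complex"
      have "- log_kern x * (\<rho> (fst x) * \<rho> (snd x)) \<le> (ln1p_norm (fst x) + ln1p_norm (snd x)) * (\<rho> (fst x) * \<rho> (snd x))"
        using neg_log_kern_le[of "fst x" "snd x"] by (intro mult_right_mono mult_nonneg_nonneg nonneg) simp
      then show "- (log_kern x * (\<rho> (fst x) * \<rho> (snd x))) \<le> (ln1p_norm (fst x) + ln1p_norm (snd x)) * (\<rho> (fst x) * \<rho> (snd x))"
        by simp
    qed
    also have "\<dots> = ennreal (integral\<^sup>L (lborel \<Otimes>\<^sub>M lborel) (\<lambda>x. (ln1p_norm (fst x) + ln1p_norm (snd x)) * (\<rho> (fst x) * \<rho> (snd x))))"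
      by (rule nn_integral_eq_integral[OF integrable_ln1p_norm_pair[OF int int ln1p_norm_int ln1p_norm_int]]) (simp add: nonneg)
    also have "\<dots> < \<infinity>" by simp
    finally show "(\<integral>\<^sup>+x. ennreal (- (log_kern x * (\<rho> (fst x) * \<rho> (snd x)))) \<partial>(lborel \<Otimes>\<^sub>M lborel)) < \<infinity>" .
    show "\<rho> (fst x) * \<rho> (snd x) \<ge> 0" for x by (simp add: nonneg)
  qed measurable
  then show ?thesis unfolding mutual_def[abs_def] .
qed

text \<open>The modified Robin constant, F in the overview: the mean of a function that turns out to
  be constant almost everywhere with respect to the minimizer.\<close>

definition robin :: real where
  "robin = (LINT x|lborel. (log_potential \<rho> x + p x) * \<rho> x)"

text \<open>First variation of the energy along \<open>(1 - t) \<rho> + t \<sigma>\<close>.\<close>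

lemma first_variation:
  assumes "bounded_density \<sigma> M R" and "integral\<^sup>L lborel \<sigma> = 1"
  shows "integrable lborel (\<lambda>x. (log_potential \<rho> x + p x) * \<sigma> x)"
    and "robin \<le> (LINT x|lborel. (log_potential \<rho> x + p x) * \<sigma> x)"
proof -
  interpret \<sigma>: bounded_density \<sigma> M R by fact
  let ?N = "lborel \<Otimes>\<^sub>M lborel :: (complex \<times> complex) measure"
  note p\<sigma> = integrable_field_bounded_density[OF assms(1)]
  note \<rho>\<sigma> = \<sigma>.integrable_mutual[OF meas nonneg int ln1p_norm_int]
  note \<sigma>\<rho> = integrable_mutual_swap[OF \<rho>\<sigma>]
  note \<sigma>\<sigma> = \<sigma>.integrable_mutual[OF \<sigma>.meas \<sigma>.nonneg \<sigma>.integrable_density \<sigma>.integrable_mult_ln1p_norm]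
  define a where "a = integral\<^sup>L ?N (mutual \<rho> \<rho>)"
  define b where "b = integral\<^sup>L ?N (mutual \<rho> \<sigma>)"
  define c where "c = integral\<^sup>L ?N (mutual \<sigma> \<sigma>)"
  define P\<rho> where "P\<rho> = (LINT x|lborel. p x * \<rho> x)"
  define P\<sigma> where "P\<sigma> = (LINT x|lborel. p x * \<sigma> x)"
  have b': "integral\<^sup>L ?N (mutual \<sigma> \<rho>) = b"
    unfolding b_def by (rule integral_mutual_swap[OF \<rho>\<sigma>])
  have "2 * (b + P\<sigma> - (a + P\<rho>)) \<ge> 0"
  proof (rule nonneg_of_small_perturbation)
    fix t :: real assume t: "0 < t" "t \<le> 1"
    define \<tau> where "\<tau> x = (1 - t) * \<rho> x + t * \<sigma> x" for x
    have [measurable]: "\<tau> \<in> borel_measurable borel"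
      unfolding \<tau>_def by measurable
    have \<tau>nn: "\<tau> x \<ge> 0" for x
      using t nonneg \<sigma>.nonneg by (simp add: \<tau>_def)
    have \<tau>int: "integrable lborel \<tau>"
      unfolding \<tau>_def by (intro Bochner_Integration.integrable_add integrable_mult_right int \<sigma>.integrable_density)
    have \<tau>1: "integral\<^sup>L lborel \<tau> = 1"
      unfolding \<tau>_def
      by (subst Bochner_Integration.integral_add) (auto simp: int_1 assms(2) int \<sigma>.integrable_density)
    have p\<tau>: "(\<lambda>x. p x * \<tau> x) = (\<lambda>x. (1 - t) * (p x * \<rho> x) + t * (p x * \<sigma> x))"
      by (auto simp: \<tau>_def algebra_simps)
    have p\<tau>int: "integrable lborel (\<lambda>x. p x * \<tau> x)"
      unfolding p\<tau> by (intro Bochner_Integration.integrable_add integrable_mult_right field_int p\<sigma>)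
    have p\<tau>val: "(LINT x|lborel. p x * \<tau> x) = (1 - t) * P\<rho> + t * P\<sigma>"
      unfolding p\<tau> P\<rho>_def P\<sigma>_def
      by (subst Bochner_Integration.integral_add) (auto intro!: integrable_mult_right field_int p\<sigma>)
    have \<tau>\<tau>: "mutual \<tau> \<tau> = (\<lambda>x. (1 - t)\<^sup>2 * mutual \<rho> \<rho> x + (t * (1 - t) * mutual \<rho> \<sigma> x + (t * (1 - t) * mutual \<sigma> \<rho> x + t\<^sup>2 * mutual \<sigma> \<sigma> x)))"
      by (auto simp: mutual_def \<tau>_def algebra_simps power2_eq_square)
    have \<tau>\<tau>int: "integrable ?N (mutual \<tau> \<tau>)"
      unfolding \<tau>\<tau> by (intro Bochner_Integration.integrable_add integrable_mult_right mutual_int \<rho>\<sigma> \<sigma>\<rho> \<sigma>\<sigma>)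
    have \<tau>\<tau>val: "integral\<^sup>L ?N (mutual \<tau> \<tau>) = (1 - t)\<^sup>2 * a + (t * (1 - t) * b + (t * (1 - t) * b + t\<^sup>2 * c))"
      unfolding \<tau>\<tau>
      by (subst Bochner_Integration.integral_add,
          (intro Bochner_Integration.integrable_add integrable_mult_right mutual_int \<rho>\<sigma> \<sigma>\<rho> \<sigma>\<sigma>)+)+
         (simp add: a_def b_def[symmetric] b' c_def)
    have "weighted_energy P (density lborel (\<lambda>x. ennreal (\<rho> x))) \<le>
      ereal (integral\<^sup>L ?N (mutual \<tau> \<tau>) + 2 * (LINT x|lborel. p x * \<tau> x))"
      by (rule energy_le) (use \<tau>nn \<tau>int \<tau>1 \<tau>\<tau>int p\<tau>int in auto)
    then have "a + 2 * P\<rho> \<le> (1 - t)\<^sup>2 * a + (t * (1 - t) * b + (t * (1 - t) * b + t\<^sup>2 * c)) + 2 * ((1 - t) * P\<rho> + t * P\<sigma>)"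
      unfolding weighted_energy_density[OF meas nonneg prob mutual_int field_int] \<tau>\<tau>val p\<tau>val
      by (simp add: a_def P\<rho>_def)
    then show "0 \<le> t * (2 * (b + P\<sigma> - (a + P\<rho>))) + t\<^sup>2 * (a - 2 * b + c)"
      by (simp add: algebra_simps power2_eq_square)
  qed
  then have le: "a + P\<rho> \<le> b + P\<sigma>" by simp
  note U\<rho> = mutual_potential[OF mutual_int] and U\<sigma> = mutual_potential[OF \<rho>\<sigma>]
  show "integrable lborel (\<lambda>x. (log_potential \<rho> x + p x) * \<sigma> x)"
    unfolding distrib_right by (intro Bochner_Integration.integrable_add U\<sigma> p\<sigma>)
  have "(LINT x|lborel. (log_potential \<rho> x + p x) * \<sigma> x) = b + P\<sigma>"
    unfolding distrib_right b_def P\<sigma>_def U\<sigma>(2)[symmetric]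
    by (rule Bochner_Integration.integral_add[OF U\<sigma>(1) p\<sigma>])
  moreover have "robin = a + P\<rho>"
    unfolding robin_def distrib_right a_def P\<rho>_def U\<rho>(2)[symmetric]
    by (rule Bochner_Integration.integral_add[OF U\<rho>(1) field_int])
  ultimately show "robin \<le> (LINT x|lborel. (log_potential \<rho> x + p x) * \<sigma> x)"
    using le by simp
qed

lemma borel_measurable_log_potential [measurable]: "log_potential \<rho> \<in> borel_measurable borel"
  unfolding log_potential_def[abs_def] by measurable

text \<open>The normalized indicator of the bad set inside a disc is an admissible test density. If
  that set had positive measure, its mean of the effective potential would lie strictly below
  \<open>robin\<close>, against \<open>first_variation\<close>.\<close>

lemma robin_le_AE: "AE x in lborel. robin \<le> log_potential \<rho> x + p x"
proof -
  have *: "AE x in lborel. x \<notin> {x \<in> cball 0 (real k). log_potential \<rho> x + p x < robin}" for k :: nat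
  proof -
    define A where "A = {x \<in> cball 0 (real k). log_potential \<rho> x + p x < robin}"
    have [measurable]: "A \<in> sets borel" unfolding A_def by measurable
    define m where "m = measure lborel A"
    have fin: "emeasure lborel A < \<infinity>"
    proof (rule order_le_less_trans)
      show "emeasure lborel A \<le> emeasure lborel (cball (0 :: complex) (real k))"
        by (rule emeasure_mono) (auto simp: A_def)
      show "emeasure lborel (cball (0 :: complex) (real k)) < \<infinity>"
        by (simp add: emeasure_cball)
    qed
    have em: "emeasure lborel A = ennreal m"
      using fin by (simp add: m_def emeasure_eq_ennreal_measure)
    show ?thesis
    proof (cases "m = 0")
      case True
      then have "A \<in> null_sets lborel" using em by (auto simp: null_sets_def)
      then show ?thesis unfolding A_def[symmetric] by (rule AE_not_in)
    next
      case False
      then have m: "m > 0" by (simp add: m_def zero_less_measure_iff)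
      define \<sigma> where "\<sigma> x = 1 / m * indicator A x" for x
      have [measurable]: "\<sigma> \<in> borel_measurable borel"
        unfolding \<sigma>_def[abs_def] by measurable
      interpret \<sigma>: bounded_density \<sigma> "1 / m" "real k"
        using m by unfold_locales (auto simp: \<sigma>_def A_def split: split_indicator)
      have \<sigma>1: "integral\<^sup>L lborel \<sigma> = 1"
        unfolding \<sigma>_def using m by (simp add: m_def)
      note fv = first_variation[OF \<sigma>.bounded_density_axioms \<sigma>1]
      let ?f = "\<lambda>x. robin * \<sigma> x - (log_potential \<rho> x + p x) * \<sigma> x"
      have f_int: "integrable lborel ?f"
        by (intro Bochner_Integration.integrable_diff integrable_mult_right \<sigma>.integrable_density fv)
      have f_nn: "?f x \<ge> 0" for x
        using m by (auto simp: \<sigma>_def A_def divide_right_mono split: split_indicator)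
      have "integral\<^sup>L lborel ?f = robin - (LINT x|lborel. (log_potential \<rho> x + p x) * \<sigma> x)"
        by (subst Bochner_Integration.integral_diff) (auto intro!: integrable_mult_right \<sigma>.integrable_density fv simp: \<sigma>1)
      then have "integral\<^sup>L lborel ?f = 0"
        using fv(2) integral_nonneg_AE[where M = lborel and f = ?f] f_nn by (simp add: order_antisym)
      then have "AE x in lborel. ?f x = 0"
        by (subst (asm) integral_nonneg_eq_0_iff_AE[OF f_int]) (use f_nn in auto)
      then show ?thesis
      proof eventually_elim
        case (elim x)
        then show ?case using m by (auto simp: \<sigma>_def A_def split: split_indicator_asm)
      qed
    qed
  qed
  have "AE x in lborel. \<forall>k::nat. x \<notin> {x \<in> cball 0 (real k). log_potential \<rho> x + p x < robin}"
    unfolding AE_all_countable using * by blast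
  then show ?thesis
  proof eventually_elim
    case (elim x)
    obtain k :: nat where "norm x \<le> real k" using real_arch_simple by blast
    then show ?case using elim[rule_format, of k] by auto
  qed
qed

text \<open>The excess over \<open>robin\<close>, weighted by \<rho>, is nonnegative almost
  everywhere and integrates to 0 because \<open>robin\<close> is the mean.\<close>

lemma robin_eq_AE: "AE x in lborel. \<rho> x \<noteq> 0 \<longrightarrow> log_potential \<rho> x + p x = robin"
proof -
  note U\<rho> = mutual_potential[OF mutual_int]
  have int1: "integrable lborel (\<lambda>x. (log_potential \<rho> x + p x) * \<rho> x)"
    unfolding distrib_right by (intro Bochner_Integration.integrable_add U\<rho> field_int)
  let ?f = "\<lambda>x. (log_potential \<rho> x + p x) * \<rho> x - robin * \<rho> x"
  have f_int: "integrable lborel ?f"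
    by (intro Bochner_Integration.integrable_diff integrable_mult_right int int1)
  have "integral\<^sup>L lborel ?f = 0"
    by (subst Bochner_Integration.integral_diff[OF int1 integrable_mult_right[OF int]])
       (simp add: int_1 robin_def)
  moreover have "AE x in lborel. ?f x \<ge> 0"
    using robin_le_AE by eventually_elim (simp add: mult_right_mono nonneg)
  ultimately have "AE x in lborel. ?f x = 0"
    using integral_nonneg_eq_0_iff_AE[OF f_int] by simp
  then show ?thesis by eventually_elim auto
qed

text \<open>The potential is bounded below by - \<open>ln1p_norm\<close> minus a constant, while
  \<open>p\<close> exceeds \<open>ln1p_norm\<close> by any amount far out. So the effective
  potential cannot equal \<open>robin\<close> there.\<close>

lemma support_bounded_AE: "\<exists>R\<ge>0. AE x in lborel. \<rho> x \<noteq> 0 \<longrightarrow> norm x \<le> R"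
proof -
  define l where "l = (LINT x|lborel. ln1p_norm x * \<rho> x)"
  have l0: "l \<ge> 0" unfolding l_def by (intro integral_nonneg_AE) (simp add: nonneg)
  have U_ge: "- ln1p_norm x - l \<le> log_potential \<rho> x" for x
  proof (cases "integrable lborel (\<lambda>w. - ln (norm (x - w)) * \<rho> w)")
    case True
    have "(LINT w|lborel. - (ln1p_norm x * \<rho> w + ln1p_norm w * \<rho> w)) \<le> log_potential \<rho> x"
      unfolding log_potential_def
    proof (rule integral_mono[OF _ True])
      show "integrable lborel (\<lambda>w. - (ln1p_norm x * \<rho> w + ln1p_norm w * \<rho> w))"
        by (intro integrable_minus Bochner_Integration.integrable_add integrable_mult_right int ln1p_norm_int)
      show "- (ln1p_norm x * \<rho> w + ln1p_norm w * \<rho> w) \<le> - ln (norm (x - w)) * \<rho> w" for w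
        using mult_right_mono[OF ln_norm_diff_le[of x w] nonneg[of w]] by (simp add: algebra_simps)
    qed
    moreover have "(LINT w|lborel. - (ln1p_norm x * \<rho> w + ln1p_norm w * \<rho> w)) = - ln1p_norm x - l"
      unfolding Bochner_Integration.integral_minus
      by (subst Bochner_Integration.integral_add[OF integrable_mult_right[OF int] ln1p_norm_int]) (simp add: l_def int_1)
    ultimately show ?thesis by simp
  next
    \<comment> \<open>At points where the defining integral does not exist, the potential has the
      default value 0, which satisfies the bound as well.\<close>
    case False
    then show ?thesis
      unfolding log_potential_def not_integrable_integral_eq[OF False] using l0 ln1p_norm_nonneg[of x] by linarith
  qed
  obtain R where R: "\<And>x. norm x > R \<Longrightarrow> p x - ln1p_norm x > robin + l"
    using growth[of "robin + l"] by blast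
  have "AE x in lborel. \<rho> x \<noteq> 0 \<longrightarrow> norm x \<le> max R 0"
    using robin_eq_AE
  proof eventually_elim
    case (elim x)
    show ?case
    proof (intro impI, rule ccontr)
      assume "\<rho> x \<noteq> 0" "\<not> norm x \<le> max R 0"
      then have "p x - ln1p_norm x > robin + l" by (intro R) simp
      then show False using elim \<open>\<rho> x \<noteq> 0\<close> U_ge[of x] by simp
    qed
  qed
  then show ?thesis by (intro exI[of _ "max R 0"]) simp
qed

end

section \<open>Measure supports: from almost everywhere to everywhere\<close>

lemma closed_measure_support: "closed (measure_support \<mu>)"
proof -
  have "- measure_support \<mu> = \<Union> {U. open U \<and> emeasure \<mu> U = 0}"
    by (auto simp: measure_support_def)
  then show ?thesis
    unfolding closed_def by (auto intro: open_Union)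
qed

lemma open_AE_notin_empty:
  fixes N :: "'a::euclidean_space set"
  assumes "open N" "AE y in lborel. y \<notin> N"
  shows "N = {}"
proof -
  have "N \<in> null_sets lborel"
    using assms AE_iff_null_sets[of N lborel] by auto
  then have "negligible N"
    by (simp add: negligible_iff_null_sets null_sets_completionI)
  then show ?thesis using open_not_negligible[OF assms(1)] by blast
qed

text \<open>\<open>max 0\<close> reproduces the truncation that \<open>ennreal\<close> performs on
  the density; \<open>g_nonneg\<close> shows afterwards that nothing is cut off on \<open>S\<close>.
  Continuity of \<open>g\<close> gives the bound on the density, and continuity of \<open>p\<close>
  off the nodes removes the exceptional null sets.\<close>

locale equilibrium = weighted_minimizer +
  fixes g :: "complex \<Rightarrow> real" and S :: "complex set"
  assumes \<rho>_eq: "\<And>x. \<rho> x = max 0 (g x) * indicator S x"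
    and S_eq: "S = measure_support (density lborel (\<lambda>x. ennreal (\<rho> x)))"
    and g_cont: "continuous_on UNIV g"
    and p_cont: "continuous_on (- Z) p"
    and p_pole: "\<And>a. a \<in> Z \<Longrightarrow> filterlim p at_top (at a)"
begin

lemma closed_S: "closed S"
  unfolding S_eq by (rule closed_measure_support)

lemma positive_near_S:
  assumes "x \<in> S" "open N" "x \<in> N" "AE y in lborel. y \<in> N \<longrightarrow> \<rho> y = 0"
  shows False
proof -
  have "emeasure (density lborel (\<lambda>x. ennreal (\<rho> x))) N = (\<integral>\<^sup>+y. ennreal (\<rho> y) * indicator N y \<partial>lborel)"
    using assms(2) by (intro emeasure_density) auto
  also have "\<dots> = (\<integral>\<^sup>+y. 0 \<partial>(lborel :: complex measure))"
  proof (rule nn_integral_cong_AE)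
    show "AE y in lborel. ennreal (\<rho> y) * indicator N y = 0"
      using assms(4) by eventually_elim (auto split: split_indicator)
  qed
  finally show False
    using assms(1-3) unfolding S_eq measure_support_def by auto
qed

lemma g_nonneg: "x \<in> S \<Longrightarrow> g x \<ge> 0"
proof (rule ccontr)
  assume x: "x \<in> S" "\<not> g x \<ge> 0"
  have "open {y. g y < 0}"
    using open_Collect_less[OF g_cont continuous_on_const] by simp
  moreover have "AE y in lborel. y \<in> {y. g y < 0} \<longrightarrow> \<rho> y = 0"
    by (simp add: \<rho>_eq)
  ultimately show False using positive_near_S[OF x(1), of "{y. g y < 0}"] x(2) by auto
qed

lemma bounded_S: "\<exists>R\<ge>0. S \<subseteq> cball 0 R"
proof -
  obtain R where R: "R \<ge> 0" "AE x in lborel. \<rho> x \<noteq> 0 \<longrightarrow> norm x \<le> R"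
    using support_bounded_AE by blast
  have "S \<subseteq> cball 0 R"
  proof (rule subsetI, rule ccontr)
    fix x assume x: "x \<in> S" "x \<notin> cball 0 R"
    have "AE y in lborel. y \<in> - cball 0 R \<longrightarrow> \<rho> y = 0"
      using R(2) by eventually_elim auto
    then show False
      using positive_near_S[OF x(1), of "- cball 0 R"] x(2) by (auto simp: open_Compl)
  qed
  with R(1) show ?thesis by blast
qed

lemma compact_S: "compact S"
  using closed_S bounded_S by (meson bounded_cball bounded_subset compact_eq_bounded_closed)

lemma \<rho>_outside: "x \<notin> S \<Longrightarrow> \<rho> x = 0"
  by (simp add: \<rho>_eq)

lemma \<rho>_inside: "x \<in> S \<Longrightarrow> \<rho> x = g x"
  using g_nonneg[of x] by (simp add: \<rho>_eq)

lemma bounded_density: "\<exists>M R. bounded_density \<rho> M R"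
proof -
  obtain R where R: "R \<ge> 0" "S \<subseteq> cball 0 R" using bounded_S by blast
  have "compact (g ` S)"
    using compact_S g_cont by (meson compact_continuous_image continuous_on_subset subset_UNIV)
  then obtain M where M: "\<And>x. x \<in> S \<Longrightarrow> \<bar>g x\<bar> \<le> M"
    by (metis bounded_iff compact_imp_bounded imageI real_norm_def)
  have "bounded_density \<rho> (max 0 M) R"
  proof
    show "\<rho> w \<le> max 0 M" for w
      using M[of w] \<rho>_inside[of w] \<rho>_outside[of w] by (cases "w \<in> S") auto
    show "\<rho> w = 0" if "norm w > R" for w
      using that R by (intro \<rho>_outside) auto
  qed (use nonneg R in auto)
  then show ?thesis by blast
qed

lemma potential_cont: "continuous_on UNIV (log_potential \<rho>)"
  using bounded_density bounded_density.continuous_log_potential by blast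

lemma isCont_effective: "x \<notin> Z \<Longrightarrow> isCont (\<lambda>x. log_potential \<rho> x + p x) x"
proof (intro continuous_add)
  assume "x \<notin> Z"
  then show "isCont p x"
    using p_cont finite_Z by (metis ComplI closed_def continuous_on_eq_continuous_at finite_imp_closed)
  show "isCont (log_potential \<rho>) x"
    using potential_cont by (simp add: continuous_on_eq_continuous_at)
qed

text \<open>Every neighbourhood of a point of the support has positive mass, and a single point has
  none. A punctured neighbourhood is used so that the lemma also applies at nodes, where only limits
  of the field are meaningful.\<close>

lemma not_eventually_neq_robin:
  assumes "x \<in> S" "\<forall>\<^sub>F y in at x. log_potential \<rho> y + p y \<noteq> robin"
  shows False
proof -
  obtain N where N: "open N" "x \<in> N" "\<And>y. y \<in> N \<Longrightarrow> y \<noteq> x \<Longrightarrow> log_potential \<rho> y + p y \<noteq> robin"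
    using assms(2) unfolding eventually_at_topological by blast
  have "AE y in lborel. y \<in> N \<longrightarrow> \<rho> y = 0"
    using robin_eq_AE AE_lborel_singleton[of x]
    by eventually_elim (use N in blast)
  then show False using positive_near_S[OF assms(1) N(1,2)] by blast
qed

text \<open>The potential of a bounded density is continuous at a node while the field tends to
  infinity there, so the effective potential exceeds \<open>robin\<close> on a punctured
  neighbourhood.\<close>

lemma S_Z: "x \<in> S \<Longrightarrow> x \<notin> Z"
proof
  assume x: "x \<in> S" "x \<in> Z"
  have "isCont (log_potential \<rho>) x"
    using potential_cont by (simp add: continuous_on_eq_continuous_at)
  then have "filterlim (\<lambda>y. log_potential \<rho> y + p y) at_top (at x)"
    by (intro filterlim_tendsto_add_at_top[OF _ p_pole[OF x(2)]]) (simp add: isCont_def)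
  then have "\<forall>\<^sub>F y in at x. log_potential \<rho> y + p y > robin"
    by (rule filterlim_at_top_dense[THEN iffD1, rule_format])
  then have "\<forall>\<^sub>F y in at x. log_potential \<rho> y + p y \<noteq> robin"
    by eventually_elim simp
  then show False by (rule not_eventually_neq_robin[OF x(1)])
qed

lemma effective_eq: "x \<in> S \<Longrightarrow> log_potential \<rho> x + p x = robin"
proof (rule ccontr)
  assume x: "x \<in> S" "log_potential \<rho> x + p x \<noteq> robin"
  have "((\<lambda>y. log_potential \<rho> y + p y) \<longlongrightarrow> log_potential \<rho> x + p x) (at x)"
    using isCont_effective[OF S_Z[OF x(1)]] by (simp add: isCont_def)
  then have "\<forall>\<^sub>F y in at x. log_potential \<rho> y + p y \<noteq> robin"
    using x(2) by (rule tendsto_imp_eventually_ne)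
  then show False by (rule not_eventually_neq_robin[OF x(1)])
qed

lemma effective_ge: "x \<notin> Z \<Longrightarrow> robin \<le> log_potential \<rho> x + p x"
proof (rule ccontr)
  assume x: "x \<notin> Z" "\<not> robin \<le> log_potential \<rho> x + p x"
  have "continuous_on (- Z) (\<lambda>x. log_potential \<rho> x + p x)"
    using p_cont potential_cont by (intro continuous_intros) (auto intro: continuous_on_subset)
  moreover have "open (- Z)" using finite_Z by (simp add: finite_imp_closed open_Compl)
  ultimately have "open ((- Z) \<inter> (\<lambda>x. log_potential \<rho> x + p x) -` {..<robin})"
    by (simp add: continuous_on_open_vimage Int_commute)
  moreover have "AE y in lborel. y \<notin> (- Z) \<inter> (\<lambda>x. log_potential \<rho> x + p x) -` {..<robin}"
    using robin_le_AE by eventually_elim auto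
  ultimately have "(- Z) \<inter> (\<lambda>x. log_potential \<rho> x + p x) -` {..<robin} = {}"
    by (rule open_AE_notin_empty)
  then show False using x by auto
qed

end

subsection \<open>Smooth fields with point charges\<close>

lemma smooth_imp_continuous: "smooth f \<Longrightarrow> continuous_on UNIV f"
  using C_k.simps(1)[of f] unfolding smooth_def by blast

lemma smooth_imp_differentiable: "smooth f \<Longrightarrow> f differentiable (at x)"
  using C_k.simps(2)[of 0 f] unfolding smooth_def by blast

lemma smooth_frechet_derivative: "smooth f \<Longrightarrow> smooth (\<lambda>x. frechet_derivative f (at x) v)"
  using C_k.simps(2)[of _ f] unfolding smooth_def by blast

lemma smooth_pd_x: "smooth f \<Longrightarrow> smooth (pd_x f)"
  unfolding pd_x_def[abs_def] by (rule smooth_frechet_derivative)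

lemma smooth_pd_y: "smooth f \<Longrightarrow> smooth (pd_y f)"
  unfolding pd_y_def[abs_def] by (rule smooth_frechet_derivative)

lemma continuous_laplacian: "smooth f \<Longrightarrow> continuous_on UNIV (laplacian f)"
  unfolding laplacian_def[abs_def]
  by (intro continuous_on_add smooth_imp_continuous smooth_pd_x smooth_pd_y)

lemma has_derivative_pd:
  assumes "smooth f"
  shows "(f has_derivative (\<lambda>h. pd_x f z * Re h + pd_y f z * Im h)) (at z)"
proof -
  have D: "(f has_derivative frechet_derivative f (at z)) (at z)"
    using smooth_imp_differentiable[OF assms] frechet_derivative_works by blast
  then interpret linear "frechet_derivative f (at z)"
    by (rule has_derivative_linear)
  have "frechet_derivative f (at z) h = pd_x f z * Re h + pd_y f z * Im h" for h
  proof -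
    have "h = Re h *\<^sub>R 1 + Im h *\<^sub>R \<i>" by (simp add: complex_eq_iff)
    then have "frechet_derivative f (at z) h = frechet_derivative f (at z) (Re h *\<^sub>R 1 + Im h *\<^sub>R \<i>)" by simp
    also have "\<dots> = Re h *\<^sub>R pd_x f z + Im h *\<^sub>R pd_y f z"
      unfolding add scale pd_x_def pd_y_def ..
    finally show ?thesis by simp
  qed
  then have "frechet_derivative f (at z) = (\<lambda>h. pd_x f z * Re h + pd_y f z * Im h)" by auto
  with D show ?thesis by simp
qed

text \<open>The case \<open>n = 0\<close> is \<open>Q\<close> itself, so the results on \<open>charged_field\<close> also apply to \<open>\<mu>Q\<close>.\<close>

lemma filterlim_neg_ln_norm_at_top: "filterlim (\<lambda>x::complex. - ln (norm (x - a))) at_top (at a)"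
proof -
  have "filterlim (\<lambda>x. norm (x - a)) (at_right 0) (at a)"
    by (auto simp: filterlim_at eventually_at_filter intro!: tendsto_eq_intros)
  from filterlim_compose[OF ln_at_0 this] show ?thesis
    by (simp add: filterlim_uminus_at_top)
qed

section \<open>Growth, poles and integrability of charged fields\<close>

lemma admissible_growth:
  assumes "admissible (\<lambda>x. ereal (Q x))"
  shows "\<exists>R. \<forall>x. norm x > R \<longrightarrow> Q x - ln1p_norm x > c"
proof -
  have "((\<lambda>z. ereal (cmod z * exp (- Q z))) \<longlongrightarrow> ereal 0) at_infinity"
    using assms unfolding admissible_def exp_ereal_def by (simp add: zero_ereal_def)
  then have "((\<lambda>z. cmod z * exp (- Q z)) \<longlongrightarrow> 0) at_infinity"
    by (simp only: lim_ereal)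
  \<comment> \<open>The factor 1/2 pays for replacing the modulus by 1 + |z|, which is at most 2 |z|
    once |z| \<ge> 1.\<close>
  then have "\<forall>\<^sub>F z in at_infinity. cmod z * exp (- Q z) < exp (- c) / 2"
    by (rule order_tendstoD) simp
  then obtain B where B: "\<And>z. norm z \<ge> B \<Longrightarrow> cmod z * exp (- Q z) < exp (- c) / 2"
    unfolding eventually_at_infinity by blast
  have "Q x - ln1p_norm x > c" if x: "norm x > max B 1" for x
  proof -
    have "(1 + norm x) * exp (- Q x) \<le> (2 * norm x) * exp (- Q x)"
      using x by (intro mult_right_mono) auto
    also have "\<dots> < exp (- c)" using B[of x] x by simp
    finally have "exp (ln1p_norm x) * exp (- Q x) < exp (- c)"
      by (simp add: ln1p_norm_def add_pos_nonneg)
    then have "ln1p_norm x - Q x < - c" by (simp add: exp_add[symmetric])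
    then show ?thesis by simp
  qed
  then show ?thesis by blast
qed

definition charged_field :: "(complex \<Rightarrow> real) \<Rightarrow> nat \<Rightarrow> (nat \<Rightarrow> complex) \<Rightarrow> (nat \<Rightarrow> real) \<Rightarrow> complex \<Rightarrow> real" where
  "charged_field Q n z q x = (1 + (\<Sum>j=1..n. q j)) * Q x + (\<Sum>j=1..n. q j * - ln (norm (x - z j)))"

lemma charged_field_eq_ereal:
  assumes "x \<notin> z ` {1..n}"
  shows "ereal ((1 + (\<Sum>j=1..n. q j)) * Q x) + (\<Sum>j=1..n. ereal (q j) * log_kernel x (z j)) = ereal (charged_field Q n z q x)"
proof -
  have "(\<Sum>j=1..n. ereal (q j) * log_kernel x (z j)) = (\<Sum>j=1..n. ereal (q j * - ln (norm (x - z j))))"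
  proof (rule sum.cong[OF refl])
    fix j assume "j \<in> {1..n}"
    then have "x \<noteq> z j" using assms by auto
    then show "ereal (q j) * log_kernel x (z j) = ereal (q j * - ln (norm (x - z j)))"
      by (simp add: log_kernel_def ln_div)
  qed
  then show ?thesis by (simp add: charged_field_def)
qed

lemma charged_field_continuous_on:
  assumes "continuous_on UNIV Q"
  shows "continuous_on (- z ` {1..n}) (charged_field Q n z q)"
proof -
  have "continuous_on (- z ` {1..n}) Q" using assms by (rule continuous_on_subset) simp
  then show ?thesis
    unfolding charged_field_def[abs_def] by (intro continuous_intros) auto
qed

lemma charged_field_pole:
  assumes Q: "continuous_on UNIV Q" and q: "\<And>j. j \<in> {1..n} \<Longrightarrow> q j > 0" and a: "a \<in> z ` {1..n}"
  shows "filterlim (charged_field Q n z q) at_top (at a)"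
proof -
  \<comment> \<open>The points \<open>z j\<close> may coincide, so the strength of the pole at
    \<open>a\<close> is the sum of all intensities placed there.\<close>
  define J where "J = {j \<in> {1..n}. z j = a}"
  define c where "c = (\<Sum>j\<in>J. q j)"
  have "J \<noteq> {}" "finite J" using a by (auto simp: J_def)
  then have c: "c > 0" unfolding c_def using q by (intro sum_pos) (auto simp: J_def)
  define r where "r x = (1 + (\<Sum>j=1..n. q j)) * Q x + (\<Sum>j\<in>{1..n} - J. q j * - ln (norm (x - z j)))" for x
  have eq: "charged_field Q n z q x = r x + c * - ln (norm (x - a))" for x
  proof -
    have "(\<Sum>j=1..n. q j * - ln (norm (x - z j))) =
        (\<Sum>j\<in>{1..n} - J. q j * - ln (norm (x - z j))) + (\<Sum>j\<in>J. q j * - ln (norm (x - z j)))"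
      by (rule sum.subset_diff) (auto simp: J_def)
    also have "(\<Sum>j\<in>J. q j * - ln (norm (x - z j))) = (\<Sum>j\<in>J. q j * - ln (norm (x - a)))"
      by (rule sum.cong) (auto simp: J_def)
    also have "\<dots> = c * - ln (norm (x - a))" unfolding c_def by (rule sum_distrib_right[symmetric])
    finally show ?thesis by (simp add: charged_field_def r_def)
  qed
  have "isCont Q a" using Q by (simp add: continuous_on_eq_continuous_at)
  then have "isCont r a"
    unfolding r_def by (intro continuous_intros) (auto simp: J_def)
  then have "(r \<longlongrightarrow> r a) (at a)" by (simp add: isCont_def)
  then have "filterlim (\<lambda>x. r x + c * - ln (norm (x - a))) at_top (at a)"
    by (rule filterlim_tendsto_add_at_top)
       (rule filterlim_tendsto_pos_mult_at_top[OF tendsto_const c filterlim_neg_ln_norm_at_top])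
  then show ?thesis unfolding eq[abs_def] .
qed

lemma charged_field_local_integrable:
  assumes Q: "continuous_on UNIV Q"
  shows "integrable lborel (\<lambda>x. charged_field Q n z q x * indicator (cball 0 R) x)"
proof -
  let ?R = "max R 0"
  interpret b: bounded_density "\<lambda>x. indicator (cball 0 R) x :: real" 1 ?R
    by unfold_locales (auto split: split_indicator)
  have 1: "integrable lborel (\<lambda>x. Q x * indicator (cball 0 R) x)"
    using borel_integrable_compact[of "cball 0 R" Q] continuous_on_subset[OF Q]
    by (simp add: mult.commute)
  have 2: "integrable lborel (\<lambda>x. - ln (norm (x - a)) * indicator (cball 0 R) x)" for a :: complex
    using b.integrable_log[of a] by (simp add: norm_minus_commute)
  have "charged_field Q n z q x * indicator (cball 0 R) x =
    (1 + (\<Sum>j=1..n. q j)) * (Q x * indicator (cball 0 R) x) + (\<Sum>j=1..n. q j * (- ln (norm (x - z j)) * indicator (cball 0 R) x))" for x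
    unfolding charged_field_def distrib_right sum_distrib_right by (simp add: mult.assoc)
  then show ?thesis
    by (simp only:) (intro Bochner_Integration.integrable_add integrable_mult_right Bochner_Integration.integrable_sum 1 2)
qed

lemma field_minus_ln1p_norm_ge:
  assumes Q: "continuous_on UNIV Q" and adm: "admissible (\<lambda>x. ereal (Q x))"
  shows "\<exists>K. \<forall>x. Q x - ln1p_norm x \<ge> - K"
proof -
  obtain R where R: "\<And>x. norm x > R \<Longrightarrow> Q x - ln1p_norm x > 0"
    using admissible_growth[OF adm, of 0] by blast
  have "continuous_on (cball 0 R) (\<lambda>x. Q x - ln1p_norm x)"
    unfolding ln1p_norm_def
    by (intro continuous_intros continuous_on_subset[OF Q]) (auto simp: add_nonneg_eq_0_iff)
  then have "compact ((\<lambda>x. Q x - ln1p_norm x) ` cball 0 R)"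
    by (rule compact_continuous_image) simp
  then obtain B where "\<forall>y \<in> (\<lambda>x. Q x - ln1p_norm x) ` cball 0 R. norm y \<le> B"
    using compact_imp_bounded bounded_iff by blast
  then have B: "\<bar>Q x - ln1p_norm x\<bar> \<le> B" if "x \<in> cball 0 R" for x using that by simp
  have "Q x - ln1p_norm x \<ge> - max B 0" for x
    using R[of x] B[of x] by (cases "norm x > R") auto
  then show ?thesis by blast
qed

text \<open>The charges cost at most qs times \<open>ln1p_norm\<close>, with qs the sum of the
  intensities. The factor 1 + qs in front of Q makes up for this loss and leaves exactly one
  \<open>ln1p_norm\<close>, as the locale assumptions require.\<close>

lemma charged_field_ge:
  assumes q: "\<And>j. j \<in> {1..n} \<Longrightarrow> q j \<ge> 0"
  shows "(1 + (\<Sum>j=1..n. q j)) * (Q x - ln1p_norm x) + ln1p_norm x - (\<Sum>j=1..n. q j * ln1p_norm (z j)) \<le> charged_field Q n z q x"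
proof -
  have "(\<Sum>j=1..n. q j * (- ln1p_norm x - ln1p_norm (z j))) \<le> (\<Sum>j=1..n. q j * - ln (norm (x - z j)))"
  proof (rule sum_mono, rule mult_left_mono)
    fix j assume "j \<in> {1..n}"
    then show "q j \<ge> 0" by (rule q)
    show "- ln1p_norm x - ln1p_norm (z j) \<le> - ln (norm (x - z j))"
      using ln_norm_diff_le[of x "z j"] by simp
  qed
  moreover have "(\<Sum>j=1..n. q j * (- ln1p_norm x - ln1p_norm (z j))) = - (\<Sum>j=1..n. q j) * ln1p_norm x - (\<Sum>j=1..n. q j * ln1p_norm (z j))"
    by (simp add: right_diff_distrib sum_subtractf sum_distrib_right sum_negf)
  ultimately show ?thesis unfolding charged_field_def by (simp add: algebra_simps)
qed

lemma equilibrium_charged: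
  fixes Q :: "complex \<Rightarrow> real" and n :: nat and z :: "nat \<Rightarrow> complex" and q :: "nat \<Rightarrow> real"
  assumes "smooth Q" and adm: "admissible (\<lambda>x. ereal (Q x))"
    and q: "\<And>j. j \<in> {1..n} \<Longrightarrow> q j > 0"
    and V: "V = (\<lambda>x. ereal ((1 + (\<Sum>j=1..n. q j)) * Q x) + (\<Sum>j=1..n. ereal (q j) * log_kernel x (z j)))"
    and eq: "equilibrium_measure V \<mu>" and S: "S = measure_support \<mu>"
    and \<mu>: "\<mu> = density lborel (\<lambda>x. ennreal (c * laplacian Q x) * indicator S x)"
  shows "\<exists>K. equilibrium V (charged_field Q n z q) (\<lambda>x. max 0 (c * laplacian Q x) * indicator S x)
     (z ` {1..n}) K (\<lambda>x. c * laplacian Q x) S"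
proof -
  note Q = smooth_imp_continuous[OF \<open>smooth Q\<close>]
  have lap [measurable]: "laplacian Q \<in> borel_measurable borel"
    by (intro borel_measurable_continuous_onI continuous_laplacian \<open>smooth Q\<close>)
  have [measurable]: "Q \<in> borel_measurable borel" by (intro borel_measurable_continuous_onI Q)
  have [measurable]: "S \<in> sets borel" unfolding S by (intro borel_closed closed_measure_support)
  have "(\<lambda>x. ennreal (c * laplacian Q x) * indicator S x) = (\<lambda>x. ennreal (max 0 (c * laplacian Q x) * indicator S x))"
    by (auto split: split_indicator simp: fun_eq_iff ennreal_neg max_def)
  with \<mu> have \<mu>': "\<mu> = density lborel (\<lambda>x. ennreal (max 0 (c * laplacian Q x) * indicator S x))" by simp
  obtain K0 where K0: "\<And>x. Q x - ln1p_norm x \<ge> - K0" using field_minus_ln1p_norm_ge[OF Q adm] by blast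
  define qs where "qs = (\<Sum>j=1..n. q j)"
  define l where "l = (\<Sum>j=1..n. q j * ln1p_norm (z j))"
  have qs: "qs \<ge> 0" unfolding qs_def using q by (intro sum_nonneg) (auto intro: less_imp_le)
  have ge: "(1 + qs) * (Q x - ln1p_norm x) + ln1p_norm x - l \<le> charged_field Q n z q x" for x
    unfolding qs_def l_def using q by (intro charged_field_ge) (auto intro: less_imp_le)
  show ?thesis
  proof (intro exI[of _ "(1 + qs) * K0 + l"], unfold_locales)
    show "V x = ereal (charged_field Q n z q x)" if "x \<notin> z ` {1..n}" for x
      unfolding V by (rule charged_field_eq_ereal[OF that])
    show "V \<in> borel_measurable borel"
      unfolding V log_kernel_def by measurable
    show "charged_field Q n z q \<in> borel_measurable borel"
      unfolding charged_field_def[abs_def] by measurable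
    show "ln1p_norm x - ((1 + qs) * K0 + l) \<le> charged_field Q n z q x" for x
      using ge[of x] mult_left_mono[OF K0[of x], of "1 + qs"] qs by linarith
    show "integrable lborel (\<lambda>x. charged_field Q n z q x * indicat_real (cball 0 R) x)" for R
      by (rule charged_field_local_integrable[OF Q])
    show "\<exists>R. \<forall>x. R < norm x \<longrightarrow> c < charged_field Q n z q x - ln1p_norm x" for c
    proof -
      obtain R where R: "\<And>x. norm x > R \<Longrightarrow> Q x - ln1p_norm x > max 0 (c + l)"
        using admissible_growth[OF adm, of "max 0 (c + l)"] by blast
      have "c < charged_field Q n z q x - ln1p_norm x" if "R < norm x" for x
      proof -
        have "Q x - ln1p_norm x \<le> (1 + qs) * (Q x - ln1p_norm x)"
          using R[OF that] qs by (simp add: distrib_right)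
        then show ?thesis using ge[of x] R[OF that] by linarith
      qed
      then show ?thesis by blast
    qed
    show "energy_minimizer V (density lborel (\<lambda>x. ennreal (max 0 (c * laplacian Q x) * indicat_real S x)))"
      using eq unfolding equilibrium_measure_def \<mu>' by blast
    show "S = measure_support (density lborel (\<lambda>x. ennreal (max 0 (c * laplacian Q x) * indicat_real S x)))"
      using S unfolding \<mu>' .
    show "continuous_on UNIV (\<lambda>x. c * laplacian Q x)"
      by (intro continuous_intros continuous_laplacian \<open>smooth Q\<close>)
    show "continuous_on (- z ` {1..n}) (charged_field Q n z q)"
      by (rule charged_field_continuous_on[OF Q])
    show "filterlim (charged_field Q n z q) at_top (at a)" if "a \<in> z ` {1..n}" for a
      by (rule charged_field_pole[OF Q q that])
  qed auto
qed

subsection \<open>The Cauchy--Riemann operator on continuously differentiable functions\<close>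

text \<open>Continuity is asked of each directional derivative instead of the derivative as an
  operator. By linearity this is the same in the plane, and it avoids operator norms.\<close>

definition C1_on :: "complex set \<Rightarrow> (complex \<Rightarrow> 'b::real_normed_vector) \<Rightarrow> bool" where
  "C1_on N F \<longleftrightarrow> (\<forall>y\<in>N. (F has_derivative frechet_derivative F (at y)) (at y)) \<and>
     (\<forall>v. continuous_on N (\<lambda>y. frechet_derivative F (at y) v))"

text \<open>Twice the Cauchy-Riemann operator, so that \<open>dbar2\<close> of 2 \<partial>Q is
  \<Delta>Q without factors 1/2 or 1/4.\<close>

definition dbar2 :: "(complex \<Rightarrow> complex) \<Rightarrow> complex \<Rightarrow> complex" where
  "dbar2 F y = frechet_derivative F (at y) 1 + \<i> * frechet_derivative F (at y) \<i>"

lemma C1_onI: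
  assumes "\<And>y. y \<in> N \<Longrightarrow> (F has_derivative D y) (at y)" "\<And>v. continuous_on N (\<lambda>y. D y v)"
  shows "C1_on N F"
proof -
  have eq: "frechet_derivative F (at y) = D y" if "y \<in> N" for y
    using frechet_derivative_at[OF assms(1)[OF that]] by simp
  show ?thesis
    unfolding C1_on_def using assms eq by (auto cong: continuous_on_cong)
qed

lemma C1_onD: "C1_on N F \<Longrightarrow> y \<in> N \<Longrightarrow> (F has_derivative frechet_derivative F (at y)) (at y)"
  by (simp add: C1_on_def)

lemma C1_on_cont: "C1_on N F \<Longrightarrow> continuous_on N F"
  by (meson C1_onD continuous_at_imp_continuous_on has_derivative_continuous)

lemma C1_on_subset: "C1_on N F \<Longrightarrow> N' \<subseteq> N \<Longrightarrow> C1_on N' F"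
  unfolding C1_on_def by (meson continuous_on_subset subsetD)

lemma C1_on_local:
  assumes "\<And>x. x \<in> T \<Longrightarrow> \<exists>N. open N \<and> x \<in> N \<and> C1_on N F"
  shows "C1_on T F"
  unfolding C1_on_def
proof (intro conjI ballI allI)
  fix y assume "y \<in> T"
  then show "(F has_derivative frechet_derivative F (at y)) (at y)"
    using assms C1_onD by blast
next
  fix v
  have "isCont (\<lambda>y. frechet_derivative F (at y) v) y" if "y \<in> T" for y
    using assms[OF that] unfolding C1_on_def by (metis continuous_on_eq_continuous_at)
  then show "continuous_on T (\<lambda>y. frechet_derivative F (at y) v)"
    by (intro continuous_at_imp_continuous_on) auto
qed

lemma frechet_derivative_cong_open:
  assumes "open N" "y \<in> N" "\<And>x. x \<in> N \<Longrightarrow> F x = G x"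
  shows "frechet_derivative F (at y) = frechet_derivative G (at y)"
  unfolding frechet_derivative_def
  using has_derivative_transform_within_open[OF _ assms(1,2)] assms(3)
  by (metis (no_types, opaque_lifting))

lemma C1_on_cong:
  assumes "open N" "\<And>x. x \<in> N \<Longrightarrow> F x = G x" "C1_on N G"
  shows "C1_on N F"
proof (rule C1_onI)
  show "(F has_derivative frechet_derivative G (at y)) (at y)" if "y \<in> N" for y
    by (rule has_derivative_transform_within_open[OF C1_onD[OF assms(3) that] assms(1) that])
       (simp add: assms(2))
  show "continuous_on N (\<lambda>y. frechet_derivative G (at y) v)" for v
    using assms(3) by (simp add: C1_on_def)
qed

lemma dbar2_cong_open:
  assumes "open N" "y \<in> N" "\<And>x. x \<in> N \<Longrightarrow> F x = G x"
  shows "dbar2 F y = dbar2 G y"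
  using frechet_derivative_cong_open[of N y F G] assms by (simp add: dbar2_def)

lemma C1_on_continuous_deriv: "C1_on N F \<Longrightarrow> continuous_on N (\<lambda>y. frechet_derivative F (at y) v)"
  by (simp add: C1_on_def)

lemma C1_on_const: "C1_on N (\<lambda>_. c)"
  by (rule C1_onI[where D = "\<lambda>_ _. 0"]) auto

lemma C1_on_add:
  assumes "C1_on N F" "C1_on N G" shows "C1_on N (\<lambda>x. F x + G x)"
  by (rule C1_onI[where D = "\<lambda>y v. frechet_derivative F (at y) v + frechet_derivative G (at y) v"])
     (intro has_derivative_add C1_onD[OF assms(1)] C1_onD[OF assms(2)] continuous_intros
        C1_on_continuous_deriv assms; assumption)+

lemma C1_on_minus:
  assumes "C1_on N F" shows "C1_on N (\<lambda>x. - F x)"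
  by (rule C1_onI[where D = "\<lambda>y v. - frechet_derivative F (at y) v"])
     (intro has_derivative_minus C1_onD[OF assms(1)] continuous_intros C1_on_continuous_deriv assms; assumption)+

lemma C1_on_diff:
  assumes "C1_on N F" "C1_on N G" shows "C1_on N (\<lambda>x. F x - G x)"
  using C1_on_add[OF assms(1) C1_on_minus[OF assms(2)]] by simp

lemma C1_on_mult:
  fixes F G :: "complex \<Rightarrow> 'a::real_normed_algebra"
  assumes "C1_on N F" "C1_on N G" shows "C1_on N (\<lambda>x. F x * G x)"
  by (rule C1_onI[where D = "\<lambda>y v. F y * frechet_derivative G (at y) v + frechet_derivative F (at y) v * G y"])
     (intro has_derivative_mult C1_onD[OF assms(1)] C1_onD[OF assms(2)] continuous_intros
        C1_on_continuous_deriv C1_on_cont assms; assumption)+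

lemma C1_on_sum:
  assumes "\<And>i. i \<in> I \<Longrightarrow> C1_on N (F i)" shows "C1_on N (\<lambda>x. \<Sum>i\<in>I. F i x)"
  using assms by (induction I rule: infinite_finite_induct) (auto intro: C1_on_const C1_on_add)

lemma C1_on_bounded_linear:
  assumes L: "bounded_linear L" and F: "C1_on N F" shows "C1_on N (\<lambda>x. L (F x))"
proof (rule C1_onI)
  show "((\<lambda>x. L (F x)) has_derivative (\<lambda>v. L (frechet_derivative F (at y) v))) (at y)" if "y \<in> N" for y
    by (rule bounded_linear.has_derivative[OF L C1_onD[OF F that]])
  show "continuous_on N (\<lambda>y. L (frechet_derivative F (at y) v))" for v
    by (rule bounded_linear.continuous_on[OF L C1_on_continuous_deriv[OF F]])
qed

lemma C1_on_compose_real: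
  fixes F :: "complex \<Rightarrow> real"
  assumes t: "\<And>s. (\<theta> has_real_derivative \<theta>' s) (at s)" "continuous_on UNIV \<theta>'" and F: "C1_on N F"
  shows "C1_on N (\<lambda>x. \<theta> (F x))"
proof (rule C1_onI)
  show "((\<lambda>x. \<theta> (F x)) has_derivative (\<lambda>v. \<theta>' (F y) * frechet_derivative F (at y) v)) (at y)" if "y \<in> N" for y
    using has_derivative_compose[OF C1_onD[OF F that] t(1)[of "F y", unfolded has_field_derivative_def]] by simp
  show "continuous_on N (\<lambda>y. \<theta>' (F y) * frechet_derivative F (at y) v)" for v
    by (intro continuous_intros continuous_on_compose2[OF t(2)] C1_on_cont[OF F] C1_on_continuous_deriv[OF F]) auto
qed

lemma C1_on_holomorphic:
  assumes "open N" "F holomorphic_on N"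
  shows "C1_on N F" and "\<And>y. y \<in> N \<Longrightarrow> dbar2 F y = 0"
proof -
  have D: "(F has_derivative (*) (deriv F y)) (at y)" if "y \<in> N" for y
    using holomorphic_derivI[OF assms(2,1) that] by (simp add: has_field_derivative_def)
  have cont: "continuous_on N (deriv F)"
    by (intro holomorphic_on_imp_continuous_on holomorphic_deriv assms)
  show "C1_on N F"
  proof (rule C1_onI)
    show "(F has_derivative (*) (deriv F y)) (at y)" if "y \<in> N" for y using that by (rule D)
    show "continuous_on N (\<lambda>y. deriv F y * v)" for v
      by (intro continuous_intros cont)
  qed
  show "dbar2 F y = 0" if "y \<in> N" for y
    using frechet_derivative_at[OF D[OF that], symmetric] by (simp add: dbar2_def complex_eq_iff)
qed

lemma dbar2_of_has_derivative: "(F has_derivative D) (at y) \<Longrightarrow> dbar2 F y = D 1 + \<i> * D \<i>"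
  unfolding dbar2_def using frechet_derivative_at by metis

lemma dbar2_mult:
  assumes "C1_on N F" "C1_on N G" "y \<in> N"
  shows "dbar2 (\<lambda>x. F x * G x) y = dbar2 F y * G y + F y * dbar2 G y"
  using dbar2_of_has_derivative[OF has_derivative_mult[OF C1_onD[OF assms(1,3)] C1_onD[OF assms(2,3)]]]
  by (simp add: dbar2_def algebra_simps)

lemma dbar2_add:
  assumes "C1_on N F" "C1_on N G" "y \<in> N"
  shows "dbar2 (\<lambda>x. F x + G x) y = dbar2 F y + dbar2 G y"
  using dbar2_of_has_derivative[OF has_derivative_add[OF C1_onD[OF assms(1,3)] C1_onD[OF assms(2,3)]]]
  by (simp add: dbar2_def algebra_simps)

lemma dbar2_const: "dbar2 (\<lambda>_. c) y = 0"
  using dbar2_of_has_derivative[OF has_derivative_const] by simp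

lemma dbar2_sum:
  assumes "\<And>i. i \<in> I \<Longrightarrow> C1_on N (F i)" "y \<in> N"
  shows "dbar2 (\<lambda>x. \<Sum>i\<in>I. F i x) y = (\<Sum>i\<in>I. dbar2 (F i) y)"
  using assms(1)
proof (induction I rule: infinite_finite_induct)
  case (insert i I)
  have "dbar2 (\<lambda>x. F i x + (\<Sum>i\<in>I. F i x)) y = dbar2 (F i) y + dbar2 (\<lambda>x. \<Sum>i\<in>I. F i x) y"
    using insert by (intro dbar2_add[OF _ _ assms(2)] C1_on_sum) auto
  then show ?case using insert by simp
qed (auto simp: dbar2_const)

text \<open>Translation invariance of Lebesgue measure replaces an integration by parts.\<close>

lemma integral_directional_derivative_eq_0:
  fixes F :: "complex \<Rightarrow> complex"
  assumes C1: "C1_on UNIV F" and supp: "\<And>x. norm x > R \<Longrightarrow> F x = 0"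
  shows "integrable lborel (\<lambda>x. frechet_derivative F (at x) v)"
    and "(LINT x|lborel. frechet_derivative F (at x) v) = 0"
proof -
  let ?D = "\<lambda>x. frechet_derivative F (at x) v"
  have D: "(F has_derivative frechet_derivative F (at x)) (at x)" for x
    using C1_onD[OF C1] by blast
  have D_cont: "continuous_on UNIV ?D" by (rule C1_on_continuous_deriv[OF C1])
  have lin: "linear (frechet_derivative F (at x))" for x
    using D has_derivative_linear by blast
  have D0: "frechet_derivative F (at x) u = 0" if "norm x > R" for x u
  proof -
    have "((\<lambda>_. 0) has_derivative frechet_derivative F (at x)) (at x)"
    proof (rule has_derivative_transform_within_open[OF D])
      show "open (- cball 0 R :: complex set)" by (simp add: open_Compl)
    qed (use that supp in auto)
    then have "frechet_derivative F (at x) = (\<lambda>_. 0)"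
      by (rule has_derivative_unique) simp
    then show ?thesis by simp
  qed
  have bnd: "\<exists>B\<ge>0. \<forall>x. norm (frechet_derivative F (at x) u) \<le> B" for u
  proof -
    let ?E = "\<lambda>x. frechet_derivative F (at x) u"
    have "compact (?E ` cball 0 R)"
      using C1_on_continuous_deriv[OF C1, of u] by (intro compact_continuous_image) (auto intro: continuous_on_subset)
    then obtain B where "\<forall>y \<in> ?E ` cball 0 R. norm y \<le> B"
      using compact_imp_bounded bounded_iff by blast
    then have B: "norm (?E x) \<le> B" if "x \<in> cball 0 R" for x using that by blast
    have "norm (?E x) \<le> max B 0" for x
      using B[of x] D0[of x u] by (cases "norm x > R") auto
    then show ?thesis by (intro exI[of _ "max B 0"]) auto
  qed
  obtain B1 B2 where B: "B1 \<ge> 0" "B2 \<ge> 0"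
    "\<And>x. norm (frechet_derivative F (at x) 1) \<le> B1" "\<And>x. norm (frechet_derivative F (at x) \<i>) \<le> B2"
    using bnd[of 1] bnd[of \<i>] by blast
  have D_le: "norm (frechet_derivative F (at x) h) \<le> (B1 + B2) * norm h" for x h
  proof -
    have "h = Re h *\<^sub>R 1 + Im h *\<^sub>R \<i>" by (simp add: complex_eq_iff)
    then have "frechet_derivative F (at x) h = frechet_derivative F (at x) (Re h *\<^sub>R 1 + Im h *\<^sub>R \<i>)" by simp
    also have "\<dots> = Re h *\<^sub>R frechet_derivative F (at x) 1 + Im h *\<^sub>R frechet_derivative F (at x) \<i>"
      by (simp only: linear_add[OF lin] linear_scale[OF lin])
    also have "norm \<dots> \<le> \<bar>Re h\<bar> * norm (frechet_derivative F (at x) 1) + \<bar>Im h\<bar> * norm (frechet_derivative F (at x) \<i>)"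
      by (rule order_trans[OF norm_triangle_ineq]) simp
    also have "\<dots> \<le> norm h * B1 + norm h * B2"
      by (intro add_mono mult_mono B abs_Re_le_cmod abs_Im_le_cmod) auto
    finally show ?thesis by (simp add: algebra_simps)
  qed
  define B where "B = (B1 + B2) * norm v"
  have B0: "B \<ge> 0" using B by (simp add: B_def)
  \<comment> \<open>Enlarged by |v| so that one disc contains the supports of all the difference
    quotients along v.\<close>
  define R' where "R' = max R 0 + norm v"
  have R': "R' \<ge> 0" by (simp add: R'_def)
  have dom: "integrable lborel (\<lambda>x::complex. B * indicator (cball 0 R') x :: real)"
    using R' by (intro integrable_mult_right integrable_real_indicator) (simp_all add: emeasure_cball)
  have F_cont: "continuous_on UNIV F" using C1_on_cont[OF C1] .
  have [measurable]: "F \<in> borel_measurable borel" "?D \<in> borel_measurable borel"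
    using F_cont D_cont by (auto intro: borel_measurable_continuous_onI)
  show int: "integrable lborel ?D"
  proof (rule Bochner_Integration.integrable_bound[OF dom])
    have "norm (?D x) \<le> norm (B * indicator (cball 0 R') x :: real)" for x
    proof (cases "norm x > R")
      case False
      then have "x \<in> cball 0 R'" by (auto simp: R'_def intro: add_increasing2)
      then show ?thesis using D_le[of x v] B0 by (simp add: B_def)
    qed (simp add: D0)
    then show "AE x in lborel. norm (?D x) \<le> norm (B * indicator (cball 0 R') x :: real)" by simp
  qed measurable
  define s where "s k x = of_nat (Suc k) * (F (v /\<^sub>R real (Suc k) + x) - F x)" for k x
  have F_int: "integrable lborel F"
  proof -
    have "integrable lborel (\<lambda>x. indicator (cball 0 R) x *\<^sub>R F x)"
      by (rule borel_integrable_compact) (auto intro: continuous_on_subset[OF F_cont])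
    also have "(\<lambda>x. indicator (cball 0 R) x *\<^sub>R F x) = F"
      using supp by (auto split: split_indicator simp: fun_eq_iff not_le)
    finally show ?thesis .
  qed
  have shift: "integrable lborel (\<lambda>x. F (a + x))" "(LINT x|lborel. F (a + x)) = integral\<^sup>L lborel F" for a
  proof -
    have d: "distr lborel borel ((+) a) = lborel" by (rule lborel_distr_plus)
    have "integrable (distr lborel borel ((+) a)) F" unfolding d by (rule F_int)
    then show "integrable lborel (\<lambda>x. F (a + x))" by (subst (asm) integrable_distr_eq) auto
    have "integral\<^sup>L (distr lborel borel ((+) a)) F = (LINT x|lborel. F (a + x))"
      by (rule integral_distr) auto
    then show "(LINT x|lborel. F (a + x)) = integral\<^sup>L lborel F" unfolding d by simp
  qed
  have s0: "integral\<^sup>L lborel (s k) = 0" for k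
    unfolding s_def integral_mult_right_zero
    by (subst Bochner_Integration.integral_diff[OF shift(1) F_int]) (simp add: shift(2))
  have "(\<lambda>k. integral\<^sup>L lborel (s k)) \<longlonglongrightarrow> integral\<^sup>L lborel ?D"
  proof (rule integral_dominated_convergence[OF _ _ dom])
    show "AE x in lborel. (\<lambda>k. s k x) \<longlonglongrightarrow> ?D x"
    proof (rule AE_I2)
      fix x
      show "(\<lambda>k. s k x) \<longlonglongrightarrow> ?D x"
      proof (cases "v = 0")
        case True
        then show ?thesis by (simp add: s_def linear_0[OF lin])
      next
        case False
        let ?h = "\<lambda>k. v /\<^sub>R real (Suc k)"
        have "(\<lambda>k. inverse (real (Suc k)) *\<^sub>R v) \<longlonglongrightarrow> 0 *\<^sub>R v"
          by (intro tendsto_intros LIMSEQ_inverse_real_of_nat)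
        then have h0: "?h \<longlonglongrightarrow> 0" by simp
        have "((\<lambda>h. norm (F (x + h) - F x - frechet_derivative F (at x) h) / norm h) \<longlongrightarrow> 0) (at 0)"
          using D[of x] by (simp add: has_derivative_at)
        then have "((\<lambda>h. norm (F (x + h) - F x - frechet_derivative F (at x) h) / norm h) \<circ> ?h) \<longlonglongrightarrow> 0"
          unfolding tendsto_at_iff_sequentially using h0 False by auto
        then have "(\<lambda>k. norm v * (norm (F (x + ?h k) - F x - frechet_derivative F (at x) (?h k)) / norm (?h k))) \<longlonglongrightarrow> norm v * 0"
          unfolding o_def by (intro tendsto_intros)
        moreover have "norm v * (norm (F (x + ?h k) - F x - frechet_derivative F (at x) (?h k)) / norm (?h k)) = norm (s k x - ?D x)" for k
        proof -
          have "s k x - ?D x = of_nat (Suc k) * (F (x + ?h k) - F x - frechet_derivative F (at x) (?h k))"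
            unfolding s_def linear_scale[OF lin]
            by (simp add: scaleR_conv_of_real right_diff_distrib add.commute del: of_nat_Suc)
          then have "norm (s k x - ?D x) = real (Suc k) * norm (F (x + ?h k) - F x - frechet_derivative F (at x) (?h k))"
            by (simp only: norm_mult norm_of_nat)
          then show ?thesis using False by (simp add: field_simps del: of_nat_Suc)
        qed
        ultimately have "(\<lambda>k. norm (s k x - ?D x)) \<longlonglongrightarrow> 0" by simp
        then show ?thesis using LIM_zero_cancel tendsto_norm_zero_iff by blast
      qed
    qed
    show "AE x in lborel. norm (s k x) \<le> B * indicator (cball 0 R') x" for k
    proof (rule AE_I2)
      fix x
      have h_le: "norm (v /\<^sub>R real (Suc k)) \<le> norm v"
      proof -
        have "norm (v /\<^sub>R real (Suc k)) = norm v / real (Suc k)" by (simp add: divide_inverse_commute)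
        also have "\<dots> \<le> norm v / 1" by (rule divide_left_mono) auto
        finally show ?thesis by simp
      qed
      show "norm (s k x) \<le> B * indicator (cball 0 R') x"
      proof (cases "x \<in> cball 0 R'")
        case False
        then have "norm x > R + norm v" "norm x > R"
          unfolding R'_def using norm_ge_zero[of v] by (simp_all del: norm_ge_zero)
        moreover have "norm (v /\<^sub>R real (Suc k) + x) \<ge> norm x - norm (v /\<^sub>R real (Suc k))"
          using norm_triangle_ineq2[of x "- (v /\<^sub>R real (Suc k))"] by (simp add: add.commute)
        ultimately have "F (v /\<^sub>R real (Suc k) + x) = 0" "F x = 0"
          using h_le by (auto intro!: supp)
        then show ?thesis using False by (simp add: s_def)
      next
        case True
        have "norm (F (v /\<^sub>R real (Suc k) + x) - F x) \<le> (B1 + B2) * norm (v /\<^sub>R real (Suc k) + x - x)"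
        proof (rule differentiable_bound[OF convex_UNIV])
          show "(F has_derivative frechet_derivative F (at y)) (at y within UNIV)" for y using D by simp
          show "onorm (frechet_derivative F (at y)) \<le> B1 + B2" for y
            by (rule onorm_bound) (use B D_le in auto)
        qed auto
        then have "real (Suc k) * norm (F (v /\<^sub>R real (Suc k) + x) - F x) \<le> real (Suc k) * ((B1 + B2) * norm (v /\<^sub>R real (Suc k)))"
          by (intro mult_left_mono) auto
        also have "\<dots> = B" by (simp add: B_def field_simps del: of_nat_Suc)
        finally show ?thesis
          using True by (simp add: s_def norm_mult del: of_nat_Suc)
      qed
    qed
    show "s k \<in> borel_measurable lborel" for k
      unfolding s_def[abs_def] by measurable
  qed measurable
  then have "(\<lambda>k. 0 :: complex) \<longlonglongrightarrow> integral\<^sup>L lborel ?D" by (simp add: s0)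
  then show "integral\<^sup>L lborel ?D = 0" using LIMSEQ_unique tendsto_const by blast
qed

lemma integral_dbar2_eq_0:
  fixes F :: "complex \<Rightarrow> complex"
  assumes C1: "C1_on UNIV F" and supp: "\<And>x. norm x > R \<Longrightarrow> F x = 0"
  shows "integrable lborel (dbar2 F)" and "integral\<^sup>L lborel (dbar2 F) = 0"
proof -
  have 1: "integrable lborel (\<lambda>x. frechet_derivative F (at x) v)" "(LINT x|lborel. frechet_derivative F (at x) v) = 0" for v
    using integral_directional_derivative_eq_0[OF C1, of R v] supp by auto
  have "integrable lborel (\<lambda>x. \<i> * frechet_derivative F (at x) \<i>)"
    by (intro integrable_mult_right 1)
  note 2 = 1(1)[of 1] this
  show "integrable lborel (dbar2 F)"
    unfolding dbar2_def[abs_def] by (rule Bochner_Integration.integrable_add[OF 2])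
  show "integral\<^sup>L lborel (dbar2 F) = 0"
    unfolding dbar2_def[abs_def]
    by (subst Bochner_Integration.integral_add[OF 2], subst integral_mult_right_zero, simp only: 1(2)) simp
qed

text \<open>Two applications of the mean value theorem to the second difference over a square of
  side h give h^2 times either mixed derivative at some nearby point. As h tends to 0, continuity
  identifies both with their values at z.\<close>

lemma pd_y_pd_x_commute:
  assumes Q: "smooth Q"
  shows "pd_y (pd_x Q) z = pd_x (pd_y Q) z"
proof -
  have x: "((\<lambda>s. f (a + of_real s)) has_real_derivative pd_x f (a + of_real s)) (at s)" if "smooth f" for f a s
  proof -
    have "((\<lambda>s. a + of_real s) has_derivative of_real) (at s)" by (auto intro!: derivative_eq_intros)
    from has_derivative_compose[OF this has_derivative_pd[OF that]]
    show ?thesis unfolding has_field_derivative_def by (rule has_derivative_eq_rhs) (simp add: fun_eq_iff)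
  qed
  have y: "((\<lambda>s. f (a + \<i> * of_real s)) has_real_derivative pd_y f (a + \<i> * of_real s)) (at s)" if "smooth f" for f a s
  proof -
    have "((\<lambda>s. a + \<i> * of_real s) has_derivative (\<lambda>s. \<i> * of_real s)) (at s)" by (auto intro!: derivative_eq_intros)
    from has_derivative_compose[OF this has_derivative_pd[OF that]]
    show ?thesis unfolding has_field_derivative_def by (rule has_derivative_eq_rhs) (simp add: fun_eq_iff)
  qed
  define \<Delta> where "\<Delta> h = Q (z + of_real h + \<i> * of_real h) - Q (z + of_real h) - Q (z + \<i> * of_real h) + Q z" for h
  have 1: "\<exists>u. norm (u - z) \<le> 2 * h \<and> \<Delta> h = h * h * pd_y (pd_x Q) u" if h: "h > 0" for h
  proof -
    have "DERIV (\<lambda>s. Q (z + \<i> * of_real h + of_real s) - Q (z + of_real s)) s :>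
        pd_x Q (z + \<i> * of_real h + of_real s) - pd_x Q (z + of_real s)" for s
      by (intro DERIV_diff x Q)
    from MVT2[OF h this] obtain s where s: "0 < s" "s < h"
      "\<Delta> h = h * (pd_x Q (z + \<i> * of_real h + of_real s) - pd_x Q (z + of_real s))"
      unfolding \<Delta>_def by (auto simp: algebra_simps)
    have "DERIV (\<lambda>t. pd_x Q ((z + of_real s) + \<i> * of_real t)) t :> pd_y (pd_x Q) ((z + of_real s) + \<i> * of_real t)" for t
      by (intro y smooth_pd_x Q)
    from MVT2[OF h this] obtain t where t: "0 < t" "t < h"
      "pd_x Q (z + of_real s + \<i> * of_real h) - pd_x Q (z + of_real s) = h * pd_y (pd_x Q) (z + of_real s + \<i> * of_real t)"
      by auto
    have "norm (z + of_real s + \<i> * of_real t - z) \<le> 2 * h"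
      using norm_triangle_ineq[of "of_real s" "\<i> * of_real t :: complex"] s t by (simp add: norm_mult)
    moreover have "\<Delta> h = h * h * pd_y (pd_x Q) (z + of_real s + \<i> * of_real t)"
      using s(3) t(3) by (simp add: algebra_simps)
    ultimately show ?thesis by blast
  qed
  have 2: "\<exists>u. norm (u - z) \<le> 2 * h \<and> \<Delta> h = h * h * pd_x (pd_y Q) u" if h: "h > 0" for h
  proof -
    have "DERIV (\<lambda>s. Q (z + of_real h + \<i> * of_real s) - Q (z + \<i> * of_real s)) s :>
        pd_y Q (z + of_real h + \<i> * of_real s) - pd_y Q (z + \<i> * of_real s)" for s
      by (intro DERIV_diff y Q)
    from MVT2[OF h this] obtain s where s: "0 < s" "s < h"
      "\<Delta> h = h * (pd_y Q (z + of_real h + \<i> * of_real s) - pd_y Q (z + \<i> * of_real s))"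
      unfolding \<Delta>_def by (auto simp: algebra_simps)
    have "DERIV (\<lambda>t. pd_y Q ((z + \<i> * of_real s) + of_real t)) t :> pd_x (pd_y Q) ((z + \<i> * of_real s) + of_real t)" for t
      by (intro x smooth_pd_y Q)
    from MVT2[OF h this] obtain t where t: "0 < t" "t < h"
      "pd_y Q (z + \<i> * of_real s + of_real h) - pd_y Q (z + \<i> * of_real s) = h * pd_x (pd_y Q) (z + \<i> * of_real s + of_real t)"
      by auto
    have "norm (z + \<i> * of_real s + of_real t - z) \<le> 2 * h"
      using norm_triangle_ineq[of "\<i> * of_real s :: complex" "of_real t"] s t by (simp add: norm_mult)
    moreover have "\<Delta> h = h * h * pd_x (pd_y Q) (z + \<i> * of_real s + of_real t)"
      using s(3) t(3) by (simp add: algebra_simps)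
    ultimately show ?thesis by blast
  qed
  define h where "h k = inverse (real (Suc k))" for k
  have h: "h k > 0" for k by (simp add: h_def)
  have "\<exists>u v. norm (u - z) \<le> 2 * h k \<and> norm (v - z) \<le> 2 * h k \<and> pd_y (pd_x Q) u = pd_x (pd_y Q) v" for k
  proof -
    obtain u where u: "norm (u - z) \<le> 2 * h k" "\<Delta> (h k) = h k * h k * pd_y (pd_x Q) u"
      using 1[OF h[of k]] by blast
    obtain v where v: "norm (v - z) \<le> 2 * h k" "\<Delta> (h k) = h k * h k * pd_x (pd_y Q) v"
      using 2[OF h[of k]] by blast
    have "pd_y (pd_x Q) u = pd_x (pd_y Q) v" using u(2) v(2) h[of k] by simp
    then show ?thesis using u(1) v(1) by blast
  qed
  then obtain u v where uv: "\<And>k. norm (u k - z) \<le> 2 * h k" "\<And>k. norm (v k - z) \<le> 2 * h k"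
    "\<And>k. pd_y (pd_x Q) (u k) = pd_x (pd_y Q) (v k)"
    by metis
  have "(\<lambda>k. 2 * h k) \<longlonglongrightarrow> 2 * 0"
    unfolding h_def by (intro tendsto_intros LIMSEQ_inverse_real_of_nat)
  then have h0: "(\<lambda>k. 2 * h k) \<longlonglongrightarrow> 0" by simp
  have u: "u \<longlonglongrightarrow> z" "v \<longlonglongrightarrow> z"
    using Lim_null_comparison[OF _ h0, of "\<lambda>k. u k - z"] Lim_null_comparison[OF _ h0, of "\<lambda>k. v k - z"] uv
    by (auto simp: LIM_zero_iff)
  have "(\<lambda>k. pd_y (pd_x Q) (u k)) \<longlonglongrightarrow> pd_y (pd_x Q) z"
    by (rule continuous_on_tendsto_compose[OF smooth_imp_continuous[OF smooth_pd_y[OF smooth_pd_x[OF Q]]] u(1)]) auto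
  moreover have "(\<lambda>k. pd_x (pd_y Q) (v k)) \<longlonglongrightarrow> pd_x (pd_y Q) z"
    by (rule continuous_on_tendsto_compose[OF smooth_imp_continuous[OF smooth_pd_x[OF smooth_pd_y[OF Q]]] u(2)]) auto
  ultimately show ?thesis unfolding uv(3) by (rule LIMSEQ_unique)
qed

section \<open>A continuously differentiable step function\<close>

lemma has_real_derivative_sq_pos:
  "((\<lambda>s. (max 0 s)\<^sup>2) has_real_derivative 2 * max 0 s) (at s)" for s :: real
proof (cases s "0 :: real" rule: linorder_cases)
  case less
  have "((\<lambda>_. 0) has_real_derivative 0) (at s)" by simp
  then have "((\<lambda>s. (max 0 s)\<^sup>2) has_real_derivative 0) (at s)"
    by (rule DERIV_cong_ev[THEN iffD1, rotated 3])
       (use less eventually_nhds_in_open[of "{..<0}" s] in \<open>auto elim!: eventually_mono\<close>)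
  then show ?thesis using less by simp
next
  case greater
  have "((\<lambda>s. s\<^sup>2) has_real_derivative 2 * s) (at s)" by (auto intro!: derivative_eq_intros)
  then have "((\<lambda>s. (max 0 s)\<^sup>2) has_real_derivative 2 * s) (at s)"
    by (rule DERIV_cong_ev[THEN iffD1, rotated 3])
       (use greater eventually_nhds_in_open[of "{0<..}" s] in \<open>auto elim!: eventually_mono\<close>)
  then show ?thesis using greater by simp
next
  case equal
  have "((\<lambda>h. ((max 0 (0 + h))\<^sup>2 - (max 0 0)\<^sup>2) / h) \<longlongrightarrow> 0) (at (0 :: real))"
  proof (rule Lim_null_comparison)
    show "\<forall>\<^sub>F h in at 0. norm (((max 0 (0 + h))\<^sup>2 - (max 0 0)\<^sup>2) / h) \<le> \<bar>h\<bar>"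
      by (intro always_eventually allI) (auto simp: max_def power2_eq_square)
    show "((\<lambda>h. \<bar>h\<bar>) \<longlongrightarrow> 0) (at (0 :: real))" by (intro tendsto_eq_intros) auto
  qed
  then show ?thesis using equal by (simp add: DERIV_def)
qed

text \<open>Only one derivative is ever taken, so two nested squared positive parts are smooth
  enough. The value is 0 up to \<open>e\<close> and 1 from \<open>2 * e\<close> on.\<close>

definition step :: "real \<Rightarrow> real \<Rightarrow> real" where
  "step e t = 1 - (max 0 (1 - (max 0 (t / e - 1))\<^sup>2))\<^sup>2"

definition step' :: "real \<Rightarrow> real \<Rightarrow> real" where
  "step' e t = 4 * max 0 (1 - (max 0 (t / e - 1))\<^sup>2) * max 0 (t / e - 1) / e"

lemma step_deriv: "e > 0 \<Longrightarrow> (step e has_real_derivative step' e t) (at t)"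
proof -
  assume e: "e > 0"
  have 1: "((\<lambda>t. t / e - 1) has_real_derivative 1 / e) (at t)"
    using e by (auto intro!: derivative_eq_intros)
  note 2 = DERIV_chain2[OF has_real_derivative_sq_pos 1]
  have 3: "((\<lambda>t. 1 - (max 0 (t / e - 1))\<^sup>2) has_real_derivative 0 - 2 * max 0 (t / e - 1) * (1 / e)) (at t)"
    by (intro DERIV_diff DERIV_const 2)
  note 4 = DERIV_diff[OF DERIV_const[of 1] DERIV_chain2[OF has_real_derivative_sq_pos 3]]
  show ?thesis
    unfolding step_def[abs_def] step'_def by (rule DERIV_cong[OF 4]) simp
qed

lemma step'_cont: "e > 0 \<Longrightarrow> continuous_on UNIV (step' e)"
  unfolding step'_def[abs_def] by (intro continuous_intros) auto

lemma step'_nonneg: "e > 0 \<Longrightarrow> step' e t \<ge> 0"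
  unfolding step'_def by simp

lemma step_0: "e > 0 \<Longrightarrow> t \<le> e \<Longrightarrow> step e t = 0"
  by (simp add: step_def max_def)

lemma step'_0: "e > 0 \<Longrightarrow> t \<le> e \<Longrightarrow> step' e t = 0"
  by (simp add: step'_def max_def)

lemma step_1: "e > 0 \<Longrightarrow> t \<ge> 2 * e \<Longrightarrow> step e t = 1"
proof -
  assume e: "e > 0" "t \<ge> 2 * e"
  then have "t / e - 1 \<ge> 1" by (simp add: field_simps)
  then have "1 \<le> (max 0 (t / e - 1))\<^sup>2" by (simp add: one_le_power)
  then show ?thesis by (simp add: step_def)
qed

lemma step'_1: "e > 0 \<Longrightarrow> t \<ge> 2 * e \<Longrightarrow> step' e t = 0"
proof -
  assume e: "e > 0" "t \<ge> 2 * e"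
  then have "t / e - 1 \<ge> 1" by (simp add: field_simps)
  then have "1 \<le> (max 0 (t / e - 1))\<^sup>2" by (simp add: one_le_power)
  then show ?thesis by (simp add: step'_def)
qed

lemma step_bounds: "0 \<le> step e t" "step e t \<le> 1"
proof -
  have "(max 0 (1 - (max 0 (t / e - 1))\<^sup>2))\<^sup>2 \<le> 1"
    by (rule power_le_one) auto
  then show "0 \<le> step e t" by (simp add: step_def)
qed (simp add: step_def)

text \<open>For real F, 2 \<partial>F = X implies that twice the antiholomorphic derivative is
  \<open>cnj X\<close>. Multiplied by X, this produces the weight |X|^2 of the error term.\<close>

lemma dbar2_real_compose:
  fixes F :: "complex \<Rightarrow> real"
  assumes t: "(\<theta> has_real_derivative t') (at (F y))"
    and F: "(F has_derivative (\<lambda>h. Re (X * h))) (at y)"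
  shows "dbar2 (\<lambda>x. of_real (\<theta> (F x))) y = of_real t' * cnj X"
proof -
  have "((\<lambda>x. \<theta> (F x)) has_derivative (\<lambda>h. t' * Re (X * h))) (at y)"
    using has_derivative_compose[OF F t[unfolded has_field_derivative_def]] by simp
  from bounded_linear.has_derivative[OF bounded_linear_of_real this]
  have "((\<lambda>x. complex_of_real (\<theta> (F x))) has_derivative (\<lambda>h. of_real (t' * Re (X * h)))) (at y)" .
  from dbar2_of_has_derivative[OF this] show ?thesis
    by (simp add: complex_eq_iff)
qed

lemma C1_on_norm_sq: "C1_on N (\<lambda>x. (norm (x - a))\<^sup>2)"
  and has_derivative_norm_sq: "((\<lambda>x. (norm (x - a))\<^sup>2) has_derivative (\<lambda>h. Re (2 * cnj (y - a) * h))) (at y)"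
  for a y :: complex
proof -
  have eq: "(\<lambda>x. (norm (x - a))\<^sup>2) = (\<lambda>x. (Re (x - a))\<^sup>2 + (Im (x - a))\<^sup>2)"
    by (simp add: cmod_power2 fun_eq_iff)
  show D: "((\<lambda>x. (norm (x - a))\<^sup>2) has_derivative (\<lambda>h. Re (2 * cnj (y - a) * h))) (at y)" for y
    unfolding eq by (auto intro!: derivative_eq_intros simp: algebra_simps fun_eq_iff)
  show "C1_on N (\<lambda>x. (norm (x - a))\<^sup>2)"
    by (rule C1_onI[OF D]) (intro continuous_intros)
qed

subsection \<open>The effective potential\<close>

locale charged = equilibrium +
  fixes Q :: "complex \<Rightarrow> real" and n :: nat and z :: "nat \<Rightarrow> complex" and q :: "nat \<Rightarrow> real"
  assumes p_eq: "p = charged_field Q n z q"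
    and Z_eq: "Z = z ` {1..n}"
    and g_eq: "g = (\<lambda>x. (1 + (\<Sum>j=1..n. q j)) / (2 * pi) * laplacian Q x)"
    and smooth_Q: "smooth Q"
    and q_pos: "\<And>j. j \<in> {1..n} \<Longrightarrow> q j > 0"
begin

definition qs where "qs = (\<Sum>j=1..n. q j)"

lemma qs_nonneg: "qs \<ge> 0"
  unfolding qs_def using q_pos by (intro sum_nonneg) (auto intro: less_imp_le)

text \<open>In terms of the Wirtinger derivative, \<open>G\<close> is \<open>2 \<partial>Q\<close> and \<open>X\<close> is \<open>2 \<partial>w\<close>.\<close>

definition w where "w x = log_potential \<rho> x + p x - robin"

definition G where "G x = complex_of_real (pd_x Q x) - \<i> * of_real (pd_y Q x)"

definition X where "X x = of_real (1 + qs) * G x - cauchy_transform \<rho> x - (\<Sum>j=1..n. of_real (q j) / (x - z j))"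

lemma w_S: "x \<in> S \<Longrightarrow> w x = 0"
  by (simp add: w_def effective_eq)

lemma w_nonneg: "x \<notin> Z \<Longrightarrow> w x \<ge> 0"
  using effective_ge[of x] by (simp add: w_def)

lemma open_compl_Z: "open (- Z)"
  using finite_Z by (simp add: finite_imp_closed open_Compl)

lemma w_eq: "w = (\<lambda>x. log_potential \<rho> x + ((1 + qs) * Q x + (\<Sum>j=1..n. q j * - ln (norm (x - z j)))) - robin)"
proof
  fix x
  have "p x = (1 + qs) * Q x + (\<Sum>j=1..n. q j * - ln (norm (x - z j)))"
    by (simp only: p_eq charged_field_def qs_def)
  then show "w x = log_potential \<rho> x + ((1 + qs) * Q x + (\<Sum>j=1..n. q j * - ln (norm (x - z j)))) - robin"
    by (simp only: w_def)
qed

lemma has_derivative_w: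
  assumes "x \<notin> Z"
  shows "(w has_derivative (\<lambda>h. Re (X x * h))) (at x)"
proof -
  obtain M R where "bounded_density \<rho> M R" using bounded_density by blast
  then have U: "(log_potential \<rho> has_derivative (\<lambda>h. - Re (h * cauchy_transform \<rho> x))) (at x)"
    by (rule bounded_density.has_derivative_log_potential)
  have l: "((\<lambda>x. ln (norm (x - z j))) has_derivative (\<lambda>h. Re (h / (x - z j)))) (at x)" if "j \<in> {1..n}" for j
  proof -
    have ne: "x - z j \<noteq> 0" using assms that by (auto simp: Z_eq)
    have "((\<lambda>x. x - z j) has_derivative (\<lambda>h. h)) (at x)" by (auto intro!: derivative_eq_intros)
    from has_derivative_compose[OF this has_derivative_ln_norm[OF ne]] show ?thesis .
  qed
  have "(w has_derivative (\<lambda>h. - Re (h * cauchy_transform \<rho> x) + ((1 + qs) * (pd_x Q x * Re h + pd_y Q x * Im h)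
     + (\<Sum>j=1..n. q j * - Re (h / (x - z j)))) - 0)) (at x)"
    unfolding w_eq
    by (intro has_derivative_diff has_derivative_add has_derivative_const U has_derivative_mult_right
        has_derivative_pd[OF smooth_Q] has_derivative_sum has_derivative_minus l; assumption)
  moreover have "- Re (h * cauchy_transform \<rho> x) + ((1 + qs) * (pd_x Q x * Re h + pd_y Q x * Im h)
     + (\<Sum>j=1..n. q j * - Re (h / (x - z j)))) - 0 = Re (X x * h)" for h
  proof -
    have "(\<Sum>j=1..n. q j * - Re (h / (x - z j))) = - Re ((\<Sum>j=1..n. of_real (q j) / (x - z j)) * h)"
    proof -
      have "Re ((\<Sum>j=1..n. of_real (q j) / (x - z j)) * h) = (\<Sum>j=1..n. Re (of_real (q j) / (x - z j) * h))"
        by (simp only: sum_distrib_right Re_sum)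
      also have "\<dots> = (\<Sum>j=1..n. q j * Re (h / (x - z j)))"
      proof (rule sum.cong[OF refl])
        fix j
        have "of_real (q j) / (x - z j) * h = of_real (q j) * (h / (x - z j))" by simp
        then show "Re (of_real (q j) / (x - z j) * h) = q j * Re (h / (x - z j))"
          by (simp only: times_complex.sel Re_complex_of_real Im_complex_of_real mult_zero_left diff_zero)
      qed
      finally show ?thesis by (simp add: sum_negf)
    qed
    moreover have "Re (of_real (1 + qs) * G x * h) = (1 + qs) * (pd_x Q x * Re h + pd_y Q x * Im h)"
      by (simp add: G_def algebra_simps)
    moreover have "Re (X x * h) = Re (of_real (1 + qs) * G x * h) - Re (h * cauchy_transform \<rho> x) - Re ((\<Sum>j=1..n. of_real (q j) / (x - z j)) * h)"
      unfolding X_def left_diff_distrib minus_complex.sel mult.commute[of h] ..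
    ultimately show ?thesis by simp
  qed
  ultimately show ?thesis by simp
qed

lemma isCont_w: "x \<notin> Z \<Longrightarrow> isCont w x"
  using has_derivative_w has_derivative_continuous by blast

text \<open>Points of \<open>S\<close> are minima of \<open>w\<close>, hence critical.\<close>

lemma X_eq_0_of_w_eq_0:
  assumes "x \<notin> Z" "w x = 0"
  shows "X x = 0"
proof -
  have "(\<lambda>h. Re (X x * h)) = (\<lambda>h. 0)"
    by (rule differential_zero_maxmin[OF _ open_compl_Z has_derivative_w[OF assms(1)]])
       (use assms w_nonneg in auto)
  from fun_cong[OF this, of "cnj (X x)"] have "(Re (X x))\<^sup>2 + (Im (X x))\<^sup>2 = 0"
    by (simp add: power2_eq_square)
  then show ?thesis by (simp add: complex_eq_iff sum_power2_eq_zero_iff)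
qed

lemma X_S: "x \<in> S \<Longrightarrow> X x = 0"
  using X_eq_0_of_w_eq_0 S_Z w_S by blast

lemma cauchy_holomorphic: "cauchy_transform \<rho> holomorphic_on - S"
proof -
  obtain M R where "bounded_density \<rho> M R" using bounded_density by blast
  then show ?thesis
    using bounded_density.cauchy_transform_holomorphic closed_S \<rho>_outside by blast
qed

lemma has_derivative_G:
  "(G has_derivative (\<lambda>h. of_real (pd_x (pd_x Q) x * Re h + pd_y (pd_x Q) x * Im h)
     - \<i> * of_real (pd_x (pd_y Q) x * Re h + pd_y (pd_y Q) x * Im h))) (at x)"
  unfolding G_def[abs_def]
  by (intro has_derivative_diff has_derivative_mult_right bounded_linear.has_derivative[OF bounded_linear_of_real]
      has_derivative_pd smooth_pd_x smooth_pd_y smooth_Q)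

lemma C1_on_G: "C1_on N G"
proof (rule C1_onI[OF has_derivative_G])
  have c: "continuous_on N (pd_x (pd_x Q))" "continuous_on N (pd_y (pd_x Q))"
    "continuous_on N (pd_x (pd_y Q))" "continuous_on N (pd_y (pd_y Q))"
    by (auto intro!: continuous_on_subset[OF smooth_imp_continuous] smooth_pd_x smooth_pd_y smooth_Q)
  show "continuous_on N (\<lambda>x. of_real (pd_x (pd_x Q) x * Re v + pd_y (pd_x Q) x * Im v)
     - \<i> * of_real (pd_x (pd_y Q) x * Re v + pd_y (pd_y Q) x * Im v))" for v
    by (intro continuous_intros c)
qed

text \<open>The imaginary part is the difference of the two mixed second derivatives of Q; here
  their symmetry enters.\<close>

lemma dbar2_G: "dbar2 G x = of_real (laplacian Q x)"
  using dbar2_of_has_derivative[OF has_derivative_G] pd_y_pd_x_commute[OF smooth_Q, of x]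
  by (simp add: laplacian_def complex_eq_iff)

text \<open>A subset J of the charges is allowed because near a node the singular terms are split
  off and treated separately.\<close>

lemma holomorphic_part_X:
  assumes "J \<subseteq> {1..n}" "N \<inter> z ` J = {}" "N \<inter> S = {}"
  shows "(\<lambda>x. - cauchy_transform \<rho> x - (\<Sum>j\<in>J. of_real (q j) / (x - z j))) holomorphic_on N"
proof -
  have "cauchy_transform \<rho> holomorphic_on N"
    by (rule holomorphic_on_subset[OF cauchy_holomorphic]) (use assms in auto)
  then show ?thesis
    by (intro holomorphic_intros) (use assms in auto)
qed

lemma
  assumes "open N" "N \<inter> Z = {}" "N \<inter> S = {}"
  shows C1_on_X: "C1_on N X" and dbar2_X: "\<And>x. x \<in> N \<Longrightarrow> dbar2 X x = of_real ((1 + qs) * laplacian Q x)"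
proof -
  let ?H = "\<lambda>x. - cauchy_transform \<rho> x - (\<Sum>j=1..n. of_real (q j) / (x - z j))"
  have H: "?H holomorphic_on N"
    by (rule holomorphic_part_X) (use assms in \<open>auto simp: Z_eq\<close>)
  have eq: "X = (\<lambda>x. of_real (1 + qs) * G x + ?H x)"
    by (simp add: X_def fun_eq_iff)
  have 1: "C1_on N (\<lambda>x. of_real (1 + qs) * G x)"
    by (intro C1_on_mult C1_on_const C1_on_G)
  note 2 = C1_on_holomorphic[OF assms(1) H]
  show "C1_on N X" unfolding eq by (rule C1_on_add[OF 1 2(1)])
  fix x assume x: "x \<in> N"
  show "dbar2 X x = of_real ((1 + qs) * laplacian Q x)"
    unfolding eq dbar2_add[OF 1 2(1) x] 2(2)[OF x] dbar2_mult[OF C1_on_const C1_on_G x] dbar2_const dbar2_G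
    by simp
qed

lemma C1_on_w:
  assumes "open N" "N \<inter> Z = {}" "N \<inter> S = {}"
  shows "C1_on N w"
proof (rule C1_onI)
  show "(w has_derivative (\<lambda>h. Re (X y * h))) (at y)" if "y \<in> N" for y
    using that assms by (intro has_derivative_w) auto
  show "continuous_on N (\<lambda>y. Re (X y * v))" for v
    by (intro continuous_intros C1_on_cont C1_on_X assms)
qed

lemma w_at_top: "a \<in> Z \<Longrightarrow> filterlim w at_top (at a)"
proof -
  assume a: "a \<in> Z"
  have "isCont (log_potential \<rho>) a"
    using potential_cont by (simp add: continuous_on_eq_continuous_at)
  then have "((\<lambda>y. log_potential \<rho> y - robin) \<longlongrightarrow> log_potential \<rho> a - robin) (at a)"
    by (intro tendsto_intros) (simp add: isCont_def)
  from filterlim_tendsto_add_at_top[OF this p_pole[OF a]]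
  show ?thesis by (simp add: w_def[abs_def] algebra_simps)
qed

end

section \<open>Green's formula for the cut-off gradient field\<close>

lemma has_bochner_integral_paraboloid_scaled:
  fixes a :: complex
  assumes r: "r > 0"
  shows "has_bochner_integral lborel (\<lambda>y. 4 / r\<^sup>2 * max 0 (1 - (norm (y - a))\<^sup>2 / r\<^sup>2)) (2 * pi)"
proof (rule has_bochner_integral_nn_integral)
  let ?T = "\<lambda>x::complex. a + r *\<^sub>R x"
  let ?f = "\<lambda>y. 4 / r\<^sup>2 * max 0 (1 - (norm (y - a))\<^sup>2 / r\<^sup>2)"
  have meas[measurable]: "(\<lambda>y. ennreal (?f y)) \<in> borel_measurable borel" by measurable
  have "(\<integral>\<^sup>+y. ennreal (?f y) \<partial>lborel) = (\<integral>\<^sup>+y. ennreal (?f y) \<partial>density (distr lborel borel ?T) (\<lambda>_. ennreal (\<bar>r\<bar> ^ DIM(complex))))"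
    using lborel_affine[of r a] r by simp
  also have "\<dots> = (\<integral>\<^sup>+y. ennreal (\<bar>r\<bar> ^ DIM(complex)) * ennreal (?f y) \<partial>distr lborel borel ?T)"
    by (rule nn_integral_density) auto
  also have "\<dots> = (\<integral>\<^sup>+x. ennreal (\<bar>r\<bar> ^ DIM(complex)) * ennreal (?f (?T x)) \<partial>lborel)"
    by (rule nn_integral_distr) auto
  also have "\<dots> = (\<integral>\<^sup>+x. ennreal 4 * ennreal (max 0 (1 - (norm (x::complex))\<^sup>2)) \<partial>lborel)"
  proof (rule nn_integral_cong)
    fix x :: complex
    have 1: "(norm (?T x - a))\<^sup>2 / r\<^sup>2 = (norm x)\<^sup>2"
      using r by (simp add: power_mult_distrib)
    have "ennreal (\<bar>r\<bar> ^ DIM(complex)) * ennreal (?f (?T x)) = ennreal (\<bar>r\<bar> ^ DIM(complex) * ?f (?T x))"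
      by (rule ennreal_mult'[symmetric]) simp
    also have "\<bar>r\<bar> ^ DIM(complex) * ?f (?T x) = 4 * max 0 (1 - (norm x)\<^sup>2)"
      unfolding 1 using r by simp
    also have "ennreal \<dots> = ennreal 4 * ennreal (max 0 (1 - (norm x)\<^sup>2))"
      by (rule ennreal_mult') simp
    finally show "ennreal (\<bar>r\<bar> ^ DIM(complex)) * ennreal (?f (?T x)) = ennreal 4 * ennreal (max 0 (1 - (norm x)\<^sup>2))" .
  qed
  also have "\<dots> = ennreal 4 * (\<integral>\<^sup>+x. ennreal (max 0 (1 - (norm (x::complex))\<^sup>2)) \<partial>lborel)"
    by (rule nn_integral_cmult) auto
  also have "(\<integral>\<^sup>+x. ennreal (max 0 (1 - (norm (x::complex))\<^sup>2)) \<partial>lborel) = ennreal (pi / 2)"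
    using has_bochner_integral_paraboloid
    by (subst nn_integral_eq_integral) (auto simp: has_bochner_integral_iff)
  also have "ennreal 4 * ennreal (pi / 2) = ennreal (2 * pi)"
    by (subst ennreal_mult'[symmetric]) auto
  finally show "(\<integral>\<^sup>+y. ennreal (?f y) \<partial>lborel) = ennreal (2 * pi)" .
qed auto

lemma integrable_bounded_indicator:
  fixes h :: "complex \<Rightarrow> complex"
  assumes A: "A \<in> sets borel" "bounded A" and h: "continuous_on A h" "\<And>x. x \<in> A \<Longrightarrow> norm (h x) \<le> B"
  shows "integrable lborel (\<lambda>x. indicator A x *\<^sub>R h x)"
proof -
  obtain R where "\<forall>x\<in>A. norm x \<le> R" using A(2) bounded_iff by blast
  then have R: "A \<subseteq> cball 0 R" by auto
  show ?thesis
  proof (rule Bochner_Integration.integrable_bound)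
    show "integrable lborel (\<lambda>x::complex. max B 0 * indicator (cball 0 (max R 0)) x :: real)"
      by (intro integrable_mult_right integrable_real_indicator) (simp_all add: emeasure_cball)
    have "norm (indicator A x *\<^sub>R h x) \<le> norm (max B 0 * indicator (cball 0 (max R 0)) x :: real)" for x
      using h(2)[of x] R by (auto split: split_indicator)
    then show "AE x in lborel. norm (indicator A x *\<^sub>R h x) \<le> norm (max B 0 * indicator (cball 0 (max R 0)) x :: real)"
      by simp
    show "(\<lambda>x. indicator A x *\<^sub>R h x) \<in> borel_measurable lborel"
      using borel_measurable_continuous_on_indicator[OF A(1) h(1)] by simp
  qed
qed

context charged
begin

lemma near_pole:
  assumes "a \<in> Z" "open N" "a \<in> N"
  shows "\<exists>r>0. ball a r \<subseteq> N \<and> ball a r \<inter> Z = {a} \<and> (\<forall>y\<in>ball a r - {a}. w y \<ge> e)"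
proof -
  have "\<forall>\<^sub>F y in at a. w y \<ge> e"
    using w_at_top[OF assms(1)] by (simp add: filterlim_at_top)
  then obtain d1 where d1: "d1 > 0" "\<And>y. y \<noteq> a \<Longrightarrow> dist y a < d1 \<Longrightarrow> w y \<ge> e"
    unfolding eventually_at by auto
  obtain d2 where d2: "d2 > 0" "ball a d2 \<subseteq> N" using assms by (meson openE)
  obtain d3 where d3: "d3 > 0" "\<And>x. x \<in> Z \<Longrightarrow> x \<noteq> a \<Longrightarrow> d3 \<le> dist a x"
    using finite_set_avoid[OF finite_Z, of a] by blast
  define r where "r = min d1 (min d2 d3)"
  have "ball a r \<inter> Z = {a}"
    using d1(1) d2(1) d3 assms(1) by (force simp: r_def)
  moreover have "ball a r \<subseteq> N" using d2 by (auto simp: r_def)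
  moreover have "w y \<ge> e" if "y \<in> ball a r - {a}" for y
    using that by (intro d1) (auto simp: r_def dist_commute)
  moreover have "r > 0" using d1 d2 d3 by (simp add: r_def)
  ultimately show ?thesis by blast
qed

text \<open>A limit point on the frontier of N would lie in \<open>S\<close>, where w = 0 < e. So
  functions supported in this set extend by 0 across the frontier, however irregular it is.\<close>

lemma closed_superlevel:
  assumes "open N" "frontier N \<subseteq> S" "e > 0"
  shows "closed {x \<in> N. x \<in> Z \<or> w x \<ge> e}"
  unfolding closed_sequential_limits
proof (intro allI impI, elim conjE)
  fix x l assume x: "\<forall>n. x n \<in> {x \<in> N. x \<in> Z \<or> w x \<ge> e}" and l: "x \<longlonglongrightarrow> l"
  have "l \<in> closure N" using x l closure_sequential by blast
  then have N_or_S: "l \<in> N \<or> l \<in> S"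
    using assms(1,2) by (auto simp: frontier_def interior_open)
  show "l \<in> {x \<in> N. x \<in> Z \<or> w x \<ge> e}"
  proof (cases "l \<in> Z")
    case True
    then show ?thesis using N_or_S S_Z by auto
  next
    case False
    then have "\<forall>\<^sub>F n in sequentially. x n \<in> - Z"
      by (intro topological_tendstoD[OF l open_compl_Z]) simp
    then have "\<forall>\<^sub>F n in sequentially. e \<le> w (x n)"
      by eventually_elim (use x in auto)
    moreover have "(\<lambda>n. w (x n)) \<longlonglongrightarrow> w l"
      using isCont_w[OF False] l by (rule isCont_tendsto_compose)
    ultimately have "e \<le> w l"
      by (intro tendsto_lowerbound[where f = "\<lambda>n. w (x n)"]) auto
    then show ?thesis using N_or_S w_S[of l] assms(3) by auto
  qed
qed

text \<open>The field f \<theta>(w) X vanishes near the frontier, and near a node a, where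
  \<theta>(w) = 1, it has a simple pole with coefficient - c a * f a. Adding c a * f a / (y - a)
  times a bump cancels the pole and leaves a C1 function of compact support in the plane, whose
  \<open>dbar2\<close> has integral 0. The \<open>dbar2\<close> of the correction is a smeared point
  mass, which gives the sum over the nodes.\<close>

lemma green:
  assumes N: "open N" "bounded N" "N \<inter> S = {}" "frontier N \<subseteq> S"
    and f: "f holomorphic_on N" "\<And>x. x \<in> N \<Longrightarrow> norm (f x) \<le> B" and e: "e > 0"
  defines "I1 \<equiv> \<lambda>y. indicator (N - Z) y *\<^sub>R (f y * of_real (step' e (w y) * (norm (X y))\<^sup>2))"
    and "I2 \<equiv> \<lambda>y. indicator (N - Z) y *\<^sub>R (f y * of_real (step e (w y) * laplacian Q y))"
  shows "integrable lborel I1" "integrable lborel I2"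
    "integral\<^sup>L lborel I1 + of_real (1 + qs) * integral\<^sup>L lborel I2 =
       of_real (2 * pi) * (\<Sum>j\<in>{j\<in>{1..n}. z j \<in> N}. of_real (q j) * f (z j))"
proof -
  define A where "A = Z \<inter> N"
  have fin_A: "finite A" using finite_Z by (simp add: A_def)
  define c where "c a = (\<Sum>j\<in>{j\<in>{1..n}. z j = a}. q j)" for a
  have "\<forall>a\<in>A. \<exists>r>0. ball a r \<subseteq> N \<and> ball a r \<inter> Z = {a} \<and> (\<forall>y\<in>ball a r - {a}. w y \<ge> 2 * e)"
    unfolding A_def using near_pole N(1) by blast
  then obtain r where r: "\<And>a. a \<in> A \<Longrightarrow> r a > 0" "\<And>a. a \<in> A \<Longrightarrow> ball a (r a) \<subseteq> N"
    "\<And>a. a \<in> A \<Longrightarrow> ball a (r a) \<inter> Z = {a}"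
    "\<And>a y. a \<in> A \<Longrightarrow> y \<in> ball a (r a) \<Longrightarrow> y \<noteq> a \<Longrightarrow> w y \<ge> 2 * e"
    by (subst (asm) bchoice_iff) blast
  define K where "K = {x \<in> N. x \<in> Z \<or> w x \<ge> e}"
  have K: "closed K" unfolding K_def by (rule closed_superlevel[OF N(1,4) e])
  \<comment> \<open>The bump is a function of |y - a|^2, so its \<open>dbar2\<close> contains a
    factor y - a that cancels the pole of 1 / (y - a). The outer square makes it C1 across the
    circle.\<close>
  define \<phi> where "\<phi> a y = complex_of_real ((max 0 (1 - (norm (y - a))\<^sup>2 / (r a)\<^sup>2))\<^sup>2)" for a y
  define T where "T a y = (of_real (c a) * f a) * (\<phi> a y * (1 / (y - a)))" for a y
  define base where "base y = f y * of_real (step e (w y)) * X y + (\<Sum>a\<in>A. T a y)" for y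
  define gq where "gq a y = (if y = a then deriv f a else (f y - f a) / (y - a))" for a y
  define Xr where "Xr a y = of_real (1 + qs) * G y + (- cauchy_transform \<rho> y - (\<Sum>j\<in>{j\<in>{1..n}. z j \<noteq> a}. of_real (q j) / (y - z j)))" for a y
  \<comment> \<open>The corrected field on the disc around \<open>a\<close>, written without
    singular terms. With u = y - a, the holomorphic quotient \<open>gq\<close> absorbs (f y - f a) /
    u. Since the bump is (1 - u cnj u / r^2)^2, the quotient (bump - 1) / u is the polynomial in u
    and cnj u of the middle line.\<close>
  define \<Lambda> where "\<Lambda> a y = (f y * Xr a y - of_real (c a) * gq a y)
    + (of_real (c a) * f a) * (cnj (y - a) * (- 2 / of_real ((r a)\<^sup>2) + (y - a) * cnj (y - a) * (1 / of_real ((r a) ^ 4))))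
    + (\<Sum>b\<in>A - {a}. T b y)" for a y
  define \<Psi> where "\<Psi> y = (if y \<in> A then \<Lambda> y y else if y \<in> N then base y else 0)" for y
  have open_NZ: "open (N - Z)" using N(1) open_compl_Z by (simp add: Diff_eq open_Int)
  have NZ: "(N - Z) \<inter> Z = {}" "(N - Z) \<inter> S = {}" using N by auto
  have holf: "f holomorphic_on (N - Z)" using f(1) holomorphic_on_subset by blast
  have \<phi>_out: "\<phi> a y = 0" if "a \<in> A" "y \<notin> ball a (r a)" for a y
  proof -
    have "r a \<le> norm (y - a)" using that by (simp add: dist_norm norm_minus_commute)
    then have "(r a)\<^sup>2 \<le> (norm (y - a))\<^sup>2" using r(1)[OF that(1)] by (intro power_mono) auto
    then have "1 - (norm (y - a))\<^sup>2 / (r a)\<^sup>2 \<le> 0" using r(1)[OF that(1)] by simp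
    then show ?thesis by (simp add: \<phi>_def max_def)
  qed
  have C1_F: "C1_on M (\<lambda>y. 1 - (norm (y - a))\<^sup>2 / (r a)\<^sup>2)" for M a
    unfolding divide_inverse by (intro C1_on_diff C1_on_const C1_on_mult C1_on_norm_sq)
  have C1_\<phi>: "C1_on M (\<phi> a)" for M a
    unfolding \<phi>_def
    by (intro C1_on_bounded_linear[OF bounded_linear_of_real] C1_on_compose_real[OF has_real_derivative_sq_pos _ C1_F] continuous_intros)
  have hol_inv: "(\<lambda>y. 1 / (y - a)) holomorphic_on - {a}" for a
    by (intro holomorphic_intros) auto
  note inv_a = C1_on_holomorphic[OF open_Compl[OF closed_singleton] hol_inv]
  have C1_T: "C1_on (- {a}) (T a)" for a
    unfolding T_def by (intro C1_on_mult C1_on_const C1_\<phi> inv_a)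
  have dbar_\<phi>: "dbar2 (\<phi> a) y = of_real (2 * max 0 (1 - (norm (y - a))\<^sup>2 / (r a)\<^sup>2)) * (- 2 * (y - a) / of_real ((r a)\<^sup>2))" for a y
  proof -
    have D: "((\<lambda>x. 1 - (norm (x - a))\<^sup>2 / (r a)\<^sup>2) has_derivative (\<lambda>h. Re ((- 2 * cnj (y - a) / of_real ((r a)\<^sup>2)) * h))) (at y)"
    proof (rule has_derivative_eq_rhs)
      show "((\<lambda>x. 1 - (norm (x - a))\<^sup>2 / (r a)\<^sup>2) has_derivative (\<lambda>h. 0 - Re (2 * cnj (y - a) * h) * inverse ((r a)\<^sup>2))) (at y)"
        unfolding divide_inverse
        by (intro has_derivative_diff has_derivative_const has_derivative_mult_left has_derivative_norm_sq)
      show "(\<lambda>h. 0 - Re (2 * cnj (y - a) * h) * inverse ((r a)\<^sup>2)) = (\<lambda>h. Re ((- 2 * cnj (y - a) / of_real ((r a)\<^sup>2)) * h))"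
      proof
        fix h
        have "(- 2 * cnj (y - a) / of_real ((r a)\<^sup>2)) * h = of_real (- inverse ((r a)\<^sup>2)) * (2 * cnj (y - a) * h)"
          by (simp add: divide_inverse algebra_simps)
        then show "0 - Re (2 * cnj (y - a) * h) * inverse ((r a)\<^sup>2) = Re ((- 2 * cnj (y - a) / of_real ((r a)\<^sup>2)) * h)"
          by (simp only: times_complex.sel Re_complex_of_real Im_complex_of_real mult_zero_left diff_zero) simp
      qed
    qed
    show ?thesis
      unfolding \<phi>_def using dbar2_real_compose[OF has_real_derivative_sq_pos D] by simp
  qed
  have dbar_T: "dbar2 (T a) y = - (of_real (c a) * f a * of_real (4 / (r a)\<^sup>2 * max 0 (1 - (norm (y - a))\<^sup>2 / (r a)\<^sup>2)))"
    if "y \<noteq> a" for a y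
  proof -
    have y: "y \<in> - {a}" using that by simp
    have "dbar2 (T a) y = of_real (c a) * f a * (dbar2 (\<phi> a) y * (1 / (y - a)))"
      unfolding T_def dbar2_mult[OF C1_on_const C1_on_mult[OF C1_\<phi> inv_a(1)] y] dbar2_mult[OF C1_\<phi> inv_a(1) y] dbar2_const inv_a(2)[OF y]
      by simp
    also have "dbar2 (\<phi> a) y * (1 / (y - a)) = - of_real (4 / (r a)\<^sup>2 * max 0 (1 - (norm (y - a))\<^sup>2 / (r a)\<^sup>2))"
    proof -
      have *: "of_real (2 * m) * (- 2 * u / of_real R) * (1 / u) = - of_real (4 / R * m)" if "u \<noteq> 0" for m R and u :: complex
        using that by (simp add: field_simps)
      show ?thesis unfolding dbar_\<phi> by (rule *) (use that in simp)
    qed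
    finally show ?thesis by simp
  qed
  have C1_w: "C1_on (N - Z) (\<lambda>y. of_real (step e (w y)) :: complex)"
    by (intro C1_on_bounded_linear[OF bounded_linear_of_real] C1_on_compose_real[OF step_deriv step'_cont] e C1_on_w open_NZ NZ)
  have C1_fw: "C1_on (N - Z) (\<lambda>y. f y * of_real (step e (w y)))"
    by (intro C1_on_mult C1_w C1_on_holomorphic open_NZ holf)
  have C1_T': "C1_on (N - Z) (T a)" if "a \<in> A" for a
    by (rule C1_on_subset[OF C1_T]) (use that in \<open>auto simp: A_def\<close>)
  have C1_fwX: "C1_on (N - Z) (\<lambda>y. f y * of_real (step e (w y)) * X y)"
    by (intro C1_on_mult[OF C1_fw] C1_on_X open_NZ NZ)
  have C1_base: "C1_on (N - Z) base"
    unfolding base_def by (intro C1_on_add C1_fwX C1_on_sum C1_T')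
  have \<Psi>_base: "\<Psi> y = base y" if "y \<in> N - Z" for y
    using that by (simp add: \<Psi>_def A_def)
  have \<Psi>_zero: "\<Psi> y = 0" if "y \<in> - K" for y
  proof (cases "y \<in> N")
    case True
    with that have y: "y \<notin> Z" "w y < e" by (auto simp: K_def)
    have "T a y = 0" if a: "a \<in> A" for a
    proof -
      have "y \<notin> ball a (r a)"
        using r(4)[OF a, of y] y a e by (auto simp: A_def)
      then show ?thesis by (simp add: T_def \<phi>_out[OF a])
    qed
    then show ?thesis
      using y True step_0[OF e, of "w y"] by (simp add: \<Psi>_def A_def base_def)
  qed (auto simp: \<Psi>_def A_def)
  have C1_\<Lambda>: "C1_on (ball a (r a)) (\<Lambda> a)" if a: "a \<in> A" for a
  proof -
    let ?b = "ball a (r a)"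
    have hf: "f holomorphic_on ?b" using f(1) r(2)[OF a] holomorphic_on_subset by blast
    have "gq a holomorphic_on ?b"
      using pole_lemma_open[OF hf open_ball] unfolding gq_def by simp
    then have 1: "C1_on ?b (gq a)" by (rule C1_on_holomorphic[OF open_ball])
    have H: "(\<lambda>y. - cauchy_transform \<rho> y - (\<Sum>j\<in>{j\<in>{1..n}. z j \<noteq> a}. of_real (q j) / (y - z j))) holomorphic_on ?b"
    proof (rule holomorphic_part_X)
      show "?b \<inter> z ` {j \<in> {1..n}. z j \<noteq> a} = {}"
        using r(3)[OF a] unfolding Z_eq by blast
      show "?b \<inter> S = {}" using r(2)[OF a] N(3) by blast
    qed auto
    have 2: "C1_on ?b (Xr a)"
      unfolding Xr_def by (rule C1_on_add[OF C1_on_mult[OF C1_on_const C1_on_G] C1_on_holomorphic(1)[OF open_ball H]])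
    have id: "C1_on ?b (\<lambda>y. y - a)" by (rule C1_on_holomorphic[OF open_ball]) (intro holomorphic_intros)
    have 3: "C1_on ?b (T b)" if "b \<in> A - {a}" for b
    proof (rule C1_on_subset[OF C1_T])
      have "b \<notin> ball a (r a)" using r(3)[OF a] that unfolding A_def by blast
      then show "ball a (r a) \<subseteq> - {b}" by blast
    qed
    show ?thesis
      unfolding \<Lambda>_def
      by (intro C1_on_add C1_on_diff C1_on_mult C1_on_const C1_on_sum C1_on_bounded_linear[OF bounded_linear_cnj]
          C1_on_holomorphic(1)[OF open_ball hf] 1 2 id 3)
  qed
  have \<Psi>_\<Lambda>: "\<Psi> y = \<Lambda> a y" if a: "a \<in> A" and y: "y \<in> ball a (r a)" for a y
  proof (cases "y = a")
    case False
    define u where "u = y - a"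
    have u: "u \<noteq> 0" using False by (simp add: u_def)
    have ra: "r a > 0" using r(1)[OF a] .
    have yN: "y \<in> N - Z" using r(2,3)[OF a] y False by auto
    have st: "step e (w y) = 1" using step_1[OF e] r(4)[OF a y False] by blast
    have "(\<Sum>j=1..n. of_real (q j) / (y - z j)) = (\<Sum>j\<in>{j\<in>{1..n}. z j \<noteq> a}. of_real (q j) / (y - z j)) + of_real (c a) / u"
    proof -
      have "(\<Sum>j=1..n. of_real (q j) / (y - z j)) = (\<Sum>j\<in>{j\<in>{1..n}. z j \<noteq> a}. of_real (q j) / (y - z j)) + (\<Sum>j\<in>{j\<in>{1..n}. z j = a}. of_real (q j) / (y - z j))"
        by (subst sum.union_disjoint[symmetric]) (auto intro!: sum.cong)
      also have "(\<Sum>j\<in>{j\<in>{1..n}. z j = a}. of_real (q j) / (y - z j)) = (\<Sum>j\<in>{j\<in>{1..n}. z j = a}. of_real (q j) / u)"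
        by (intro sum.cong) (auto simp: u_def)
      finally show ?thesis by (simp add: c_def sum_divide_distrib)
    qed
    then have X: "X y = Xr a y - of_real (c a) / u"
      by (simp add: X_def Xr_def)
    have nu: "norm u < r a" using y by (simp add: u_def dist_norm norm_minus_commute)
    have "(norm u)\<^sup>2 \<le> (r a)\<^sup>2" using nu by (intro power_mono) auto
    then have "max 0 (1 - (norm u)\<^sup>2 / (r a)\<^sup>2) = 1 - (norm u)\<^sup>2 / (r a)\<^sup>2"
      using ra by (simp add: max_def)
    then have "\<phi> a y = (1 - u * cnj u / of_real ((r a)\<^sup>2))\<^sup>2"
    proof -
      have "complex_of_real ((1 - m / R)\<^sup>2) = (1 - of_real m / of_real R)\<^sup>2" for m R by simp
      then have "complex_of_real ((1 - (norm u)\<^sup>2 / (r a)\<^sup>2)\<^sup>2) = (1 - of_real ((norm u)\<^sup>2) / of_real ((r a)\<^sup>2))\<^sup>2" .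
      moreover assume "max 0 (1 - (norm u)\<^sup>2 / (r a)\<^sup>2) = 1 - (norm u)\<^sup>2 / (r a)\<^sup>2"
      ultimately show ?thesis
        unfolding \<phi>_def u_def[symmetric] complex_norm_square[symmetric] by (simp only:)
    qed
    then have \<phi>: "\<phi> a y * (1 / u) - 1 / u = cnj u * (- 2 / of_real ((r a)\<^sup>2) + u * cnj u * (1 / of_real ((r a) ^ 4)))"
      using u ra by (simp add: field_simps power2_eq_square eval_nat_numeral)
    have "\<Psi> y = (f y * X y + T a y) + (\<Sum>b\<in>A - {a}. T b y)"
      unfolding \<Psi>_base[OF yN] base_def st sum.remove[OF fin_A a] by simp
    also have "f y * X y + T a y = (f y * Xr a y - of_real (c a) * ((f y - f a) / u)) + (of_real (c a) * f a) * (\<phi> a y * (1 / u) - 1 / u)"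
      unfolding X T_def u_def[symmetric] by (simp add: algebra_simps diff_divide_distrib)
    finally show ?thesis
      unfolding \<Lambda>_def \<phi> u_def[symmetric] gq_def using False by (simp add: algebra_simps u_def)
  qed (use a in \<open>simp add: \<Psi>_def\<close>)
  \<comment> \<open>Three kinds of open sets cover the plane: discs around the nodes,
    \<open>N - Z\<close>, and the complement of the closed superlevel set, where the field is
    0.\<close>
  have C1_\<Psi>: "C1_on UNIV \<Psi>"
  proof (rule C1_on_local)
    fix y :: complex
    consider "y \<in> A" | "y \<in> N - Z" | "y \<in> - K" by (auto simp: A_def K_def)
    then show "\<exists>M. open M \<and> y \<in> M \<and> C1_on M \<Psi>"
    proof cases
      case 1
      show ?thesis
        by (rule exI[of _ "ball y (r y)"]) (use 1 r(1) C1_on_cong[OF open_ball \<Psi>_\<Lambda>[OF 1] C1_\<Lambda>[OF 1]] in auto)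
    next
      case 2
      show ?thesis
        by (rule exI[of _ "N - Z"]) (use 2 open_NZ C1_on_cong[OF open_NZ \<Psi>_base C1_base] in auto)
    next
      case 3
      show ?thesis
        by (rule exI[of _ "- K"]) (use 3 K C1_on_cong[OF open_Compl[OF K] \<Psi>_zero C1_on_const] in auto)
    qed
  qed
  obtain R where R: "N \<subseteq> cball 0 R" using N(2) unfolding bounded_iff by (metis mem_cball_0 subsetI)
  have supp: "\<Psi> x = 0" if "norm x > R" for x
    by (rule \<Psi>_zero) (use that R in \<open>auto simp: K_def\<close>)
  have int\<Psi>: "integrable lborel (dbar2 \<Psi>)" "integral\<^sup>L lborel (dbar2 \<Psi>) = 0"
    using integral_dbar2_eq_0[OF C1_\<Psi>, of R] supp by auto
  define P where "P a y = 4 / (r a)\<^sup>2 * max 0 (1 - (norm (y - a))\<^sup>2 / (r a)\<^sup>2)" for a y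
  have P: "has_bochner_integral lborel (P a) (2 * pi)" if "a \<in> A" for a
    unfolding P_def by (rule has_bochner_integral_paraboloid_scaled[OF r(1)[OF that]])
  have P_zero: "P a y = 0" if "a \<in> A" "y \<notin> N" for a y
  proof -
    have "y \<notin> ball a (r a)" using r(2)[OF that(1)] that(2) by blast
    from \<phi>_out[OF that(1) this] show ?thesis
      unfolding \<phi>_def P_def by simp
  qed
  define J where "J y = (\<Sum>a\<in>A. of_real (c a) * f a * of_real (P a y))" for y
  have J: "has_bochner_integral lborel J (\<Sum>a\<in>A. of_real (c a) * f a * of_real (2 * pi))"
    unfolding J_def
    by (intro has_bochner_integral_sum has_bochner_integral_mult_right has_bochner_integral_of_real P)
  have dbar_base: "dbar2 \<Psi> y = I1 y + of_real (1 + qs) * I2 y - J y" if y: "y \<in> N - Z" for y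
  proof -
    have D: "(w has_derivative (\<lambda>h. Re (X y * h))) (at y)" using y by (intro has_derivative_w) auto
    have 1: "dbar2 (\<lambda>y. f y * of_real (step e (w y))) y = f y * (of_real (step' e (w y)) * cnj (X y))"
      unfolding dbar2_mult[OF C1_on_holomorphic(1)[OF open_NZ holf] C1_w y] C1_on_holomorphic(2)[OF open_NZ holf y]
        dbar2_real_compose[where \<theta> = "step e", OF step_deriv[OF e] D] by simp
    have 2: "dbar2 (\<lambda>y. f y * of_real (step e (w y)) * X y) y =
      f y * (of_real (step' e (w y)) * cnj (X y)) * X y + f y * of_real (step e (w y)) * of_real ((1 + qs) * laplacian Q y)"
      unfolding dbar2_mult[OF C1_fw C1_on_X[OF open_NZ NZ] y] 1 dbar2_X[OF open_NZ NZ y] ..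
    have "dbar2 \<Psi> y = dbar2 base y"
      by (rule dbar2_cong_open[OF open_NZ y \<Psi>_base])
    also have "\<dots> = dbar2 (\<lambda>y. f y * of_real (step e (w y)) * X y) y + dbar2 (\<lambda>y. \<Sum>a\<in>A. T a y) y"
      unfolding base_def by (rule dbar2_add[OF C1_fwX C1_on_sum[OF C1_T'] y])
    also have "dbar2 (\<lambda>y. \<Sum>a\<in>A. T a y) y = (\<Sum>a\<in>A. dbar2 (T a) y)"
      by (rule dbar2_sum[OF C1_T' y])
    also have "(\<Sum>a\<in>A. dbar2 (T a) y) = - J y"
      unfolding J_def sum_negf[symmetric] P_def
      by (intro sum.cong[OF refl] dbar_T) (use y in \<open>auto simp: A_def\<close>)
    finally show ?thesis
      unfolding 2 I1_def I2_def using y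
      by (simp add: complex_norm_square[unfolded of_real_power] algebra_simps)
  qed
  have AE_eq: "AE y in lborel. I1 y = dbar2 \<Psi> y - of_real (1 + qs) * I2 y + J y"
  proof -
    have "Z \<in> null_sets lborel" using finite_Z by (rule finite_imp_null_set_lborel)
    then have "AE y in lborel. y \<notin> Z" by (rule AE_not_in)
    then show ?thesis
    proof eventually_elim
      case (elim y)
      show ?case
      proof (cases "y \<in> N")
        case True
        then show ?thesis using dbar_base[of y] elim by simp
      next
        case False
        then have "y \<in> - K" by (auto simp: K_def)
        then have "dbar2 \<Psi> y = 0"
          using dbar2_cong_open[OF open_Compl[OF K] \<open>y \<in> - K\<close> \<Psi>_zero] by (simp add: dbar2_const)
        then show ?thesis using False by (simp add: I1_def I2_def J_def P_zero)
      qed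
    qed
  qed
  have NZ_borel: "N - Z \<in> sets borel" using open_NZ by (rule borel_open)
  have cont_w: "continuous_on (N - Z) w" using C1_on_cont[OF C1_on_w[OF open_NZ NZ]] .
  have cont_f: "continuous_on (N - Z) f" using holf by (rule holomorphic_on_imp_continuous_on)
  have cont_lap: "continuous_on (N - Z) (laplacian Q)"
    using continuous_laplacian[OF smooth_Q] by (rule continuous_on_subset) simp
  have cont_step: "continuous_on (N - Z) (\<lambda>y. step e (w y))"
    unfolding step_def using e by (intro continuous_intros cont_w) auto
  have cont_step': "continuous_on (N - Z) (\<lambda>y. step' e (w y))"
    unfolding step'_def using e by (intro continuous_intros cont_w) auto
  have cont_X: "continuous_on (N - Z) X" using C1_on_cont[OF C1_on_X[OF open_NZ NZ]] .
  show I2: "integrable lborel I2"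
  proof -
    have "compact (closure N)" using N(2) by (simp add: compact_closure)
    then have "compact (laplacian Q ` closure N)"
      by (rule compact_continuous_image[rotated]) (rule continuous_on_subset[OF continuous_laplacian[OF smooth_Q]], simp)
    then obtain L where "\<forall>y \<in> laplacian Q ` closure N. norm y \<le> L"
      using compact_imp_bounded bounded_iff by blast
    then have L: "\<bar>laplacian Q x\<bar> \<le> L" if "x \<in> N" for x
      using that closure_subset by fastforce
    show ?thesis
      unfolding I2_def
    proof (rule integrable_bounded_indicator[OF NZ_borel bounded_subset[OF N(2)]])
      show "continuous_on (N - Z) (\<lambda>y. f y * of_real (step e (w y) * laplacian Q y))"
        by (intro continuous_intros cont_f cont_step cont_lap)
      fix x assume x: "x \<in> N - Z"
      have fx: "norm (f x) \<le> B" and Lx: "\<bar>laplacian Q x\<bar> \<le> L" using x f(2) L by auto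
      have "\<bar>step e (w x)\<bar> * \<bar>laplacian Q x\<bar> \<le> 1 * L"
        by (rule mult_mono) (use step_bounds[of e "w x"] Lx in simp_all)
      then have "norm (f x) * (\<bar>step e (w x)\<bar> * \<bar>laplacian Q x\<bar>) \<le> B * (1 * L)"
        by (rule mult_mono[OF fx]) (use fx norm_ge_zero[of "f x"] in linarith, simp)
      then show "norm (f x * of_real (step e (w x) * laplacian Q x)) \<le> B * (1 * L)"
        by (simp add: norm_mult abs_mult)
    qed auto
  qed
  have I1_meas: "I1 \<in> borel_measurable lborel"
  proof -
    have "continuous_on (N - Z) (\<lambda>y. f y * of_real (step' e (w y) * (norm (X y))\<^sup>2))"
      by (intro continuous_intros cont_f cont_step' cont_X)
    then show ?thesis
      unfolding I1_def using borel_measurable_continuous_on_indicator[OF NZ_borel] by simp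
  qed
  have J_int: "integrable lborel J" and J_val: "integral\<^sup>L lborel J = (\<Sum>a\<in>A. of_real (c a) * f a * of_real (2 * pi))"
    using J by (auto simp: has_bochner_integral_iff)
  have I2': "integrable lborel (\<lambda>y. of_real (1 + qs) * I2 y)" using I2 by (rule integrable_mult_right)
  have rhs: "integrable lborel (\<lambda>y. dbar2 \<Psi> y - of_real (1 + qs) * I2 y + J y)"
    by (intro Bochner_Integration.integrable_add Bochner_Integration.integrable_diff int\<Psi> I2' J_int)
  show I1: "integrable lborel I1"
  proof (rule integrable_cong_AE_imp[OF rhs I1_meas])
    show "AE y in lborel. dbar2 \<Psi> y - of_real (1 + qs) * I2 y + J y = I1 y"
      using AE_eq by (rule eventually_mono) (rule sym)
  qed
  have "integral\<^sup>L lborel I1 = (LINT y|lborel. dbar2 \<Psi> y - of_real (1 + qs) * I2 y + J y)"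
    by (rule integral_cong_AE[OF I1_meas _ AE_eq]) (use rhs in auto)
  also have "\<dots> = 0 - of_real (1 + qs) * integral\<^sup>L lborel I2 + (\<Sum>a\<in>A. of_real (c a) * f a * of_real (2 * pi))"
    unfolding Bochner_Integration.integral_add[OF Bochner_Integration.integrable_diff[OF int\<Psi>(1) I2'] J_int]
      Bochner_Integration.integral_diff[OF int\<Psi>(1) I2'] int\<Psi>(2) J_val integral_mult_right_zero ..
  finally have "integral\<^sup>L lborel I1 + of_real (1 + qs) * integral\<^sup>L lborel I2 = (\<Sum>a\<in>A. of_real (c a) * f a * of_real (2 * pi))"
    by simp
  also have "\<dots> = of_real (2 * pi) * (\<Sum>a\<in>A. \<Sum>j\<in>{j\<in>{j\<in>{1..n}. z j \<in> N}. z j = a}. of_real (q j) * f (z j))"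
    unfolding sum_distrib_left
  proof (rule sum.cong[OF refl])
    fix a assume a: "a \<in> A"
    have "{j\<in>{j\<in>{1..n}. z j \<in> N}. z j = a} = {j\<in>{1..n}. z j = a}" using a by (auto simp: A_def)
    then show "of_real (c a) * f a * of_real (2 * pi) =
      (\<Sum>j\<in>{j\<in>{j\<in>{1..n}. z j \<in> N}. z j = a}. of_real (2 * pi) * (of_real (q j) * f (z j)))"
      by (simp add: c_def sum_distrib_right sum_distrib_left mult_ac)
  qed
  also have "(\<Sum>a\<in>A. \<Sum>j\<in>{j\<in>{j\<in>{1..n}. z j \<in> N}. z j = a}. of_real (q j) * f (z j)) =
     (\<Sum>j\<in>{j\<in>{1..n}. z j \<in> N}. of_real (q j) * f (z j))"
    by (rule sum.group) (auto simp: A_def Z_eq fin_A finite_Z)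
  finally show "integral\<^sup>L lborel I1 + of_real (1 + qs) * integral\<^sup>L lborel I2 =
       of_real (2 * pi) * (\<Sum>j\<in>{j\<in>{1..n}. z j \<in> N}. of_real (q j) * f (z j))" .
qed

end

section \<open>The zero set of the effective potential and the limit of the cutoff\<close>

lemma null_set_of_disjoint_translates:
  fixes A :: "complex set"
  assumes A: "A \<in> sets borel" "bounded A" and v: "v \<noteq> 0"
    and disj: "\<And>y t. y \<in> A \<Longrightarrow> t > 0 \<Longrightarrow> y + t *\<^sub>R v \<notin> A"
  shows "A \<in> null_sets lborel"
proof -
  obtain R where "\<forall>x\<in>A. norm x \<le> R" using A(2) bounded_iff by blast
  then have R: "\<And>x. x \<in> A \<Longrightarrow> norm x \<le> R" by auto
  define s where "s k = inverse (real (Suc k))" for k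
  \<comment> \<open>The translates of A by multiples \<open>s k\<close> of v are pairwise disjoint,
    have the measure of A, and lie in a common disc. Infinitely many of them fit only if that
    measure is 0.\<close>
  define B where "B k = (\<lambda>x. s k *\<^sub>R v + x) -` A" for k
  have s: "s k > 0" "s k \<le> 1" for k by (auto simp: s_def inverse_le_1_iff)
  have B_sets: "B k \<in> sets lborel" for k
  proof -
    have "(\<lambda>x. s k *\<^sub>R v + x) \<in> borel \<rightarrow>\<^sub>M borel" by measurable
    from measurable_sets[OF this A(1)] show ?thesis by (simp add: B_def)
  qed
  have em: "emeasure lborel (B k) = emeasure lborel A" for k
  proof -
    have "emeasure lborel A = emeasure (distr lborel borel ((+) (s k *\<^sub>R v))) A"
      by (simp add: lborel_distr_plus)
    also have "\<dots> = emeasure lborel (B k)"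
      using A(1) by (subst emeasure_distr) (auto simp: B_def)
    finally show ?thesis ..
  qed
  have disj_B: "disjoint_family B"
  proof -
    have "B k \<inter> B m = {}" if "s m < s k" for k m
    proof (rule ccontr)
      assume "B k \<inter> B m \<noteq> {}"
      then obtain x where x: "s k *\<^sub>R v + x \<in> A" "s m *\<^sub>R v + x \<in> A" by (auto simp: B_def)
      have eq: "(s m *\<^sub>R v + x) + (s k - s m) *\<^sub>R v = s k *\<^sub>R v + x" by (simp add: algebra_simps)
      have "(s m *\<^sub>R v + x) + (s k - s m) *\<^sub>R v \<notin> A" by (rule disj[OF x(2)]) (use that in simp)
      then show False using x(1) unfolding eq by contradiction
    qed
    moreover have "s m < s k \<or> s k < s m" if "k \<noteq> m" for k m
      using that by (auto simp: s_def field_simps)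
    ultimately show ?thesis
      unfolding disjoint_family_on_def by (metis inf_commute)
  qed
  have sub: "(\<Union>k. B k) \<subseteq> cball 0 (R + norm v)"
  proof
    fix x assume "x \<in> (\<Union>k. B k)"
    then obtain k where "s k *\<^sub>R v + x \<in> A" by (auto simp: B_def)
    then have "norm (s k *\<^sub>R v + x) \<le> R" by (rule R)
    moreover have "norm (s k *\<^sub>R v) \<le> norm v"
      using s[of k] by (simp add: mult_left_le_one_le)
    moreover have "norm x \<le> norm (s k *\<^sub>R v + x) + norm (s k *\<^sub>R v)"
      using norm_triangle_ineq4[of "s k *\<^sub>R v + x" "s k *\<^sub>R v"] by simp
    ultimately show "x \<in> cball 0 (R + norm v)" by simp
  qed
  have "(\<Sum>k. emeasure lborel (B k)) = emeasure lborel (\<Union>k. B k)"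
    by (rule suminf_emeasure) (use B_sets disj_B in auto)
  also have "\<dots> \<le> emeasure lborel (cball (0::complex) (max 0 (R + norm v)))"
    by (rule emeasure_mono) (use sub in auto)
  also have "\<dots> < \<infinity>" by (simp add: emeasure_cball)
  finally have T: "(\<Sum>k::nat. emeasure lborel A) < \<infinity>" by (simp add: em)
  then obtain T where T': "(\<Sum>k::nat. emeasure lborel A) = ennreal T" "T \<ge> 0"
    by (cases "\<Sum>k::nat. emeasure lborel A") auto
  have part: "of_nat m * emeasure lborel A \<le> ennreal T" for m :: nat
  proof -
    have "(\<Sum>k<m. emeasure lborel A) \<le> (\<Sum>k::nat. emeasure lborel A)"
      by (rule sum_le_suminf) auto
    then show ?thesis by (simp add: T')
  qed
  have "emeasure lborel A \<le> ennreal T" using part[of 1] by simp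
  then have "emeasure lborel A < \<infinity>" using order_le_less_trans ennreal_less_top by (metis infinity_ennreal_def)
  then obtain c where c: "emeasure lborel A = ennreal c" "c \<ge> 0"
    by (cases "emeasure lborel A") auto
  have "c = 0"
  proof (rule ccontr)
    assume "c \<noteq> 0"
    then obtain m :: nat where "T < real m * c" using reals_Archimedean3[of c] c by auto
    moreover have "real m * c \<le> T"
      using part[of m] c T'(2) by (simp add: ennreal_of_nat_eq_real_of_nat ennreal_mult'[symmetric])
    ultimately show False by simp
  qed
  then have "emeasure lborel A = 0" using c by simp
  then show ?thesis using A(1) by (auto simp: null_sets_def)
qed

context charged
begin

text \<open>Where \<open>\<Delta>Q > 0\<close>, the gradient of \<open>w\<close> is strictly monotone in some coordinate direction,
  so every line in that direction meets the zero set of \<open>w\<close> at most once.\<close>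

lemma negligible_zero_set:
  assumes N: "open N" "N \<inter> S = {}"
  shows "negligible {x \<in> N - Z. w x = 0 \<and> laplacian Q x > 0}"
  unfolding locally_negligible_alt[of "{x \<in> N - Z. w x = 0 \<and> laplacian Q x > 0}"]
proof
  let ?E = "{x \<in> N - Z. w x = 0 \<and> laplacian Q x > 0}"
  fix x assume x: "x \<in> ?E"
  have open_NZ: "open (N - Z)" using N(1) open_compl_Z by (simp add: Diff_eq open_Int)
  have NZ: "(N - Z) \<inter> Z = {}" "(N - Z) \<inter> S = {}" using N by auto
  note C1 = C1_on_X[OF open_NZ NZ]
  \<comment> \<open>As the differential of w is Re (X h), \<open>D v\<close> is its second
    derivative in direction v. For v = 1 and v = \<i> the two add up to the Laplacian of w, so one
    of them is positive at x.\<close>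
  define D where "D v y = Re (frechet_derivative X (at y) v * v)" for v y
  have "Re (dbar2 X x) = D 1 x + D \<i> x"
    by (simp add: dbar2_def D_def)
  also have "Re (dbar2 X x) = (1 + qs) * laplacian Q x"
    using dbar2_X[OF open_NZ NZ, of x] x by simp
  finally have "D 1 x + D \<i> x > 0" using x qs_nonneg by (metis (mono_tags, lifting) add_pos_nonneg mem_Collect_eq mult_pos_pos zero_less_one)
  then obtain v where v: "v \<noteq> 0" "D v x > 0"
    by (metis add_nonpos_nonpos complex_i_not_zero not_le one_neq_zero)
  have "continuous_on (N - Z) (D v)"
    unfolding D_def by (intro continuous_intros C1_on_continuous_deriv C1)
  then have "open ((N - Z) \<inter> D v -` {0<..})"
    using open_NZ by (simp add: continuous_on_open_vimage Int_commute)
  moreover have "x \<in> (N - Z) \<inter> D v -` {0<..}" using x v by auto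
  ultimately obtain e where e: "e > 0" "ball x e \<subseteq> (N - Z) \<inter> D v -` {0<..}"
    by (meson openE)
  define A where "A = {y \<in> ball x e. w y = 0}"
  have "A \<in> null_sets lborel"
  proof (rule null_set_of_disjoint_translates[OF _ _ v(1)])
    have "continuous_on (ball x e) w"
      using e by (intro C1_on_cont C1_on_subset[OF C1_on_w[OF open_NZ NZ]]) auto
    then have "A = ball x e \<inter> w -` {0}" "closedin (top_of_set (ball x e)) (ball x e \<inter> w -` {0})"
      by (auto simp: A_def continuous_closedin_preimage)
    then show "A \<in> sets borel"
      by (metis borel_closed borel_open closedin_closed open_ball sets.Int)
    show "bounded A" unfolding A_def by (rule bounded_subset[OF bounded_ball]) auto
    fix y t assume y: "y \<in> A" and t: "(t :: real) > 0"
    show "y + t *\<^sub>R v \<notin> A"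
    proof
      assume y': "y + t *\<^sub>R v \<in> A"
      define u where "u s = Re (X (y + s *\<^sub>R v) * v)" for s
      have inb: "y + s *\<^sub>R v \<in> ball x e" if "0 \<le> s" "s \<le> t" for s
      proof -
        have "y + s *\<^sub>R v = (1 - s / t) *\<^sub>R y + (s / t) *\<^sub>R (y + t *\<^sub>R v)"
          using t by (simp add: algebra_simps)
        moreover have "\<dots> \<in> ball x e"
          by (rule convexD[OF convex_ball]) (use y y' t that in \<open>auto simp: A_def\<close>)
        ultimately show ?thesis by simp
      qed
      have deriv: "(u has_real_derivative D v (y + s *\<^sub>R v)) (at s)" if "0 \<le> s" "s \<le> t" for s
      proof -
        have "(X has_derivative frechet_derivative X (at (y + s *\<^sub>R v))) (at (y + s *\<^sub>R v))"
          using inb[OF that] e(2) by (intro C1_onD[OF C1]) auto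
        moreover from this have "linear (frechet_derivative X (at (y + s *\<^sub>R v)))"
          by (rule has_derivative_linear)
        moreover have "((\<lambda>s. y + s *\<^sub>R v) has_derivative (\<lambda>h. h *\<^sub>R v)) (at s)"
          by (auto intro!: derivative_eq_intros)
        ultimately have "((\<lambda>s. X (y + s *\<^sub>R v)) has_derivative (\<lambda>h. h *\<^sub>R frechet_derivative X (at (y + s *\<^sub>R v)) v)) (at s)"
          using has_derivative_compose[of "\<lambda>s. y + s *\<^sub>R v" "\<lambda>h. h *\<^sub>R v" s UNIV X "frechet_derivative X (at (y + s *\<^sub>R v))"]
          by (simp add: linear_scale)
        from bounded_linear.has_derivative[OF bounded_linear_compose[OF bounded_linear_Re bounded_linear_mult_left[of v]] this]
        show ?thesis
          unfolding u_def has_field_derivative_def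
          by (rule has_derivative_eq_rhs) (auto simp: D_def fun_eq_iff algebra_simps)
      qed
      obtain s where s: "0 < s" "s < t" "u t - u 0 = (t - 0) * D v (y + s *\<^sub>R v)"
        using MVT2[OF t, of u "\<lambda>s. D v (y + s *\<^sub>R v)"] deriv by auto
      have "D v (y + s *\<^sub>R v) > 0" using inb[of s] s e(2) by auto
      then have "u t - u 0 > 0" using s t by simp
      moreover have "y \<notin> Z" "y + t *\<^sub>R v \<notin> Z" using y y' e(2) by (auto simp: A_def)
      then have "X y = 0" "X (y + t *\<^sub>R v) = 0"
        using X_eq_0_of_w_eq_0 y y' by (auto simp: A_def)
      then have "u t = 0" "u 0 = 0" by (auto simp: u_def)
      ultimately show False by simp
    qed
  qed
  then have "negligible A"
    by (simp add: negligible_iff_null_sets null_sets_completionI)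
  then have "negligible (?E \<inter> ball x e)"
    by (rule negligible_subset) (auto simp: A_def)
  then show "\<exists>U. openin (top_of_set ?E) U \<and> x \<in> U \<and> negligible U"
    using x e(1) by (intro exI[of _ "?E \<inter> ball x e"]) auto
qed

text \<open>Where \<Delta>Q = 0 both sides vanish; where w > 0 the step equals 1 as soon as its
  width is small. The remaining points form the null set of
  \<open>negligible_zero_set\<close>.\<close>

lemma AE_step_tendsto:
  assumes N: "open N" "N \<inter> S = {}" and lap: "\<And>x. x \<in> N \<Longrightarrow> laplacian Q x \<ge> 0"
  shows "AE y in lborel. (\<lambda>k. indicator (N - Z) y *\<^sub>R (f y * of_real (step (inverse (real (Suc k))) (w y) * laplacian Q y)))
    \<longlonglongrightarrow> indicator (N - Z) y *\<^sub>R (f y * of_real (laplacian Q y) :: complex)"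
proof -
  let ?E = "{x \<in> N - Z. w x = 0 \<and> laplacian Q x > 0}"
  have "?E \<in> null_sets lebesgue"
    using negligible_zero_set[OF N] by (simp add: negligible_iff_null_sets)
  then have "AE y in lebesgue. y \<notin> ?E" by (rule AE_not_in)
  then have "AE y in lborel. y \<notin> ?E" by (simp add: AE_completion_iff)
  then show ?thesis
  proof eventually_elim
    case (elim y)
    show ?case
    proof (cases "y \<in> N - Z \<and> laplacian Q y \<noteq> 0")
      case True
      then have "w y \<noteq> 0" "w y \<ge> 0" using elim lap[of y] w_nonneg[of y] by force+
      then have "w y > 0" by simp
      have "(\<lambda>k. 2 * inverse (real (Suc k))) \<longlonglongrightarrow> 2 * 0"
        by (intro tendsto_intros LIMSEQ_inverse_real_of_nat)
      then have "\<forall>\<^sub>F k in sequentially. 2 * inverse (real (Suc k)) < w y"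
        using \<open>w y > 0\<close> by (intro order_tendstoD) auto
      then have "\<forall>\<^sub>F k in sequentially. indicator (N - Z) y *\<^sub>R (f y * of_real (step (inverse (real (Suc k))) (w y) * laplacian Q y))
         = indicator (N - Z) y *\<^sub>R (f y * of_real (laplacian Q y))"
      proof eventually_elim
        case (elim k)
        then have "step (inverse (real (Suc k))) (w y) = 1" by (intro step_1) auto
        then show ?case by simp
      qed
      then show ?thesis by (rule tendsto_eventually)
    qed auto
  qed
qed

text \<open>The mass balance is known only for \<Omega> as a whole, not for the part U. Therefore
  the error is first controlled on \<Omega> with the constant function 1, and the bound on f
  transfers it to U.\<close>

lemma component_quadrature:
  assumes \<Omega>: "open \<Omega>" "bounded \<Omega>" "\<Omega> \<inter> S = {}" "frontier \<Omega> \<subseteq> S" and Z\<Omega>: "Z \<subseteq> \<Omega>"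
    and lap: "\<And>x. x \<in> \<Omega> \<Longrightarrow> laplacian Q x \<ge> 0"
    and mass: "(1 + qs) * (LINT x|lborel. indicator \<Omega> x * laplacian Q x) = 2 * pi * qs"
    and U: "open U" "U \<subseteq> \<Omega>" "frontier U \<subseteq> S"
    and f: "f holomorphic_on U" "\<And>x. x \<in> U \<Longrightarrow> norm (f x) \<le> B"
  shows "set_integrable lborel U (\<lambda>x. f x * of_real (laplacian Q x))"
    and "of_real (1 + qs) * (LINT x:U|lborel. f x * of_real (laplacian Q x)) =
      of_real (2 * pi) * (\<Sum>j\<in>{j\<in>{1..n}. z j \<in> U}. of_real (q j) * f (z j))"
proof -
  have U': "bounded U" "U \<inter> S = {}" using U(2) \<Omega> bounded_subset by blast+
  define e where "e k = inverse (real (Suc k))" for k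
  have e: "e k > 0" for k by (simp add: e_def)
  define I1 where "I1 N f k y = indicator (N - Z) y *\<^sub>R (f y * of_real (step' (e k) (w y) * (norm (X y))\<^sup>2) :: complex)" for N f k y
  define I2 where "I2 N f k y = indicator (N - Z) y *\<^sub>R (f y * of_real (step (e k) (w y) * laplacian Q y) :: complex)" for N f k y
  have ae_Z: "AE y in lborel. y \<notin> Z"
    using finite_imp_null_set_lborel[OF finite_Z] by (rule AE_not_in)
  obtain L where L: "\<And>x. x \<in> \<Omega> \<Longrightarrow> \<bar>laplacian Q x\<bar> \<le> L"
  proof -
    have "compact (closure \<Omega>)" using \<Omega>(2) by (simp add: compact_closure)
    then have "compact (laplacian Q ` closure \<Omega>)"
      by (rule compact_continuous_image[rotated]) (rule continuous_on_subset[OF continuous_laplacian[OF smooth_Q]], simp)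
    then obtain L where "\<forall>y \<in> laplacian Q ` closure \<Omega>. norm y \<le> L"
      using compact_imp_bounded bounded_iff by blast
    then show ?thesis using that closure_subset by (metis imageI real_norm_def subsetD)
  qed
  \<comment> \<open>Stated for an arbitrary open part N and holomorphic h because it is needed both
    for \<Omega> with the constant 1 and for U with f.\<close>
  have limit: "set_integrable lborel N (\<lambda>x. h x * of_real (laplacian Q x))"
    "(\<lambda>k. integral\<^sup>L lborel (I2 N h k)) \<longlonglongrightarrow> (LINT x:N|lborel. h x * of_real (laplacian Q x))"
    if N: "open N" "N \<subseteq> \<Omega>" and h: "h holomorphic_on N" "\<And>x. x \<in> N \<Longrightarrow> norm (h x) \<le> b" for N h b
  proof -
    have N': "bounded N" "N \<inter> S = {}" using N(2) \<Omega> bounded_subset by blast+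
    have cont: "continuous_on N (\<lambda>x. h x * of_real (laplacian Q x))"
      by (intro continuous_intros holomorphic_on_imp_continuous_on h continuous_on_subset[OF continuous_laplacian[OF smooth_Q]]) simp
    have int: "integrable lborel (\<lambda>x. indicator N x *\<^sub>R (h x * of_real (laplacian Q x)))"
    proof (rule integrable_bounded_indicator[OF borel_open[OF N(1)] N'(1) cont])
      fix x assume x: "x \<in> N"
      then show "norm (h x * of_real (laplacian Q x)) \<le> max b 0 * max L 0"
        unfolding norm_mult using h(2)[OF x] L[of x] N(2) by (intro mult_mono) auto
    qed
    then show "set_integrable lborel N (\<lambda>x. h x * of_real (laplacian Q x))"
      by (simp add: set_integrable_def)
    have NZ: "open (N - Z)" "(N - Z) \<inter> Z = {}" "(N - Z) \<inter> S = {}"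
      using N N' open_compl_Z by (auto simp: Diff_eq open_Int)
    have meas: "I2 N h k \<in> borel_measurable lborel" for k
    proof -
      have "continuous_on (N - Z) (\<lambda>y. h y * of_real (step (e k) (w y) * laplacian Q y))"
        unfolding step_def using e[of k]
        by (intro continuous_intros C1_on_cont[OF C1_on_w[OF NZ]] continuous_on_subset[OF continuous_laplacian[OF smooth_Q]]
            continuous_on_subset[OF holomorphic_on_imp_continuous_on[OF h(1)]]) auto
      then show ?thesis
        unfolding I2_def using borel_measurable_continuous_on_indicator[OF borel_open[OF NZ(1)]] by simp
    qed
    have "(\<lambda>k. integral\<^sup>L lborel (I2 N h k)) \<longlonglongrightarrow> (LINT y|lborel. indicator (N - Z) y *\<^sub>R (h y * of_real (laplacian Q y)))"
    proof (rule integral_dominated_convergence)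
      show "integrable lborel (\<lambda>x. norm (indicator N x *\<^sub>R (h x * of_real (laplacian Q x))))"
        using int by (rule integrable_norm)
      show "AE y in lborel. (\<lambda>k. I2 N h k y) \<longlonglongrightarrow> indicator (N - Z) y *\<^sub>R (h y * of_real (laplacian Q y))"
        unfolding I2_def e_def by (rule AE_step_tendsto[OF N(1) N'(2)]) (use lap N(2) in auto)
      show "AE y in lborel. norm (I2 N h k y) \<le> norm (indicator N y *\<^sub>R (h y * of_real (laplacian Q y)))" for k
      proof (rule AE_I2)
        fix y
        have "norm (h y) * (\<bar>step (e k) (w y)\<bar> * \<bar>laplacian Q y\<bar>) \<le> norm (h y) * (1 * \<bar>laplacian Q y\<bar>)"
          using step_bounds[of "e k" "w y"] by (intro mult_left_mono mult_right_mono) auto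
        then show "norm (I2 N h k y) \<le> norm (indicator N y *\<^sub>R (h y * of_real (laplacian Q y)))"
          by (auto simp: I2_def norm_mult abs_mult split: split_indicator)
      qed
      show "(\<lambda>y. indicator (N - Z) y *\<^sub>R (h y * of_real (laplacian Q y))) \<in> borel_measurable lborel"
        using borel_measurable_continuous_on_indicator[OF borel_open[OF NZ(1)] continuous_on_subset[OF cont]] by auto
    qed (rule meas)
    also have "(LINT y|lborel. indicator (N - Z) y *\<^sub>R (h y * of_real (laplacian Q y))) = (LINT x:N|lborel. h x * of_real (laplacian Q x))"
      unfolding set_lebesgue_integral_def
    proof (rule integral_cong_AE)
      show "AE y in lborel. indicator (N - Z) y *\<^sub>R (h y * of_real (laplacian Q y)) = indicator N y *\<^sub>R (h y * of_real (laplacian Q y))"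
        using ae_Z by eventually_elim (auto split: split_indicator)
      show "(\<lambda>y. indicator (N - Z) y *\<^sub>R (h y * of_real (laplacian Q y))) \<in> borel_measurable lborel"
        using borel_measurable_continuous_on_indicator[OF borel_open[OF NZ(1)] continuous_on_subset[OF cont]] by auto
    qed (use int in auto)
    finally show "(\<lambda>k. integral\<^sup>L lborel (I2 N h k)) \<longlonglongrightarrow> (LINT x:N|lborel. h x * of_real (laplacian Q x))" .
  qed
  have one: "(\<lambda>_. 1) holomorphic_on \<Omega>" "\<And>x. x \<in> \<Omega> \<Longrightarrow> norm (1 :: complex) \<le> 1" by auto
  have g\<Omega>1: "integrable lborel (I1 \<Omega> (\<lambda>_. 1) k)" for k
    unfolding I1_def[abs_def] by (rule green(1)[OF \<Omega> one e])
  have g\<Omega>2: "integral\<^sup>L lborel (I1 \<Omega> (\<lambda>_. 1) k) + of_real (1 + qs) * integral\<^sup>L lborel (I2 \<Omega> (\<lambda>_. 1) k) =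
       of_real (2 * pi) * (\<Sum>j\<in>{j\<in>{1..n}. z j \<in> \<Omega>}. of_real (q j) * 1)" for k
    unfolding I1_def[abs_def] I2_def[abs_def] by (rule green(3)[OF \<Omega> one e])
  have gU1: "integrable lborel (I1 U f k)" for k
    unfolding I1_def[abs_def] by (rule green(1)[OF U(1) U' U(3) f e])
  have gU2: "integral\<^sup>L lborel (I1 U f k) + of_real (1 + qs) * integral\<^sup>L lborel (I2 U f k) =
       of_real (2 * pi) * (\<Sum>j\<in>{j\<in>{1..n}. z j \<in> U}. of_real (q j) * f (z j))" for k
    unfolding I1_def[abs_def] I2_def[abs_def] by (rule green(3)[OF U(1) U' U(3) f e])
  text \<open>Total mass: the error term tends to \<open>0\<close> on all of \<open>\<Omega>\<close>, hence, being nonnegative, on \<open>U\<close>.\<close>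
  have I1_lim: "(\<lambda>k. integral\<^sup>L lborel (I1 \<Omega> (\<lambda>_. 1) k)) \<longlonglongrightarrow> 0"
  proof -
    have J: "{j \<in> {1..n}. z j \<in> \<Omega>} = {1..n}" using Z\<Omega> by (auto simp: Z_eq)
    have eq: "integral\<^sup>L lborel (I1 \<Omega> (\<lambda>_. 1) k) = of_real (2 * pi * qs) - of_real (1 + qs) * integral\<^sup>L lborel (I2 \<Omega> (\<lambda>_. 1) k)" for k
      using g\<Omega>2[of k] unfolding J by (simp add: qs_def algebra_simps)
    have m: "(LINT x:\<Omega>|lborel. 1 * complex_of_real (laplacian Q x)) = of_real (LINT x|lborel. indicator \<Omega> x * laplacian Q x)"
      unfolding set_lebesgue_integral_def integral_complex_of_real[symmetric]
      by (intro Bochner_Integration.integral_cong) (auto split: split_indicator)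
    have "(\<lambda>k. of_real (2 * pi * qs) - of_real (1 + qs) * integral\<^sup>L lborel (I2 \<Omega> (\<lambda>_. 1) k)) \<longlonglongrightarrow>
       of_real (2 * pi * qs) - of_real (1 + qs) * (LINT x:\<Omega>|lborel. 1 * complex_of_real (laplacian Q x))"
      by (intro tendsto_intros limit(2)[OF \<Omega>(1) order_refl one])
    also have "of_real (1 + qs) * (LINT x:\<Omega>|lborel. 1 * complex_of_real (laplacian Q x)) = of_real (2 * pi * qs)"
      unfolding m of_real_mult[symmetric] mass ..
    finally show ?thesis unfolding eq by simp
  qed
  have I1_le: "norm (integral\<^sup>L lborel (I1 U f k)) \<le> max B 0 * norm (integral\<^sup>L lborel (I1 \<Omega> (\<lambda>_. 1) k))" for k
  proof -
    have nn: "I1 \<Omega> (\<lambda>_. 1) k y = of_real (indicator (\<Omega> - Z) y * (step' (e k) (w y) * (norm (X y))\<^sup>2))" for y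
      by (simp add: I1_def split: split_indicator)
    have nrm: "norm (I1 \<Omega> (\<lambda>_. 1) k y) = indicator (\<Omega> - Z) y * (step' (e k) (w y) * (norm (X y))\<^sup>2)" for y
      unfolding nn norm_of_real using step'_nonneg[OF e] by simp
    have "norm (integral\<^sup>L lborel (I1 U f k)) \<le> (LINT y|lborel. norm (I1 U f k y))" by (rule integral_norm_bound)
    also have "\<dots> \<le> (LINT y|lborel. max B 0 * norm (I1 \<Omega> (\<lambda>_. 1) k y))"
    proof (rule integral_mono)
      show "integrable lborel (\<lambda>y. norm (I1 U f k y))" using gU1 by (rule integrable_norm)
      show "integrable lborel (\<lambda>y. max B 0 * norm (I1 \<Omega> (\<lambda>_. 1) k y))"
        using g\<Omega>1 by (intro integrable_mult_right integrable_norm)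
      fix y
      show "norm (I1 U f k y) \<le> max B 0 * norm (I1 \<Omega> (\<lambda>_. 1) k y)"
      proof (cases "y \<in> U - Z")
        case True
        have "norm (f y) * \<bar>step' (e k) (w y) * (norm (X y))\<^sup>2\<bar> \<le> max B 0 * \<bar>step' (e k) (w y) * (norm (X y))\<^sup>2\<bar>"
          using f(2)[of y] True by (intro mult_right_mono) auto
        moreover have "y \<in> \<Omega> - Z" using True U(2) by auto
        ultimately show ?thesis using True by (simp add: I1_def norm_mult del: of_real_mult of_real_power)
      qed (simp add: I1_def)
    qed
    also have "\<dots> = max B 0 * (LINT y|lborel. indicator (\<Omega> - Z) y * (step' (e k) (w y) * (norm (X y))\<^sup>2))"
      unfolding integral_mult_right_zero
      unfolding nrm ..
    also have "(LINT y|lborel. indicator (\<Omega> - Z) y * (step' (e k) (w y) * (norm (X y))\<^sup>2)) \<le> norm (integral\<^sup>L lborel (I1 \<Omega> (\<lambda>_. 1) k))"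
      unfolding nn integral_complex_of_real norm_of_real by (rule abs_ge_self)
    finally show ?thesis by (simp add: mult_left_mono)
  qed
  have U_lim: "(\<lambda>k. integral\<^sup>L lborel (I1 U f k)) \<longlonglongrightarrow> 0"
  proof (rule Lim_null_comparison)
    show "\<forall>\<^sub>F k in sequentially. norm (integral\<^sup>L lborel (I1 U f k)) \<le> max B 0 * norm (integral\<^sup>L lborel (I1 \<Omega> (\<lambda>_. 1) k))"
      using I1_le by (intro always_eventually) simp
    show "(\<lambda>k. max B 0 * norm (integral\<^sup>L lborel (I1 \<Omega> (\<lambda>_. 1) k))) \<longlonglongrightarrow> 0"
      using tendsto_mult_left[OF tendsto_norm[OF I1_lim], of "max B 0"] by simp
  qed
  show "set_integrable lborel U (\<lambda>x. f x * of_real (laplacian Q x))"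
    by (rule limit(1)[OF U(1,2) f])
  have "(\<lambda>k. integral\<^sup>L lborel (I1 U f k) + of_real (1 + qs) * integral\<^sup>L lborel (I2 U f k)) \<longlonglongrightarrow>
     0 + of_real (1 + qs) * (LINT x:U|lborel. f x * of_real (laplacian Q x))"
    by (intro tendsto_intros U_lim limit(2)[OF U(1,2) f])
  then have "(\<lambda>k. of_real (2 * pi) * (\<Sum>j\<in>{j\<in>{1..n}. z j \<in> U}. of_real (q j) * f (z j))) \<longlonglongrightarrow>
     0 + of_real (1 + qs) * (LINT x:U|lborel. f x * of_real (laplacian Q x))"
    unfolding gU2 .
  from LIMSEQ_unique[OF this tendsto_const]
  show "of_real (1 + qs) * (LINT x:U|lborel. f x * of_real (laplacian Q x)) =
      of_real (2 * pi) * (\<Sum>j\<in>{j\<in>{1..n}. z j \<in> U}. of_real (q j) * f (z j))"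
    by simp
qed

end

subsection \<open>Quadrature for the area measure\<close>

lemma A_infty_bounded:
  assumes "f \<in> A_infty U" "bounded U"
  shows "\<exists>B. \<forall>x\<in>U. norm (f x) \<le> B"
proof -
  obtain F :: "nat \<Rightarrow> complex \<Rightarrow> complex" where
    "\<forall>z\<in>closure U. F 0 z = f z" "\<forall>k. continuous_on (closure U) (F k) \<and> (\<forall>z\<in>U. F k z = (deriv ^^ k) f z)"
    using assms(1) unfolding A_infty_def by auto
  then have F: "\<And>z. z \<in> closure U \<Longrightarrow> F 0 z = f z" "continuous_on (closure U) (F 0)" by blast+
  have "compact (F 0 ` closure U)"
    using F(2) assms(2) by (intro compact_continuous_image) (simp_all add: compact_closure)
  then obtain B where "\<forall>y \<in> F 0 ` closure U. norm y \<le> B"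
    using compact_imp_bounded bounded_iff by blast
  then have "norm (f x) \<le> B" if "x \<in> U" for x
    using F(1)[of x] that closure_subset by (metis imageI subsetD)
  then show ?thesis by blast
qed

text \<open>Coinciding points \<open>z j\<close> form a single node, whose coefficient is the sum of
  their intensities.\<close>

lemma sum_group_nodes:
  fixes h :: "complex \<Rightarrow> complex" and z :: "nat \<Rightarrow> complex"
  shows "(\<Sum>w\<in>z ` {1..n} \<inter> U. of_real (\<Sum>j\<in>{j\<in>{1..n}. z j = w}. q j) * h w) =
    (\<Sum>j\<in>{j\<in>{1..n}. z j \<in> U}. of_real (q j) * h (z j))"
proof -
  have "(\<Sum>w\<in>z ` {1..n} \<inter> U. of_real (\<Sum>j\<in>{j\<in>{1..n}. z j = w}. q j) * h w) =
     (\<Sum>w\<in>z ` {1..n} \<inter> U. \<Sum>j\<in>{j\<in>{j\<in>{1..n}. z j \<in> U}. z j = w}. of_real (q j) * h (z j))"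
  proof (rule sum.cong[OF refl])
    fix w assume w: "w \<in> z ` {1..n} \<inter> U"
    have "{j\<in>{j\<in>{1..n}. z j \<in> U}. z j = w} = {j\<in>{1..n}. z j = w}" using w by auto
    then show "of_real (\<Sum>j\<in>{j\<in>{1..n}. z j = w}. q j) * h w =
      (\<Sum>j\<in>{j\<in>{j\<in>{1..n}. z j \<in> U}. z j = w}. of_real (q j) * h (z j))"
      by (simp add: sum_distrib_right)
  qed
  also have "\<dots> = (\<Sum>j\<in>{j\<in>{1..n}. z j \<in> U}. of_real (q j) * h (z j))"
    by (rule sum.group) auto
  finally show ?thesis .
qed

lemma node_weight_pos:
  fixes q :: "nat \<Rightarrow> real"
  assumes "\<And>j. j \<in> {1..n} \<Longrightarrow> q j > 0" "w \<in> z ` {1..n}"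
  shows "(\<Sum>j\<in>{j\<in>{1..n}. z j = w}. q j) > 0"
  using assms by (intro sum_pos) auto

lemma charged_equilibrium_measure:
  fixes Q :: "complex \<Rightarrow> real" and n :: nat and z :: "nat \<Rightarrow> complex" and q :: "nat \<Rightarrow> real"
  assumes "smooth Q" and "admissible (\<lambda>x. ereal (Q x))"
    and q: "\<And>j. j \<in> {1..n} \<Longrightarrow> q j > 0"
    and V: "V = (\<lambda>x. ereal ((1 + (\<Sum>j=1..n. q j)) * Q x) + (\<Sum>j=1..n. ereal (q j) * log_kernel x (z j)))"
    and "equilibrium_measure V \<mu>" and "S = measure_support \<mu>"
    and "\<mu> = density lborel (\<lambda>x. ennreal ((1 + (\<Sum>j=1..n. q j)) / (2 * pi) * laplacian Q x) * indicator S x)"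
  shows "\<exists>K. charged V (charged_field Q n z q)
     (\<lambda>x. max 0 ((1 + (\<Sum>j=1..n. q j)) / (2 * pi) * laplacian Q x) * indicator S x)
     (z ` {1..n}) K (\<lambda>x. (1 + (\<Sum>j=1..n. q j)) / (2 * pi) * laplacian Q x) S Q n z q"
  using equilibrium_charged[OF assms] assms(1) q
  unfolding charged_def charged_axioms_def by auto

lemma area_quadrature_domain:
  fixes Q :: "complex \<Rightarrow> real" and n :: nat and z :: "nat \<Rightarrow> complex" and q :: "nat \<Rightarrow> real"
  assumes smooth: "smooth Q" and adm: "admissible (\<lambda>x. ereal (Q x))"
    and q: "\<And>j. j \<in> {1..n} \<Longrightarrow> q j > 0"
    and q_sum: "q_sum = (\<Sum>j=1..n. q j)"
    and V: "V = (\<lambda>x. ereal ((1 + q_sum) * Q x) + (\<Sum>j=1..n. ereal (q j) * log_kernel x (z j)))"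
    and eQ: "equilibrium_measure (\<lambda>x. ereal (Q x)) \<mu>Q" and SQ: "SQ = measure_support \<mu>Q"
    and eV: "equilibrium_measure V \<mu>V" and SV: "SV = measure_support \<mu>V"
    and \<mu>Q: "\<mu>Q = density lborel (\<lambda>x. ennreal (1 / (2*pi) * laplacian Q x) * indicator SQ x)"
    and \<mu>V: "\<mu>V = density lborel (\<lambda>x. ennreal ((1 + q_sum) / (2*pi) * laplacian Q x) * indicator SV x)"
    and z: "\<And>j. j \<in> {1..n} \<Longrightarrow> z j \<in> SQ"
    and \<Omega>: "open \<Omega>" "\<Omega> \<subseteq> SQ" "SV = SQ - \<Omega>" and U: "U \<in> components \<Omega>"
  shows "quadrature_domain U (has_area_integral U (\<lambda>x. of_real (laplacian Q x))) (z ` {1..n} \<inter> U)"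
proof -
  obtain KV where KV: "charged V (charged_field Q n z q)
     (\<lambda>x. max 0 ((1 + q_sum) / (2 * pi) * laplacian Q x) * indicator SV x)
     (z ` {1..n}) KV (\<lambda>x. (1 + q_sum) / (2 * pi) * laplacian Q x) SV Q n z q"
    using charged_equilibrium_measure[OF smooth adm q V[unfolded q_sum] eV SV \<mu>V[unfolded q_sum]] unfolding q_sum by blast
  obtain KQ where KQ: "charged (\<lambda>x. ereal (Q x)) (charged_field Q 0 z q)
     (\<lambda>x. max 0 (1 / (2 * pi) * laplacian Q x) * indicator SQ x)
     (z ` {1..0}) KQ (\<lambda>x. 1 / (2 * pi) * laplacian Q x) SQ Q 0 z q"
    using charged_equilibrium_measure[OF smooth adm _ _ eQ SQ, of 0 q z] \<mu>Q by auto
  interpret V: charged V "charged_field Q n z q"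
     "\<lambda>x. max 0 ((1 + q_sum) / (2 * pi) * laplacian Q x) * indicator SV x"
     "z ` {1..n}" KV "\<lambda>x. (1 + q_sum) / (2 * pi) * laplacian Q x" SV Q n z q
    by (rule KV)
  interpret Q: charged "\<lambda>x. ereal (Q x)" "charged_field Q 0 z q"
     "\<lambda>x. max 0 (1 / (2 * pi) * laplacian Q x) * indicator SQ x"
     "z ` {1..0}" KQ "\<lambda>x. 1 / (2 * pi) * laplacian Q x" SQ Q 0 z q
    by (rule KQ)
  have qs: "V.qs = q_sum" by (simp add: V.qs_def q_sum)
  have q0: "q_sum \<ge> 0" using V.qs_nonneg unfolding qs .
  \<comment> \<open>The charges lie in \<open>SQ\<close>, and the support of \<open>\<mu>V\<close>
    avoids them, so they lie in the removed part.\<close>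
  have Z\<Omega>: "z ` {1..n} \<subseteq> \<Omega>"
    using z V.S_Z \<Omega>(3) by blast
  have fr: "frontier \<Omega> \<subseteq> SV"
    using \<Omega> closure_minimal[OF \<Omega>(2) Q.closed_S] by (auto simp: frontier_def interior_open)
  have bdd: "bounded \<Omega>" using Q.compact_S \<Omega>(2) compact_imp_bounded bounded_subset by blast
  have lap: "laplacian Q x \<ge> 0" if "x \<in> SQ" for x
    using mult_nonneg_nonneg[OF _ Q.g_nonneg[OF that], of "2 * pi"] by simp
  have mass: "(1 + V.qs) * (LINT x|lborel. indicator \<Omega> x * laplacian Q x) = 2 * pi * V.qs"
  proof -
    \<comment> \<open>On \<open>SQ\<close> the Laplacian is nonnegative, so nothing is truncated.
      Rescaled by 2 \<pi> and 2 \<pi> / (1 + q), both densities become \<Delta>Q on their supports,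
      and the difference is \<Delta>Q on \<Omega>. As both have mass 1, the integral is 2 \<pi> q /
      (1 + q).\<close>
    have "indicator \<Omega> x * laplacian Q x = 2 * pi * (max 0 (1 / (2 * pi) * laplacian Q x) * indicator SQ x)
       - 2 * pi / (1 + q_sum) * (max 0 ((1 + q_sum) / (2 * pi) * laplacian Q x) * indicator SV x)" for x
    proof (cases "x \<in> SQ")
      case True
      have "max 0 (1 / (2 * pi) * laplacian Q x) = 1 / (2 * pi) * laplacian Q x"
        "max 0 ((1 + q_sum) / (2 * pi) * laplacian Q x) = (1 + q_sum) / (2 * pi) * laplacian Q x"
        using lap[OF True] q0 by (auto simp: max_def)
      then show ?thesis using q0 True \<Omega> by (auto split: split_indicator)
    qed (use \<Omega> in \<open>auto split: split_indicator\<close>)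
    then have "(LINT x|lborel. indicator \<Omega> x * laplacian Q x) =
      (LINT x|lborel. 2 * pi * (max 0 (1 / (2 * pi) * laplacian Q x) * indicator SQ x)
       - 2 * pi / (1 + q_sum) * (max 0 ((1 + q_sum) / (2 * pi) * laplacian Q x) * indicator SV x))"
      by (simp only:)
    also have "\<dots> = 2 * pi * 1 - 2 * pi / (1 + q_sum) * 1"
      unfolding Bochner_Integration.integral_diff[OF integrable_mult_right[OF Q.int] integrable_mult_right[OF V.int]]
        integral_mult_right_zero Q.int_1 V.int_1 ..
    finally show ?thesis unfolding qs using q0 by (simp add: field_simps)
  qed
  have oU: "open U" using open_components[OF \<Omega>(1) U] .
  have U\<Omega>: "U \<subseteq> \<Omega>" using U by (rule in_components_subset)
  have frU: "frontier U \<subseteq> SV"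
    using frontier_of_components_subset[OF U] fr by blast
  have bU: "bounded U" using bdd U\<Omega> by (rule bounded_subset)
  define c where "c w = 2 * pi / (1 + q_sum) * (\<Sum>j\<in>{j\<in>{1..n}. z j = w}. q j)" for w
  have main: "has_area_integral U (\<lambda>x. of_real (laplacian Q x)) f (\<Sum>w\<in>z ` {1..n} \<inter> U. of_real (c w) * f w)"
    if f: "f \<in> A_infty U" for f
  proof -
    obtain B where B: "\<And>x. x \<in> U \<Longrightarrow> norm (f x) \<le> B" using A_infty_bounded[OF f bU] by blast
    have hol: "f holomorphic_on U" using f by (simp add: A_infty_def)
    have \<Omega>S: "\<Omega> \<inter> SV = {}" using \<Omega> by auto
    have lap\<Omega>: "laplacian Q x \<ge> 0" if "x \<in> \<Omega>" for x using that \<Omega>(2) lap by auto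
    note cq = V.component_quadrature[OF \<Omega>(1) bdd \<Omega>S fr Z\<Omega> lap\<Omega> mass oU U\<Omega> frU hol B]
    have "(\<Sum>w\<in>z ` {1..n} \<inter> U. of_real (c w) * f w) =
       (\<Sum>w\<in>z ` {1..n} \<inter> U. of_real (2 * pi / (1 + q_sum)) * (of_real (\<Sum>j\<in>{j\<in>{1..n}. z j = w}. q j) * f w))"
      by (rule sum.cong[OF refl]) (simp only: c_def of_real_mult mult.assoc)
    also have "\<dots> = of_real (2 * pi / (1 + q_sum)) * (\<Sum>w\<in>z ` {1..n} \<inter> U. of_real (\<Sum>j\<in>{j\<in>{1..n}. z j = w}. q j) * f w)"
      by (rule sum_distrib_left[symmetric])
    also have "\<dots> = of_real (2 * pi / (1 + q_sum)) * (\<Sum>j\<in>{j\<in>{1..n}. z j \<in> U}. of_real (q j) * f (z j))"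
      unfolding sum_group_nodes ..
    also have "\<dots> = (LINT x:U|lborel. f x * of_real (laplacian Q x))"
    proof -
      have "complex_of_real (1 + q_sum) \<noteq> 0" using q0 by (metis add_nonneg_eq_0_iff of_real_eq_0_iff zero_le_one zero_neq_one)
      then show ?thesis using cq(2) unfolding qs by (simp add: field_simps)
    qed
    finally show ?thesis using cq(1) by (simp add: has_area_integral_def)
  qed
  have c_pos: "c w \<noteq> 0" if "w \<in> z ` {1..n} \<inter> U" for w
    using node_weight_pos[where n = n and w = w and z = z and q = q, OF q] that q0 by (auto simp: c_def)
  show ?thesis
    unfolding quadrature_domain_def
  proof (intro conjI exI[of _ "\<lambda>_. 0 :: nat"] exI[of _ "\<lambda>w (k::nat). complex_of_real (c w)"] ballI)
    show "connected U" "U \<noteq> {}" using U in_components_connected in_components_nonempty by auto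
    show "\<exists>k\<le>0::nat. complex_of_real (c w) \<noteq> 0" if "w \<in> z ` {1..n} \<inter> U" for w
      using c_pos[OF that] by auto
    show "has_area_integral U (\<lambda>x. of_real (laplacian Q x)) f
        (\<Sum>w\<in>z ` {1..n} \<inter> U. \<Sum>k\<le>0. complex_of_real (c w) * (deriv ^^ k) f w)" if "f \<in> A_infty U" for f
      using main[OF that] by simp
  qed (use oU in auto)
qed

subsection \<open>Smooth Jordan curves\<close>

text \<open>Of the smoothness of the boundary only a nonvanishing continuous derivative is retained.
  The parameter runs over the whole line, so the base point of the loop is no exception, and the
  class is stable under inversion.\<close>

locale regular_loop =
  fixes g g' :: "real \<Rightarrow> complex"
  assumes deriv: "\<And>s. (g has_vector_derivative g' s) (at s)"
    and cont': "continuous_on UNIV g'"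
    and ne: "\<And>s. g' s \<noteq> 0"
    and periodic: "\<And>s. g (s + 1) = g s"
    and inj: "inj_on g {0..<1}"
begin

lemma isCont_g: "isCont g s"
  using deriv has_vector_derivative_continuous by blast

lemma cont: "continuous_on A g"
  using isCont_g by (simp add: continuous_at_imp_continuous_on)

lemma periodic': "g' (s + 1) = g' s"
proof -
  have "((\<lambda>s. g (s + 1)) has_vector_derivative g' (s + 1)) (at s)"
  proof -
    have "((\<lambda>s. s + 1) has_vector_derivative 1) (at s)"
      by (auto intro!: derivative_eq_intros)
    from vector_diff_chain_at[OF this deriv] show ?thesis by (simp add: o_def)
  qed
  then show ?thesis
    unfolding periodic using deriv vector_derivative_unique_at by blast
qed

lemma periodic_minus: "g (s - 1) = g s" "g' (s - 1) = g' s"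
  using periodic[of "s - 1"] periodic'[of "s - 1"] by simp_all

definition C where "C = g ` {0..1}"

lemma g_in_C: "-1 \<le> s \<Longrightarrow> s \<le> 2 \<Longrightarrow> g s \<in> C"
proof -
  assume s: "-1 \<le> s" "s \<le> 2"
  consider "s < 0" | "s \<in> {0..1}" | "s > 1" by fastforce
  then show ?thesis
  proof cases
    case 1
    then show ?thesis using s periodic[of s] unfolding C_def by (intro image_eqI[of _ _ "s + 1"]) auto
  next
    case 3
    then show ?thesis using s periodic_minus(1)[of s] unfolding C_def by (intro image_eqI[of _ _ "s - 1"]) auto
  qed (auto simp: C_def)
qed

lemma g_01: "g 1 = g 0"
  using periodic[of 0] by simp

lemma inj_cases:
  assumes "s \<in> {0..1}" "t \<in> {0..1}" "g s = g t"
  shows "s = t \<or> (s = 0 \<and> t = 1) \<or> (s = 1 \<and> t = 0)"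
proof -
  define s' where "s' = (if s = 1 then 0 else s)"
  define t' where "t' = (if t = 1 then 0 else t)"
  have "g s' = g t'" "s' \<in> {0..<1}" "t' \<in> {0..<1}"
    using assms g_01 by (auto simp: s'_def t'_def)
  then have "s' = t'" using inj by (simp add: inj_on_eq_iff)
  then show ?thesis by (auto simp: s'_def t'_def split: if_splits)
qed

lemma simple_path: "simple_path g" "pathfinish g = pathstart g" "path_image g = C"
proof -
  show "simple_path g"
    unfolding simple_path_def loop_free_def path_def using inj_cases cont by blast
qed (auto simp: pathfinish_def pathstart_def g_01 path_image_def C_def)

lemma valid_path: "valid_path g"
proof -
  have "g C1_differentiable_on {0..1}"
    unfolding C1_differentiable_on_def using deriv cont' continuous_on_subset by blast
  then show ?thesis
    unfolding valid_path_def by (rule C1_differentiable_imp_piecewise)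
qed

lemma compact_C: "compact C" and connected_C: "connected C" and nonempty_C: "C \<noteq> {}"
  unfolding C_def by (auto intro!: compact_continuous_image connected_continuous_image cont)

text \<open>The unit tangent as a function on the curve, independent of the path by which the curve
  is traversed. The choice of the parameter is harmless: only 0 and 1 are confused, and
  \<open>g'\<close> agrees there by periodicity.\<close>

definition T where "T p = sgn (g' (SOME s. s \<in> {0..1} \<and> g s = p))"

lemma T_g:
  assumes "s \<in> {0..1}" shows "T (g s) = sgn (g' s)"
proof -
  define t where "t = (SOME t. t \<in> {0..1} \<and> g t = g s)"
  have "t \<in> {0..1} \<and> g t = g s"
    unfolding t_def by (rule someI[of _ s]) (use assms in auto)
  then have "t = s \<or> (t = 0 \<and> s = 1) \<or> (t = 1 \<and> s = 0)"
    using inj_cases assms by blast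
  then have "g' t = g' s" using periodic'[of 0] by auto
  then show ?thesis by (simp add: T_def t_def)
qed

lemma norm_T: "p \<in> C \<Longrightarrow> norm (T p) = 1"
  using T_g ne by (auto simp: C_def norm_sgn)

lemma cnj_T: "p \<in> C \<Longrightarrow> cnj (T p) * T p = 1"
  using norm_T[of p] by (metis complex_norm_square mult.commute of_real_1 one_power2)

text \<open>A continuous map of a compact interval onto the Hausdorff space C is a quotient map, so
  continuity of T can be tested after composition with the parametrization.\<close>

lemma continuous_T: "continuous_on C T"
proof (rule continuous_on_open[THEN iffD2], intro allI impI)
  have quot: "quotient_map (top_of_set {0..1}) (top_of_set C) g"
  proof (rule continuous_imp_quotient_map)
    show "continuous_map (top_of_set {0..1}) (top_of_set C) g"
      using cont by (auto simp: C_def)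
    show "compact_space (top_of_set {0..1::real})"
      by (simp add: compact_space_subtopology)
    show "Hausdorff_space (top_of_set C)"
      by (simp add: Hausdorff_space_subtopology)
  qed (simp add: C_def)
  fix W assume W: "openin (top_of_set (T ` C)) W"
  then obtain W' where W': "open W'" "W = T ` C \<inter> W'" by (auto simp: openin_open)
  have "continuous_on {0..1} (\<lambda>s. sgn (g' s))"
    unfolding sgn_div_norm using ne
    by (intro continuous_intros continuous_on_subset[OF cont']) auto
  moreover have "continuous_on {0..1} (\<lambda>s. T (g s)) \<longleftrightarrow> continuous_on {0..1} (\<lambda>s. sgn (g' s))"
    by (rule continuous_on_cong[OF refl T_g])
  ultimately have "continuous_on {0..1} (\<lambda>s. T (g s))" by blast
  then have "openin (top_of_set {0..1}) ({0..1} \<inter> (\<lambda>s. T (g s)) -` W')"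
    using W'(1) by (rule continuous_openin_preimage_gen)
  moreover have "{0..1} \<inter> (\<lambda>s. T (g s)) -` W' = {0..1} \<inter> g -` (C \<inter> T -` W)"
    using W' by (auto simp: C_def)
  ultimately have op: "openin (top_of_set {0..1}) ({0..1} \<inter> g -` (C \<inter> T -` W))" by simp
  show "openin (top_of_set C) (C \<inter> T -` W)"
  proof -
    have "\<And>V. V \<subseteq> C \<Longrightarrow> openin (top_of_set {0..1}) {x \<in> {0..1}. g x \<in> V} = openin (top_of_set C) V"
      using quot by (simp add: quotient_map_def)
    moreover have "{x \<in> {0..1}. g x \<in> C \<inter> T -` W} = {0..1} \<inter> g -` (C \<inter> T -` W)" by auto
    ultimately show ?thesis using op by (metis Int_lower1)
  qed
qed

text \<open>Short chords are nearly tangent, uniformly along the curve. Compactness gives a limit of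
  a sequence of bad pairs; injectivity up to the period makes both parameters converge to the same
  one, where continuity of \<open>g'\<close> gives a contradiction.\<close>

lemma chord:
  "\<exists>r>0. \<forall>p\<in>C. \<forall>p'\<in>C. norm (p' - p) < r \<longrightarrow> \<bar>Im (cnj (T p) * (p' - p))\<bar> \<le> norm (p' - p) / 4"
proof (rule ccontr)
  assume contra: "\<not> ?thesis"
  have "\<exists>p\<in>C. \<exists>p'\<in>C. norm (p' - p) < inverse (real (Suc k)) \<and> \<bar>Im (cnj (T p) * (p' - p))\<bar> > norm (p' - p) / 4" for k
  proof -
    have "inverse (real (Suc k)) > 0" by simp
    with contra show ?thesis by (meson not_le)
  qed
  then have "\<forall>k. \<exists>x. x \<in> {0..1} \<times> {0..1} \<and> norm (g (snd x) - g (fst x)) < inverse (real (Suc k)) \<and>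
      \<bar>Im (cnj (T (g (fst x))) * (g (snd x) - g (fst x)))\<bar> > norm (g (snd x) - g (fst x)) / 4"
    unfolding C_def by fastforce
  then obtain x where x: "\<And>k. x k \<in> {0..1} \<times> {0..1}"
    "\<And>k. norm (g (snd (x k)) - g (fst (x k))) < inverse (real (Suc k))"
    "\<And>k. \<bar>Im (cnj (T (g (fst (x k)))) * (g (snd (x k)) - g (fst (x k))))\<bar> > norm (g (snd (x k)) - g (fst (x k))) / 4"
    by metis
  have "compact ({0..1::real} \<times> {0..1::real})" by (intro compact_Times) auto
  then obtain l r where l: "l \<in> {0..1::real} \<times> {0..1::real}" "strict_mono r" "(x \<circ> r) \<longlonglongrightarrow> l"
    using x(1) unfolding compact_def by metis
  obtain s t where st: "l = (s, t)" by (cases l)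
  have s: "s \<in> {0..1}" "t \<in> {0..1}" using l(1) st by auto
  have lim: "(\<lambda>k. fst (x (r k))) \<longlonglongrightarrow> s" "(\<lambda>k. snd (x (r k))) \<longlonglongrightarrow> t"
    using tendsto_fst[OF l(3)] tendsto_snd[OF l(3)] by (simp_all add: st o_def)
  have "(\<lambda>k. g (snd (x (r k))) - g (fst (x (r k)))) \<longlonglongrightarrow> g t - g s"
    by (intro tendsto_intros isCont_tendsto_compose[OF isCont_g] lim)
  moreover have "(\<lambda>k. g (snd (x (r k))) - g (fst (x (r k)))) \<longlonglongrightarrow> 0"
  proof (rule Lim_null_comparison)
    show "\<forall>\<^sub>F k in sequentially. norm (g (snd (x (r k))) - g (fst (x (r k)))) \<le> inverse (real (Suc (r k)))"
      using x(2) by (intro always_eventually allI less_imp_le)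
    show "(\<lambda>k. inverse (real (Suc (r k)))) \<longlonglongrightarrow> 0"
      using LIMSEQ_subseq_LIMSEQ[OF LIMSEQ_inverse_real_of_nat l(2)] by (simp add: o_def)
  qed
  ultimately have "g s = g t" using LIMSEQ_unique by fastforce
  then have "s = t \<or> (s = 0 \<and> t = 1) \<or> (s = 1 \<and> t = 0)" using inj_cases s by blast
  \<comment> \<open>A shift by one period brings both parameters close to s, even across the base
    point of the loop.\<close>
  then obtain m where m: "m \<in> {-1, 0, 1}" "t + m = s" by force
  \<comment> \<open>With this tolerance the normal part of the chord is at most 2 e |b - a| while
    its length is at least 13 e |b - a|, and 2/13 < 1/4.\<close>
  define e where "e = norm (g' s) / 16"
  have e: "e > 0" using ne by (simp add: e_def)
  have "isCont g' s" using cont' by (simp add: continuous_on_eq_continuous_at)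
  then obtain d where d: "d > 0" "\<And>y. \<bar>y - s\<bar> < d \<Longrightarrow> norm (g' y - g' s) < e"
    using e unfolding continuous_at_eps_delta dist_norm real_norm_def by blast
  have "(\<lambda>k. snd (x (r k)) + m) \<longlonglongrightarrow> s"
    using tendsto_add[OF lim(2) tendsto_const[of m]] m(2) by simp
  then have "\<forall>\<^sub>F k in sequentially. dist (snd (x (r k)) + m) s < d"
    using d(1) by (rule tendstoD)
  moreover have "\<forall>\<^sub>F k in sequentially. dist (fst (x (r k))) s < d"
    using lim(1) d(1) by (rule tendstoD)
  ultimately have "\<forall>\<^sub>F k in sequentially. dist (snd (x (r k)) + m) s < d \<and> dist (fst (x (r k))) s < d"
    by (rule eventually_conj)
  then obtain k where k: "dist (snd (x (r k)) + m) s < d" "dist (fst (x (r k))) s < d"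
    by (auto simp: eventually_sequentially)
  define a where "a = fst (x (r k))"
  define b where "b = snd (x (r k)) + m"
  have a01: "a \<in> {0..1}" using x(1)[of "r k"] by (auto simp: a_def mem_Times_iff)
  have gb: "g b = g (snd (x (r k)))"
    using m(1) periodic periodic_minus by (auto simp: b_def)
  have seg: "y \<in> closed_segment a b \<Longrightarrow> \<bar>y - s\<bar> < d" for y
    using k by (auto simp: a_def b_def dist_real_def closed_segment_eq_real_ivl split: if_splits)
  have lin: "norm (g b - g a - (b - a) *\<^sub>R g' a) \<le> norm (b - a) * (2 * e)"
  proof (rule vector_differentiable_bound_linearization)
    show "(g has_vector_derivative g' y) (at y within closed_segment a b)" for y
      using deriv has_vector_derivative_at_within by blast
    show "norm (g' y - g' a) \<le> 2 * e" if "y \<in> closed_segment a b" for y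
      using d(2)[OF seg[OF that]] d(2)[OF seg, of a] norm_triangle_ineq4[of "g' y - g' s" "g' a - g' s"] by simp
  qed auto
  define u where "u = g b - g a - (b - a) *\<^sub>R g' a"
  have diff: "g b - g a = (b - a) *\<^sub>R g' a + u" by (simp add: u_def)
  have u: "norm u \<le> 2 * e * \<bar>b - a\<bar>" using lin by (simp add: u_def mult.commute)
  have Ta: "T (g a) = sgn (g' a)" using T_g a01 by blast
  have "Im (cnj (T (g a)) * ((b - a) *\<^sub>R g' a)) = 0"
    by (simp add: Ta sgn_div_norm scaleR_conv_of_real)
  then have "Im (cnj (T (g a)) * (g b - g a)) = Im (cnj (T (g a)) * u)"
    unfolding diff distrib_left by simp
  also have "\<bar>\<dots>\<bar> \<le> norm (cnj (T (g a)) * u)" by (rule abs_Im_le_cmod)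
  also have "\<dots> = norm u" using norm_T[of "g a"] a01 by (simp add: norm_mult C_def)
  finally have 1: "\<bar>Im (cnj (T (g a)) * (g b - g a))\<bar> \<le> 2 * e * \<bar>b - a\<bar>" using u by simp
  have "norm (g' a) \<ge> 15 * e"
    using d(2)[OF seg, of a] norm_triangle_ineq2[of "g' s" "g' a"] by (simp add: e_def norm_minus_commute)
  then have "15 * e * \<bar>b - a\<bar> \<le> norm (g' a) * \<bar>b - a\<bar>" by (rule mult_right_mono) simp
  also have "\<dots> = norm ((b - a) *\<^sub>R g' a)" by simp
  also have "\<dots> \<le> norm (g b - g a) + norm u"
    using norm_triangle_ineq4[of "(b - a) *\<^sub>R g' a + u" u] diff by simp
  finally have "13 * e * \<bar>b - a\<bar> \<le> norm (g b - g a)" using u by simp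
  then have "\<bar>Im (cnj (T (g a)) * (g b - g a))\<bar> \<le> norm (g b - g a) / 4"
  proof -
    have "0 \<le> e * \<bar>b - a\<bar>" using e by simp
    with 1 \<open>13 * e * \<bar>b - a\<bar> \<le> norm (g b - g a)\<close> show ?thesis by linarith
  qed
  then show False using x(3)[of "r k"] gb by (simp add: a_def)
qed

lemma nearest_point_normal:
  assumes p: "p \<in> C" and min: "\<And>p'. p' \<in> C \<Longrightarrow> norm (w - p) \<le> norm (w - p')"
  shows "Re (cnj (T p) * (w - p)) = 0"
proof -
  obtain s where s: "s \<in> {0..1}" "p = g s" using p by (auto simp: C_def)
  have D: "((\<lambda>t. (w - g t) \<bullet> (w - g t)) has_real_derivative (- 2 * ((w - g s) \<bullet> g' s))) (at s)"
    unfolding has_field_derivative_def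
    by (rule has_derivative_eq_rhs)
       (rule derivative_eq_intros deriv[unfolded has_vector_derivative_def] refl | simp add: inner_commute fun_eq_iff algebra_simps)+
  have "- 2 * ((w - g s) \<bullet> g' s) = 0"
  proof (rule DERIV_local_min[OF D])
    show "(0::real) < 1" by simp
    \<comment> \<open>The parameter may leave the unit interval; by periodicity the curve stays in
      C, so the minimum is interior even for s = 0 or s = 1.\<close>
    show "\<forall>y. \<bar>s - y\<bar> < 1 \<longrightarrow> (w - g s) \<bullet> (w - g s) \<le> (w - g y) \<bullet> (w - g y)"
    proof (intro allI impI)
      fix y assume "\<bar>s - y\<bar> < 1"
      then have "g y \<in> C" using s by (intro g_in_C) auto
      then have "norm (w - g s) \<le> norm (w - g y)" using min s by blast
      then show "(w - g s) \<bullet> (w - g s) \<le> (w - g y) \<bullet> (w - g y)"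
        by (simp add: dot_square_norm power_mono)
    qed
  qed
  then have "(w - p) \<bullet> g' s = 0" using s by simp
  moreover have "Re (cnj (T p) * (w - p)) = ((w - p) \<bullet> g' s) / norm (g' s)"
    using s by (simp add: T_g sgn_div_norm inner_complex_def divide_inverse algebra_simps)
  ultimately show ?thesis by simp
qed

text \<open>A polynomial approximation of the unit normal pushes the whole curve to one side.\<close>

lemma inward_field:
  assumes E: "open E" "frontier E = C"
  shows "\<exists>N d0. polynomial_function N \<and> d0 > 0 \<and> (\<forall>p\<in>C. \<forall>d. 0 < d \<longrightarrow> d < d0 \<longrightarrow> p + d *\<^sub>R N p \<in> E)"
proof -
  obtain r where r: "r > 0" "\<And>p p'. p \<in> C \<Longrightarrow> p' \<in> C \<Longrightarrow> norm (p' - p) < r \<Longrightarrow> \<bar>Im (cnj (T p) * (p' - p))\<bar> \<le> norm (p' - p) / 4"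
    using chord by blast
  \<comment> \<open>A displacement by d along a vector within 1/4 of the unit normal has normal
    component at least 3/4 d and length at most 5/4 d. If it ended on the curve,
    \<open>chord\<close> would bound the normal component by 5/16 d.\<close>
  have off: "p + d *\<^sub>R u \<notin> C" if p: "p \<in> C" and d: "0 < d" "d < r / 2" and u: "norm (u - of_real \<sigma> * (\<i> * T p)) \<le> 1 / 4" and \<sigma>: "\<bar>\<sigma>\<bar> = 1" for p d u \<sigma>
  proof
    assume pC: "p + d *\<^sub>R u \<in> C"
    have "norm (of_real \<sigma> * (\<i> * T p)) = 1" using \<sigma> norm_T[OF p] by (simp add: norm_mult)
    then have nu: "norm u \<le> 5 / 4"
      using norm_triangle_ineq2[of u "of_real \<sigma> * (\<i> * T p)"] u by linarith
    have "norm (p + d *\<^sub>R u - p) = d * norm u" using d by simp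
    also have "\<dots> \<le> d * (5 / 4)" using nu d by (intro mult_left_mono) auto
    finally have le: "norm (p + d *\<^sub>R u - p) \<le> d * (5 / 4)" .
    then have "\<bar>Im (cnj (T p) * (p + d *\<^sub>R u - p))\<bar> \<le> norm (p + d *\<^sub>R u - p) / 4"
      using d r(1) by (intro r(2)[OF p pC]) linarith
    then have 1: "\<bar>Im (cnj (T p) * (p + d *\<^sub>R u - p))\<bar> \<le> d * (5 / 16)" using le by linarith
    define v where "v = u - of_real \<sigma> * (\<i> * T p)"
    have "cnj (T p) * u = of_real \<sigma> * \<i> * (cnj (T p) * T p) + cnj (T p) * v"
      by (simp add: v_def algebra_simps)
    then have "Im (cnj (T p) * u) = \<sigma> + Im (cnj (T p) * v)" using cnj_T[OF p] by simp
    moreover have "\<bar>Im (cnj (T p) * v)\<bar> \<le> 1 / 4"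
      using abs_Im_le_cmod[of "cnj (T p) * v"] u norm_T[OF p] by (simp add: norm_mult v_def)
    ultimately have "\<bar>Im (cnj (T p) * u)\<bar> \<ge> 3 / 4" using \<sigma> by linarith
    moreover have "\<bar>Im (cnj (T p) * (p + d *\<^sub>R u - p))\<bar> = d * \<bar>Im (cnj (T p) * u)\<bar>"
    proof -
      have "cnj (T p) * (p + d *\<^sub>R u - p) = d *\<^sub>R (cnj (T p) * u)" by simp
      then show ?thesis using d by (simp only: scaleR_complex.sel abs_mult abs_of_pos)
    qed
    ultimately have "\<bar>Im (cnj (T p) * (p + d *\<^sub>R u - p))\<bar> \<ge> d * (3 / 4)" using d by simp
    then show False using 1 d by simp
  qed
  have "continuous_on C (\<lambda>p. \<i> * T p)" by (intro continuous_intros continuous_T)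
  then obtain N where N: "polynomial_function N" "\<And>p. p \<in> C \<Longrightarrow> norm (\<i> * T p - N p) < 1 / 4"
    using Stone_Weierstrass_polynomial_function[OF compact_C, of "\<lambda>p. \<i> * T p" "1/4"] by auto
  have contN: "continuous_on A N" for A using N(1) continuous_on_polymonial_function by blast
  have near: "norm (of_real \<sigma> * N p - of_real \<sigma> * (\<i> * T p)) \<le> 1 / 4" if "p \<in> C" "\<bar>\<sigma>\<bar> = 1" for p \<sigma>
  proof -
    have "norm (of_real \<sigma> * N p - of_real \<sigma> * (\<i> * T p)) = norm (complex_of_real \<sigma>) * norm (N p - \<i> * T p)"
      unfolding right_diff_distrib[symmetric] norm_mult ..
    then show ?thesis using N(2)[OF that(1)] that(2) by (simp add: norm_minus_commute)
  qed
  have stay: "K \<subseteq> E" if "connected K" "K \<inter> C = {}" "K \<inter> E \<noteq> {}" for K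
    using connected_Int_frontier[OF that(1,3)] that(2) E(2) by blast
  obtain c0 where c0: "c0 \<in> C" using nonempty_C by blast
  then have "c0 \<in> closure E" using E(2) by (auto simp: frontier_def)
  \<comment> \<open>A point of E close to the curve determines the side: it differs from its nearest
    point p by a normal vector, and the sign of the latter is \<sigma>.\<close>
  then obtain w where w: "w \<in> E" "dist w c0 < r / 2"
    using r(1) closure_approachable half_gt_zero by blast
  have wC: "w \<notin> C" using w(1) E by (auto simp: frontier_def interior_open)
  obtain p where p: "p \<in> C" "\<And>p'. p' \<in> C \<Longrightarrow> norm (w - p) \<le> norm (w - p')"
    using distance_attains_inf[OF compact_imp_closed[OF compact_C] nonempty_C, of w] unfolding dist_norm by metis
  define d where "d = norm (w - p)"
  have d: "0 < d" "d < r / 2"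
    using wC p(1) p(2)[OF c0] w(2) by (auto simp: d_def dist_norm)
  have "Re (cnj (T p) * (w - p)) = 0" using nearest_point_normal p by blast
  moreover have "norm (cnj (T p) * (w - p)) = d" using norm_T[OF p(1)] by (simp add: norm_mult d_def)
  ultimately have im: "\<bar>Im (cnj (T p) * (w - p))\<bar> = d"
    by (simp add: cmod_def)
  define \<sigma> where "\<sigma> = Im (cnj (T p) * (w - p)) / d"
  have \<sigma>: "\<bar>\<sigma>\<bar> = 1" using im d by (simp add: \<sigma>_def)
  have "w - p = d *\<^sub>R (of_real \<sigma> * (\<i> * T p))"
  proof -
    have "cnj (T p) * (w - p) = of_real (d * \<sigma>) * \<i>"
      using \<open>Re (cnj (T p) * (w - p)) = 0\<close> d by (simp add: complex_eq_iff \<sigma>_def)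
    then have "(cnj (T p) * T p) * (w - p) = of_real (d * \<sigma>) * \<i> * T p"
      by (metis mult.assoc mult.commute)
    then show ?thesis using cnj_T[OF p(1)] by (simp add: scaleR_conv_of_real)
  qed
  then have w_eq: "w = p + d *\<^sub>R (of_real \<sigma> * (\<i> * T p))" by (simp add: algebra_simps)
  have pN: "p + d *\<^sub>R (of_real \<sigma> * N p) \<in> E"
  proof -
    \<comment> \<open>The directions within 1/4 of the normal form a ball, whose displacements miss
      the curve. It joins w to the point reached with the polynomial field.\<close>
    define K where "K = (\<lambda>u. p + d *\<^sub>R u) ` cball (of_real \<sigma> * (\<i> * T p)) (1 / 4)"
    have "K \<subseteq> E"
    proof (rule stay)
      show "connected K" unfolding K_def by (intro connected_continuous_image continuous_intros) auto
      show "K \<inter> C = {}" unfolding K_def using off[OF p(1) d _ \<sigma>] by (auto simp: dist_norm norm_minus_commute)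
      have "w \<in> K" unfolding K_def using w_eq by (intro image_eqI[of _ _ "of_real \<sigma> * (\<i> * T p)"]) auto
      then show "K \<inter> E \<noteq> {}" using w(1) by blast
    qed
    moreover have "p + d *\<^sub>R (of_real \<sigma> * N p) \<in> K"
      unfolding K_def using near[OF p(1) \<sigma>] by (intro image_eqI[of _ _ "of_real \<sigma> * N p"]) (auto simp: dist_norm norm_minus_commute)
    ultimately show ?thesis by blast
  qed
  \<comment> \<open>The whole collar swept out by the field is connected and misses the curve, so
    one of its points in E forces all of it into E.\<close>
  define K where "K = (\<lambda>(p, d). p + d *\<^sub>R (of_real \<sigma> * N p)) ` (C \<times> {0<..<r / 2})"
  have "K \<subseteq> E"
  proof (rule stay)
    have "continuous_on (C \<times> {0<..<r / 2}) (\<lambda>x. fst x + snd x *\<^sub>R (of_real \<sigma> * N (fst x)))"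
      by (intro continuous_intros continuous_on_compose2[OF contN[of UNIV]]) auto
    then show "connected K"
      unfolding K_def case_prod_unfold by (intro connected_continuous_image connected_Times connected_C) auto
    show "K \<inter> C = {}" unfolding K_def using off[OF _ _ _ near[OF _ \<sigma>] \<sigma>] by auto
    have "p + d *\<^sub>R (of_real \<sigma> * N p) \<in> K"
      unfolding K_def by (rule image_eqI[of _ _ "(p, d)"]) (use p(1) d in auto)
    then show "K \<inter> E \<noteq> {}" using pN by blast
  qed
  moreover have "polynomial_function (\<lambda>p. of_real \<sigma> * N p)"
  proof -
    have "polynomial_function (\<lambda>p. \<sigma> *\<^sub>R N p)" using N(1) by (rule polynomial_function_cmul)
    then show ?thesis by (simp add: scaleR_conv_of_real)
  qed
  moreover have "p + d *\<^sub>R (of_real \<sigma> * N p) \<in> K" if "p \<in> C" "0 < d" "d < r / 2" for p d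
    unfolding K_def by (rule image_eqI[of _ _ "(p, d)"]) (use that in auto)
  ultimately show ?thesis
    using r(1) by (intro exI[of _ "\<lambda>p. of_real \<sigma> * N p"] exI[of _ "r / 2"]) auto
qed

end

section \<open>Cauchy's formula along arbitrary boundary paths\<close>

lemma C1_on_real_polynomial: "real_polynomial_function f \<Longrightarrow> C1_on UNIV f"
proof (induction f rule: real_polynomial_function.induct)
  case (linear f)
  have "C1_on UNIV (\<lambda>x::complex. x)" by (rule C1_on_holomorphic) auto
  from C1_on_bounded_linear[OF linear this] show ?case .
qed (auto intro: C1_on_const C1_on_add C1_on_mult)

lemma C1_on_polynomial:
  fixes N :: "complex \<Rightarrow> complex"
  assumes "polynomial_function N" shows "C1_on UNIV N"
proof -
  have "C1_on UNIV (\<lambda>p. Re (N p))" "C1_on UNIV (\<lambda>p. Im (N p))"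
    using assms unfolding polynomial_function_def o_def
    by (auto intro!: C1_on_real_polynomial bounded_linear_Re bounded_linear_Im)
  then have "C1_on UNIV (\<lambda>p. of_real (Re (N p)) + \<i> * of_real (Im (N p)))"
    by (intro C1_on_add C1_on_mult C1_on_const C1_on_bounded_linear[OF bounded_linear_of_real])
  then show ?thesis by (simp add: complex_eq[symmetric] Complex_eq)
qed

context regular_loop
begin

text \<open>Near a point of the curve, the tangential coordinate of a simple parametrization is
  monotone, and it controls the speed.\<close>

lemma speed_integrable:
  assumes \<gamma>: "simple_path \<gamma>" "path_image \<gamma> = C"
    and F: "finite F" "0 \<in> F" "1 \<in> F"
    and D: "\<And>s. s \<in> {0..1} - F \<Longrightarrow> (\<gamma> has_vector_derivative v s) (at s)"
    and v0: "\<And>s. s \<in> F \<Longrightarrow> v s = 0"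
  shows "(\<lambda>s. norm (v s)) integrable_on {0..1}"
proof -
  obtain r where r: "r > 0" "\<And>p p'. p \<in> C \<Longrightarrow> p' \<in> C \<Longrightarrow> norm (p' - p) < r \<Longrightarrow> \<bar>Im (cnj (T p) * (p' - p))\<bar> \<le> norm (p' - p) / 4"
    using chord by blast
  have cont\<gamma>: "continuous_on {0..1} \<gamma>" using \<gamma>(1) by (simp add: simple_path_def path_def)
  have \<gamma>C: "\<gamma> s \<in> C" if "s \<in> {0..1}" for s using that \<gamma>(2) by (auto simp: path_image_def)
  \<comment> \<open>Integrability over a compact interval is local, so small intervals around each
    parameter suffice.\<close>
  have "\<exists>d>0. \<forall>a b. \<tau> \<in> cbox a b \<and> cbox a b \<subseteq> ball \<tau> d \<and> cbox a b \<subseteq> cbox 0 1 \<longrightarrow> (\<lambda>s. norm (v s)) integrable_on cbox a b"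
    if \<tau>: "\<tau> \<in> cbox 0 (1::real)" for \<tau>
  proof -
    have \<tau>01: "\<tau> \<in> {0..1}" using \<tau> by simp
    define T0 where "T0 = T (\<gamma> \<tau>)"
    have nT0: "norm T0 = 1" unfolding T0_def by (rule norm_T[OF \<gamma>C[OF \<tau>01]])
    obtain r1 where r1: "r1 > 0" "\<And>p. p \<in> C \<Longrightarrow> norm (p - \<gamma> \<tau>) < r1 \<Longrightarrow> norm (T p - T0) < 1 / 4"
      using continuous_T[unfolded continuous_on_iff, rule_format, OF \<gamma>C[OF \<tau>01], of "1/4"]
      unfolding dist_norm T0_def by auto
    define r2 where "r2 = min r1 (r / 2)"
    obtain d1 where d1: "d1 > 0" "\<And>s. s \<in> {0..1} \<Longrightarrow> \<bar>s - \<tau>\<bar> < d1 \<Longrightarrow> norm (\<gamma> s - \<gamma> \<tau>) < r2"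
      using cont\<gamma>[unfolded continuous_on_iff, rule_format, OF \<tau>01, of r2] r1(1) r(1)
      unfolding dist_norm r2_def by auto
    \<comment> \<open>At most 1/2, so that the neighbourhood never contains both ends of the loop
      and the path is injective on it.\<close>
    define d where "d = min d1 (1 / 2)"
    have d: "d > 0" using d1(1) by (simp add: d_def)
    define f where "f s = Re (cnj T0 * \<gamma> s)" for s
    have ch: "norm (\<gamma> s' - \<gamma> s) \<le> 2 * \<bar>f s' - f s\<bar>"
      if s: "s \<in> {0..1}" "\<bar>s - \<tau>\<bar> < d" and s': "s' \<in> {0..1}" "\<bar>s' - \<tau>\<bar> < d" for s s'
    proof -
      have n: "norm (\<gamma> s - \<gamma> \<tau>) < r2" "norm (\<gamma> s' - \<gamma> \<tau>) < r2"
        using d1(2) s s' by (auto simp: d_def)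
      define u where "u = \<gamma> s' - \<gamma> s"
      have "norm u < r"
        using n norm_triangle_ineq4[of "\<gamma> s' - \<gamma> \<tau>" "\<gamma> s - \<gamma> \<tau>"] by (simp add: u_def r2_def)
      then have 1: "\<bar>Im (cnj (T (\<gamma> s)) * u)\<bar> \<le> norm u / 4"
        unfolding u_def using r(2) \<gamma>C s s' by blast
      have "norm (T (\<gamma> s) - T0) < 1 / 4" using n(1) by (intro r1(2) \<gamma>C s) (simp add: r2_def)
      then have "norm (cnj T0 - cnj (T (\<gamma> s))) \<le> 1 / 4"
        by (simp flip: complex_cnj_diff add: norm_minus_commute)
      then have "norm ((cnj T0 - cnj (T (\<gamma> s))) * u) \<le> 1 / 4 * norm u"
        unfolding norm_mult by (rule mult_right_mono) simp
      then have "\<bar>Im ((cnj T0 - cnj (T (\<gamma> s))) * u)\<bar> \<le> norm u / 4"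
        using abs_Im_le_cmod[of "(cnj T0 - cnj (T (\<gamma> s))) * u"] by linarith
      moreover have "Im (cnj T0 * u) = Im ((cnj T0 - cnj (T (\<gamma> s))) * u) + Im (cnj (T (\<gamma> s)) * u)"
        by (simp only: left_diff_distrib minus_complex.sel)
      ultimately have "\<bar>Im (cnj T0 * u)\<bar> \<le> norm u / 2" using 1 by linarith
      moreover have "norm u \<le> \<bar>Re (cnj T0 * u)\<bar> + \<bar>Im (cnj T0 * u)\<bar>"
        using cmod_le[of "cnj T0 * u"] nT0 by (simp add: norm_mult)
      ultimately have "norm u \<le> 2 * \<bar>Re (cnj T0 * u)\<bar>" by linarith
      moreover have "Re (cnj T0 * u) = f s' - f s" by (simp add: f_def u_def right_diff_distrib)
      ultimately show ?thesis by (simp add: u_def)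
    qed
    have "(\<lambda>s. norm (v s)) integrable_on cbox a b"
      if ab: "\<tau> \<in> cbox a b" "cbox a b \<subseteq> ball \<tau> d" "cbox a b \<subseteq> cbox 0 1" for a b
    proof -
      have le: "a \<le> b" using ab(1) by auto
      have in01: "s \<in> {0..1}" "\<bar>s - \<tau>\<bar> < d" if "s \<in> {a..b}" for s
        using ab(2,3) that by (auto simp: subset_eq dist_real_def abs_minus_commute)
      have fD: "(f has_real_derivative Re (cnj T0 * v s)) (at s)" if "s \<in> {0..1} - F" for s
      proof -
        have "(f has_vector_derivative Re (cnj T0 * v s)) (at s)"
          unfolding f_def
          by (rule bounded_linear.has_vector_derivative[OF bounded_linear_compose[OF bounded_linear_Re bounded_linear_mult_right] D[OF that]])
        then show ?thesis by (simp add: has_real_derivative_iff_has_vector_derivative)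
      qed
      have f_cont: "continuous_on {a..b} f"
        unfolding f_def using in01 by (intro continuous_intros continuous_on_subset[OF cont\<gamma>]) auto
      have f_inj: "inj_on f {a..b}"
      proof (rule inj_onI)
        fix s s' assume s: "s \<in> {a..b}" "s' \<in> {a..b}" "f s = f s'"
        then have "\<gamma> s = \<gamma> s'" using ch[OF in01[OF s(1)] in01[OF s(2)]] by simp
        moreover have "d \<le> 1 / 2" by (simp add: d_def)
        then have "\<bar>s - s'\<bar> < 1" using in01(2)[OF s(1)] in01(2)[OF s(2)] by linarith
        ultimately show "s = s'"
          using \<gamma>(1) in01(1)[OF s(1)] in01(1)[OF s(2)] unfolding simple_path_def loop_free_def by force
      qed
      \<comment> \<open>A continuous injective function on an interval is monotone. Its derivative
        then has one sign, and the absolute value is integrable because the derivative is, by the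
        fundamental theorem of calculus.\<close>
      then have mono: "strict_mono_on {a..b} f \<or> strict_antimono_on {a..b} f"
        using injective_eq_monotone_map[OF is_interval_cc f_cont] by blast
      have f'_int: "(\<lambda>s. Re (cnj T0 * v s)) integrable_on {a..b}"
      proof -
        have "((\<lambda>s. Re (cnj T0 * v s)) has_integral f b - f a) {a..b}"
        proof (rule fundamental_theorem_of_calculus_interior_strong[OF F(1) le _ f_cont])
          fix s assume "s \<in> {a<..<b} - F"
          then have "s \<in> {0..1} - F" using in01(1)[of s] by auto
          then show "(f has_vector_derivative Re (cnj T0 * v s)) (at s)"
            using fD by (simp add: has_real_derivative_iff_has_vector_derivative)
        qed
        then show ?thesis by blast
      qed
      have v_int: "v integrable_on {a..b}"
      proof -
        have "(v has_integral \<gamma> b - \<gamma> a) {a..b}"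
        proof (rule fundamental_theorem_of_calculus_interior_strong[OF F(1) le])
          show "(\<gamma> has_vector_derivative v s) (at s)" if "s \<in> {a<..<b} - F" for s
            using that in01(1)[of s] by (intro D) auto
          show "continuous_on {a..b} \<gamma>" using in01 by (intro continuous_on_subset[OF cont\<gamma>]) auto
        qed
        then show ?thesis by blast
      qed
      have abs_int: "(\<lambda>s. \<bar>Re (cnj T0 * v s)\<bar>) integrable_on {a..b}"
      proof -
        have int_ab: "s \<in> interior {a..b}" if "s \<in> {a..b} - {a, b}" for s
          using that by auto
        from mono show ?thesis
        proof
          assume m: "strict_mono_on {a..b} f"
          have "Re (cnj T0 * v s) \<ge> 0" if s: "s \<in> {a..b} - {a, b}" for s
          proof (cases "s \<in> F")
            case False
            then show ?thesis
              using mono_on_imp_deriv_nonneg[OF strict_mono_on_imp_mono_on[OF m] fD int_ab[OF s]] in01(1)[of s] s by auto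
          qed (simp add: v0)
          then have "\<bar>Re (cnj T0 * v s)\<bar> = Re (cnj T0 * v s)" if "s \<in> {a..b} - {a, b}" for s
            using that by (simp only: abs_of_nonneg)
          then show ?thesis
            by (rule integrable_spike_finite[OF _ _ f'_int, of "{a, b}", rotated]) auto
        next
          assume m: "strict_antimono_on {a..b} f"
          have m': "mono_on {a..b} (\<lambda>s. - f s)"
            using m by (force simp: monotone_on_def le_less)
          have "- Re (cnj T0 * v s) \<ge> 0" if s: "s \<in> {a..b} - {a, b}" for s
          proof (cases "s \<in> F")
            case False
            then have "s \<in> {0..1} - F" using in01(1)[of s] s by auto
            from mono_on_imp_deriv_nonneg[OF m' DERIV_minus[OF fD[OF this]] int_ab[OF s]] show ?thesis .
          qed (simp add: v0)
          then have "\<bar>Re (cnj T0 * v s)\<bar> = - Re (cnj T0 * v s)" if "s \<in> {a..b} - {a, b}" for s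
            using that by (intro abs_of_nonpos) force
          then show ?thesis
            by (rule integrable_spike_finite[OF _ _ integrable_neg[OF f'_int], of "{a, b}", rotated]) auto
        qed
      qed
      \<comment> \<open>The comparison \<open>ch\<close> of increments passes to difference
        quotients and to the limit: the speed is at most twice that of the tangential
        coordinate.\<close>
      have v_le: "norm (v s) \<le> 2 * \<bar>Re (cnj T0 * v s)\<bar>" if s: "s \<in> {a..b}" for s
      proof (cases "s \<in> F")
        case False
        have s01: "0 < s" "s < 1" using in01(1)[OF s] False F by (auto simp: less_le)
        have sF: "s \<in> {0..1} - F" using in01(1)[OF s] False by auto
        have 1: "((\<lambda>y. norm ((\<gamma> y - \<gamma> s) /\<^sub>R (y - s))) \<longlongrightarrow> norm (v s)) (at s)"
        proof -
          have re: "((\<lambda>y. (Re (\<gamma> y) - Re (\<gamma> s)) / (y - s)) \<longlongrightarrow> Re (v s)) (at s)"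
            using bounded_linear.has_vector_derivative[OF bounded_linear_Re D[OF sF]]
            unfolding has_real_derivative_iff_has_vector_derivative[symmetric] has_field_derivative_iff .
          have im: "((\<lambda>y. (Im (\<gamma> y) - Im (\<gamma> s)) / (y - s)) \<longlongrightarrow> Im (v s)) (at s)"
            using bounded_linear.has_vector_derivative[OF bounded_linear_Im D[OF sF]]
            unfolding has_real_derivative_iff_has_vector_derivative[symmetric] has_field_derivative_iff .
          have "Complex ((Re (\<gamma> y) - Re (\<gamma> s)) / (y - s)) ((Im (\<gamma> y) - Im (\<gamma> s)) / (y - s)) = (\<gamma> y - \<gamma> s) /\<^sub>R (y - s)" for y
            by (simp add: complex_eq_iff divide_inverse_commute)
          then show ?thesis using tendsto_norm[OF tendsto_Complex[OF re im]] by simp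
        qed
        have 2: "((\<lambda>y. 2 * \<bar>(f y - f s) / (y - s)\<bar>) \<longlongrightarrow> 2 * \<bar>Re (cnj T0 * v s)\<bar>) (at s)"
          using fD[OF sF] unfolding has_field_derivative_iff by (intro tendsto_intros)
        define \<delta> where "\<delta> = min (d - \<bar>s - \<tau>\<bar>) (min s (1 - s))"
        have \<delta>: "\<delta> > 0" using in01(2)[OF s] s01 by (simp add: \<delta>_def)
        have "\<forall>\<^sub>F y in at s. norm ((\<gamma> y - \<gamma> s) /\<^sub>R (y - s)) \<le> 2 * \<bar>(f y - f s) / (y - s)\<bar>"
          unfolding eventually_at
        proof (intro exI[of _ \<delta>] conjI ballI impI \<delta>)
          fix y assume y: "y \<noteq> s \<and> dist y s < \<delta>"
          have yy: "y \<in> {0..1}" "\<bar>y - \<tau>\<bar> < d" using y unfolding \<delta>_def dist_real_def by auto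
          have "norm ((\<gamma> y - \<gamma> s) /\<^sub>R (y - s)) = norm (\<gamma> y - \<gamma> s) / \<bar>y - s\<bar>"
            by (simp add: divide_inverse_commute)
          also have "\<dots> \<le> 2 * \<bar>f y - f s\<bar> / \<bar>y - s\<bar>"
            by (intro divide_right_mono ch in01[OF s] yy) simp
          finally show "norm ((\<gamma> y - \<gamma> s) /\<^sub>R (y - s)) \<le> 2 * \<bar>(f y - f s) / (y - s)\<bar>"
            by (simp add: abs_divide)
        qed
        then show ?thesis by (intro tendsto_le[OF _ 2 1]) auto
      qed (simp add: v0)
      have "v absolutely_integrable_on {a..b}"
        by (rule absolutely_integrable_integrable_bound[OF v_le v_int]) (assumption, rule integrable_cmul[OF abs_int, of 2, unfolded real_scaleR_def])
      then show ?thesis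
        unfolding absolutely_integrable_on_def by simp
    qed
    then show ?thesis using d by blast
  qed
  then have "(\<lambda>s. norm (v s)) integrable_on cbox 0 1"
    by (intro integrable_on_little_subintervals) blast
  then show ?thesis by simp
qed

text \<open>As h is only continuous up to the boundary, the formula is applied to the paths pushed
  into E, which have the same winding number about a. The limit is taken under the integral; the
  dominating function is a multiple of the speed, hence the need for
  \<open>speed_integrable\<close>.\<close>

lemma cauchy_integral_formula_boundary:
  assumes E: "open E" "simply_connected E" "frontier E = C" and bdd: "bounded E"
    and \<gamma>: "positive_boundary_path E \<gamma>"
    and h: "h holomorphic_on E" "continuous_on (closure E) h" and a: "a \<in> E"
  shows "((\<lambda>t. h t / (t - a)) has_contour_integral (2 * of_real pi * \<i> * h a)) \<gamma>"
proof -
  have vp: "valid_path \<gamma>" and sp: "simple_path \<gamma>" and loop: "pathfinish \<gamma> = pathstart \<gamma>"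
    and im: "path_image \<gamma> = C" and wn: "winding_number \<gamma> a = 1"
    using \<gamma> a E(3) unfolding positive_boundary_path_def by auto
  obtain N d0 where N: "polynomial_function N" "d0 > 0" "\<And>p d. p \<in> C \<Longrightarrow> 0 < d \<Longrightarrow> d < d0 \<Longrightarrow> p + d *\<^sub>R N p \<in> E"
    using inward_field[OF E(1,3)] by blast
  obtain F0 where F0: "finite F0" "\<gamma> C1_differentiable_on ({0..1} - F0)"
    using vp unfolding valid_path_def piecewise_C1_differentiable_on_def by blast
  \<comment> \<open>The end points are added so that two-sided derivatives exist off F. The value 0
    given to \<open>v\<close> on this finite set does not affect the integrals.\<close>
  define F where "F = F0 \<union> {0, 1}"
  have F: "finite F" "0 \<in> F" "1 \<in> F" using F0(1) by (auto simp: F_def)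
  define v where "v s = (if s \<in> F then 0 else vector_derivative \<gamma> (at s))" for s
  have D: "(\<gamma> has_vector_derivative v s) (at s)" if "s \<in> {0..1} - F" for s
    using F0(2) that unfolding C1_differentiable_on_eq v_def F_def by (auto simp: vector_derivative_works)
  have speed: "(\<lambda>s. norm (v s)) integrable_on {0..1}"
    by (rule speed_integrable[OF sp im F D]) (simp_all add: v_def)
  have cont\<gamma>: "continuous_on {0..1} \<gamma>" using sp by (simp add: simple_path_def path_def)
  have \<gamma>C: "\<gamma> s \<in> C" if "s \<in> {0..1}" for s using that im by (auto simp: path_image_def)
  note C1N = C1_on_polynomial[OF N(1)]
  define DN where "DN p = frechet_derivative N (at p)" for p
  have DN: "(N has_derivative DN p) (at p)" for p
    unfolding DN_def by (rule C1_onD[OF C1N]) simp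
  have DN_lin: "DN p h = Re h *\<^sub>R DN p 1 + Im h *\<^sub>R DN p \<i>" for p h
  proof -
    have l: "linear (DN p)" using DN has_derivative_linear by blast
    have "h = Re h *\<^sub>R 1 + Im h *\<^sub>R \<i>" by (simp add: complex_eq_iff)
    then have "DN p h = DN p (Re h *\<^sub>R 1 + Im h *\<^sub>R \<i>)" by simp
    then show ?thesis by (simp only: linear_add[OF l] linear_scale[OF l])
  qed
  have DN_cont: "continuous_on A (\<lambda>p. DN p u)" for A u
    unfolding DN_def using C1_on_continuous_deriv[OF C1N] by (rule continuous_on_subset) simp
  have contN: "continuous_on A N" for A
    using C1_on_cont[OF C1N] by (rule continuous_on_subset) simp
  have bound_C: "\<exists>B>0. \<forall>p\<in>C. norm (k p) \<le> B" if "continuous_on C k" for k :: "complex \<Rightarrow> complex"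
  proof -
    have "compact (k ` C)" by (rule compact_continuous_image[OF that compact_C])
    then obtain B where "\<forall>y\<in>k ` C. norm y \<le> B" using compact_imp_bounded bounded_iff by blast
    then show ?thesis by (intro exI[of _ "max B 1"]) auto
  qed
  obtain Nm where Nm: "Nm > 0" "\<And>p. p \<in> C \<Longrightarrow> norm (N p) \<le> Nm" using bound_C[OF contN] by blast
  obtain L1 where L1: "L1 > 0" "\<And>p. p \<in> C \<Longrightarrow> norm (DN p 1) \<le> L1" using bound_C[OF DN_cont] by blast
  obtain L2 where L2: "L2 > 0" "\<And>p. p \<in> C \<Longrightarrow> norm (DN p \<i>) \<le> L2" using bound_C[OF DN_cont] by blast
  have DN_le: "norm (DN p u) \<le> (L1 + L2) * norm u" if "p \<in> C" for p u
  proof -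
    have "norm (DN p u) \<le> \<bar>Re u\<bar> * norm (DN p 1) + \<bar>Im u\<bar> * norm (DN p \<i>)"
      unfolding DN_lin[of p u] by (rule order_trans[OF norm_triangle_ineq]) simp
    also have "\<dots> \<le> norm u * L1 + norm u * L2"
      by (intro add_mono mult_mono abs_Re_le_cmod abs_Im_le_cmod L1 L2 that) auto
    finally show ?thesis by (simp add: algebra_simps)
  qed
  have aC: "a \<notin> C" using a E by (auto simp: frontier_def interior_open)
  obtain \<delta> where \<delta>: "\<delta> > 0" "\<And>p. p \<in> C \<Longrightarrow> \<delta> \<le> norm (p - a)"
  proof -
    obtain \<delta> where "\<delta> > 0" "\<And>p. p \<in> C \<Longrightarrow> \<delta> \<le> dist a p"
      using separate_point_closed[OF compact_imp_closed[OF compact_C] aC] by blast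
    then show ?thesis by (intro that[of \<delta>]) (auto simp: dist_norm norm_minus_commute)
  qed
  \<comment> \<open>The first bound keeps the pushed points in E. The second keeps them within half
    the distance \<delta> of a from the curve, so they stay away from a and the winding number is
    unchanged.\<close>
  define \<eta> where "\<eta> = min (d0 / 2) (\<delta> / (2 * Nm))"
  have \<eta>: "\<eta> > 0" "\<eta> < d0" using N(2) \<delta>(1) Nm(1) by (auto simp: \<eta>_def min_def)
  have \<eta>N: "\<eta> * Nm \<le> \<delta> / 2"
  proof -
    have "\<eta> * Nm \<le> \<delta> / (2 * Nm) * Nm" using Nm(1) by (intro mult_right_mono) (auto simp: \<eta>_def)
    then show ?thesis using Nm(1) by simp
  qed
  define e where "e k = \<eta> * inverse (real (Suc k))" for k
  have e: "0 < e k" "e k \<le> \<eta>" for k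
  proof -
    have "inverse (real (Suc k)) \<le> 1" by (simp add: inverse_le_1_iff)
    then have "\<eta> * inverse (real (Suc k)) \<le> \<eta> * 1" using \<eta> by (intro mult_left_mono) auto
    then show "e k \<le> \<eta>" by (simp add: e_def)
  qed (use \<eta> in \<open>simp add: e_def\<close>)
  have e0: "e \<longlonglongrightarrow> 0"
    using tendsto_mult_left[OF LIMSEQ_inverse_real_of_nat, of \<eta>] by (simp add: e_def[abs_def])
  define G where "G k s = \<gamma> s + e k *\<^sub>R N (\<gamma> s)" for k s
  have G_E: "G k s \<in> E" if "s \<in> {0..1}" for k s
    unfolding G_def using e[of k] \<eta> by (intro N(3) \<gamma>C that) auto
  have G_near: "norm (G k s - \<gamma> s) \<le> \<delta> / 2" if "s \<in> {0..1}" for k s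
  proof -
    have "norm (G k s - \<gamma> s) = e k * norm (N (\<gamma> s))" using e[of k] by (simp add: G_def)
    also have "\<dots> \<le> \<eta> * Nm" using e[of k] Nm \<gamma>C[OF that] \<eta> by (intro mult_mono) auto
    finally show ?thesis using \<eta>N by simp
  qed
  have G_a: "\<delta> / 2 \<le> norm (G k s - a)" if "s \<in> {0..1}" for k s
    using G_near[OF that, of k] \<delta>(2)[OF \<gamma>C[OF that]] norm_triangle_ineq4[of "G k s - a" "G k s - \<gamma> s"] by simp
  define vG where "vG k s = v s + e k *\<^sub>R DN (\<gamma> s) (v s)" for k s
  have DG: "(G k has_vector_derivative vG k s) (at s)" if "s \<in> {0..1} - F" for k s
  proof -
    have "((\<lambda>s. N (\<gamma> s)) has_vector_derivative DN (\<gamma> s) (v s)) (at s)"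
    proof -
      have l: "linear (DN (\<gamma> s))" using DN has_derivative_linear by blast
      from has_derivative_compose[OF D[OF that, unfolded has_vector_derivative_def] DN]
      show ?thesis unfolding has_vector_derivative_def by (simp add: linear_scale[OF l])
    qed
    then show ?thesis
      unfolding G_def vG_def
      by (intro has_vector_derivative_add D[OF that] bounded_linear.has_vector_derivative[OF bounded_linear_scaleR_right])
  qed
  have v_cont: "continuous_on ({0..1} - F) v"
  proof -
    have "continuous_on ({0..1} - F) (\<lambda>s. vector_derivative \<gamma> (at s))"
      using F0(2) unfolding C1_differentiable_on_eq F_def by (auto intro: continuous_on_subset)
    then show ?thesis by (rule continuous_on_eq) (simp add: v_def)
  qed
  have cont\<gamma>F: "continuous_on ({0..1} - F) \<gamma>" using cont\<gamma> by (rule continuous_on_subset) auto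
  have vG_cont: "continuous_on ({0..1} - F) (vG k)" for k
    unfolding vG_def DN_lin[of _ "v _"]
    by (intro continuous_intros v_cont continuous_on_compose2[OF DN_cont[of UNIV] cont\<gamma>F]) auto
  have G_cont: "continuous_on {0..1} (G k)" for k
    unfolding G_def by (intro continuous_intros cont\<gamma> continuous_on_compose2[OF contN[of UNIV] cont\<gamma>]) auto
  have G_valid: "valid_path (G k)" for k
    unfolding valid_path_def piecewise_C1_differentiable_on_def C1_differentiable_on_def
    using G_cont F(1) DG vG_cont by blast
  have G_loop: "pathfinish (G k) = pathstart (G k)" for k
    using loop by (simp add: pathfinish_def pathstart_def G_def)
  have G_wn: "winding_number (G k) a = 1" for k
  proof -
    have "winding_number (G k) a = winding_number \<gamma> a"
    proof (rule winding_number_nearby_loops_eq)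
      show "path \<gamma>" "path (G k)" using cont\<gamma> G_cont by (auto simp: path_def)
      fix t :: real assume t: "t \<in> {0..1}"
      show "norm (G k t - \<gamma> t) < norm (\<gamma> t - a)"
        using G_near[OF t, of k] \<delta>(2)[OF \<gamma>C[OF t]] \<delta>(1) by linarith
    qed (use loop G_loop in auto)
    then show ?thesis using wn by simp
  qed
  define f where "f k s = h (G k s) / (G k s - a) * vG k s" for k s
  have f_int: "(f k has_integral (2 * of_real pi * \<i> * h a)) {0..1}" for k
  proof -
    have im: "path_image (G k) \<subseteq> E - {a}"
    proof
      fix x assume "x \<in> path_image (G k)"
      then obtain s where s: "s \<in> {0..1}" "x = G k s" by (auto simp: path_image_def)
      then show "x \<in> E - {a}" using G_E[OF s(1), of k] G_a[OF s(1), of k] \<delta>(1) by auto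
    qed
    have "((\<lambda>w. h w / (w - a)) has_contour_integral (of_real (2 * pi) * \<i> * winding_number (G k) a * h a)) (G k)"
    proof (rule Cauchy_integral_formula_global[OF E(1) h(1) a G_valid im G_loop])
      show "winding_number (G k) w = 0" if "w \<notin> E" for w
        by (rule simply_connected_imp_winding_number_zero[OF E(2) valid_path_imp_path[OF G_valid] _ G_loop that])
           (use im in auto)
    qed
    then have "((\<lambda>s. h (G k s) / (G k s - a) * vector_derivative (G k) (at s within {0..1})) has_integral (2 * of_real pi * \<i> * h a)) {0..1}"
      by (simp add: has_contour_integral_def G_wn)
    then show ?thesis
    proof (rule has_integral_spike_finite[OF F(1), rotated])
      fix s assume s: "s \<in> {0..1} - F"
      then have "vector_derivative (G k) (at s within {0..1}) = vG k s"
        by (intro vector_derivative_at_within_ivl[OF DG[OF s]]) auto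
      then show "f k s = h (G k s) / (G k s - a) * vector_derivative (G k) (at s within {0..1})"
        by (simp add: f_def)
    qed
  qed
  define f0 where "f0 s = h (\<gamma> s) / (\<gamma> s - a) * v s" for s
  have "compact (h ` closure E)"
    using h(2) bdd by (intro compact_continuous_image) (simp_all add: compact_closure)
  then obtain H where H0: "\<forall>y\<in>h ` closure E. norm y \<le> H" using compact_imp_bounded bounded_iff by blast
  then have H: "norm (h x) \<le> H" if "x \<in> E" for x using that closure_subset by blast
  have Hnn: "H \<ge> 0" using H[OF a] norm_ge_zero order_trans by blast
  define B where "B = H / (\<delta> / 2) * (1 + \<eta> * (L1 + L2))"
  have dom: "norm (f k s) \<le> B * norm (v s)" if s: "s \<in> {0..1}" for k s
  proof -
    have "norm (vG k s) \<le> norm (v s) + e k * norm (DN (\<gamma> s) (v s))"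
      unfolding vG_def using e[of k] by (intro order_trans[OF norm_triangle_ineq]) simp
    also have "\<dots> \<le> norm (v s) + \<eta> * ((L1 + L2) * norm (v s))"
      using e[of k] \<eta> DN_le[OF \<gamma>C[OF s]] by (intro add_left_mono mult_mono) auto
    finally have 1: "norm (vG k s) \<le> (1 + \<eta> * (L1 + L2)) * norm (v s)" by (simp add: algebra_simps)
    have 2: "norm (h (G k s) / (G k s - a)) \<le> H / (\<delta> / 2)"
      unfolding norm_divide using H[OF G_E[OF s]] G_a[OF s] \<delta>(1) Hnn by (intro frac_le) auto
    have "norm (f k s) \<le> H / (\<delta> / 2) * ((1 + \<eta> * (L1 + L2)) * norm (v s))"
      unfolding f_def norm_mult using 1 2 Hnn \<delta>(1) by (intro mult_mono) auto
    then show ?thesis by (simp only: B_def mult.assoc)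
  qed
  have lim: "(\<lambda>k. f k s) \<longlonglongrightarrow> f0 s" if s: "s \<in> {0..1}" for s
  proof -
    have "(\<lambda>k. \<gamma> s + e k *\<^sub>R N (\<gamma> s)) \<longlonglongrightarrow> \<gamma> s + 0 *\<^sub>R N (\<gamma> s)" by (intro tendsto_intros e0)
    then have Gl: "(\<lambda>k. G k s) \<longlonglongrightarrow> \<gamma> s" by (simp add: G_def)
    have "(\<lambda>k. h (G k s)) \<longlonglongrightarrow> h (\<gamma> s)"
    proof (rule continuous_on_tendsto_compose[OF h(2) Gl])
      show "\<gamma> s \<in> closure E" using \<gamma>C[OF s] E(3) by (auto simp: frontier_def)
      show "\<forall>\<^sub>F k in sequentially. G k s \<in> closure E"
        using G_E[OF s] closure_subset by (intro always_eventually) blast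
    qed
    moreover have "(\<lambda>k. vG k s) \<longlonglongrightarrow> v s + 0 *\<^sub>R DN (\<gamma> s) (v s)"
      unfolding vG_def by (intro tendsto_intros e0)
    moreover have "\<gamma> s - a \<noteq> 0" using \<gamma>C[OF s] aC by auto
    ultimately show ?thesis
      unfolding f_def f0_def by (intro tendsto_intros Gl) auto
  qed
  have "(f0 has_integral (2 * of_real pi * \<i> * h a)) {0..1}"
  proof (rule has_integral_dominated_convergence)
    show "(f k has_integral (2 * of_real pi * \<i> * h a)) {0..1}" for k by (rule f_int)
    show "(\<lambda>s. B * norm (v s)) integrable_on {0..1}"
      by (rule integrable_cmul[OF speed, of B, unfolded real_scaleR_def])
    show "\<forall>s\<in>{0..1}. norm (f k s) \<le> B * norm (v s)" for k using dom by blast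
    show "\<forall>s\<in>{0..1}. (\<lambda>k. f k s) \<longlonglongrightarrow> f0 s" using lim by blast
  qed (rule tendsto_const)
  then have "((\<lambda>s. h (\<gamma> s) / (\<gamma> s - a) * vector_derivative \<gamma> (at s within {0..1})) has_integral (2 * of_real pi * \<i> * h a)) {0..1}"
  proof (rule has_integral_spike_finite[OF F(1), rotated])
    fix s assume s: "s \<in> {0..1} - F"
    then have "vector_derivative \<gamma> (at s within {0..1}) = v s"
      by (intro vector_derivative_at_within_ivl[OF D[OF s]]) auto
    then show "h (\<gamma> s) / (\<gamma> s - a) * vector_derivative \<gamma> (at s within {0..1}) = f0 s"
      by (simp add: f0_def)
  qed
  then show ?thesis by (simp add: has_contour_integral_def)
qed

end

section \<open>Boundary loops of smooth simply connected domains\<close>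

lemma regular_loop_of_smooth_jordan_curve:
  assumes "smooth_jordan_curve C0"
  shows "\<exists>g g'. regular_loop g g' \<and> regular_loop.C g = C0"
proof -
  obtain g :: "real \<Rightarrow> complex" where g: "smooth g" "\<And>s. vector_derivative g (at s) \<noteq> 0"
    "\<And>s. g (s + 1) = g s" "inj_on g {0..<1}" "C0 = g ` {0..1}"
    using assms unfolding smooth_jordan_curve_def by blast
  define g' where "g' s = frechet_derivative g (at s) 1" for s
  have D: "(g has_vector_derivative g' s) (at s)" for s
  proof -
    have D: "(g has_derivative frechet_derivative g (at s)) (at s)"
      using smooth_imp_differentiable[OF g(1)] frechet_derivative_works by blast
    then have l: "linear (frechet_derivative g (at s))" by (rule has_derivative_linear)
    have "frechet_derivative g (at s) x = x *\<^sub>R g' s" for x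
      using linear_scale[OF l, of x 1] by (simp add: g'_def)
    then have "frechet_derivative g (at s) = (\<lambda>x. x *\<^sub>R g' s)" by (rule ext)
    with D show ?thesis unfolding has_vector_derivative_def by simp
  qed
  have loop: "regular_loop g g'"
  proof
    show "continuous_on UNIV g'"
      unfolding g'_def using smooth_imp_continuous[OF smooth_frechet_derivative[OF g(1)]] .
    show "g' s \<noteq> 0" for s using g(2)[of s] vector_derivative_at[OF D] by simp
  qed (use D g in auto)
  moreover have "regular_loop.C g = C0" using regular_loop.C_def[OF loop] g(5) by simp
  ultimately show ?thesis by blast
qed

lemma (in regular_loop) regular_loop_inversion:
  assumes "\<alpha> \<notin> C"
  shows "regular_loop (\<lambda>s. inverse (g s - \<alpha>)) (\<lambda>s. - (inverse (g s - \<alpha>) * g' s * inverse (g s - \<alpha>)))"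
    and "regular_loop.C (\<lambda>s. inverse (g s - \<alpha>)) = (\<lambda>x. inverse (x - \<alpha>)) ` C"
proof -
  \<comment> \<open>\<open>g_in_C\<close> covers only a bounded range of parameters, but the
    inverted loop must be regular on the whole line.\<close>
  have in_C: "g s \<in> C" for s
  proof -
    have per: "g (s + of_int k) = g s" for s and k :: int
    proof (induction k rule: int_induct[where k = 0])
      case (step1 i)
      then show ?case using periodic[of "s + of_int i"] by (simp add: add.assoc)
    next
      case (step2 i)
      then show ?case using periodic_minus(1)[of "s + of_int i"] by (simp add: algebra_simps)
    qed simp
    have "g s = g (frac s)" using per[of "frac s" "\<lfloor>s\<rfloor>"] by (simp add: frac_def)
    moreover have "-1 \<le> frac s" "frac s \<le> 2" using frac_ge_0[of s] frac_lt_1[of s] by linarith+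
    ultimately show ?thesis using g_in_C[of "frac s"] by simp
  qed
  then have nz: "g s - \<alpha> \<noteq> 0" for s using assms by (metis eq_iff_diff_eq_0)
  show loop: "regular_loop (\<lambda>s. inverse (g s - \<alpha>)) (\<lambda>s. - (inverse (g s - \<alpha>) * g' s * inverse (g s - \<alpha>)))"
  proof
    show "((\<lambda>s. inverse (g s - \<alpha>)) has_vector_derivative - (inverse (g s - \<alpha>) * g' s * inverse (g s - \<alpha>))) (at s)" for s
    proof -
      have "((\<lambda>s. g s - \<alpha>) has_vector_derivative g' s) (at s)"
        using has_vector_derivative_diff[OF deriv has_vector_derivative_const[of \<alpha>]] by simp
      then have "((\<lambda>s. g s - \<alpha>) has_derivative (\<lambda>h. h *\<^sub>R g' s)) (at s)"
        by (simp add: has_vector_derivative_def)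
      from Deriv.has_derivative_inverse[OF nz this]
      show ?thesis unfolding has_vector_derivative_def
        by (rule has_derivative_eq_rhs) (simp add: fun_eq_iff)
    qed
    show "continuous_on UNIV (\<lambda>s. - (inverse (g s - \<alpha>) * g' s * inverse (g s - \<alpha>)))"
      by (intro continuous_intros cont cont') (use nz in auto)
    show "- (inverse (g s - \<alpha>) * g' s * inverse (g s - \<alpha>)) \<noteq> 0" for s
      using nz[of s] ne[of s] by simp
    show "inverse (g (s + 1) - \<alpha>) = inverse (g s - \<alpha>)" for s
      by (simp add: periodic)
    show "inj_on (\<lambda>s. inverse (g s - \<alpha>)) {0..<1}"
      using inj by (simp add: inj_on_def)
  qed
  show "regular_loop.C (\<lambda>s. inverse (g s - \<alpha>)) = (\<lambda>x. inverse (x - \<alpha>)) ` C"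
    unfolding regular_loop.C_def[OF loop] C_def by (simp add: image_image)
qed

text \<open>A connected set that misses the frontier of D lies in D or is disjoint from it. This
  applies to both components of the complement of the curve; the unbounded one cannot lie in
  D.\<close>

lemma jordan_domain_eq_inside:
  fixes c :: "real \<Rightarrow> complex"
  assumes c: "simple_path c" "pathfinish c = pathstart c"
    and D: "open D" "connected D" "D \<noteq> {}" "bounded D" "frontier D = path_image c"
  shows "D = inside (path_image c)"
proof -
  note J = Jordan_inside_outside[OF c]
  have disj: "D \<inter> path_image c = {}"
    using D(1,5) by (auto simp: frontier_def interior_open)
  have fr: "K \<subseteq> D" if "connected K" "K \<inter> path_image c = {}" "K \<inter> D \<noteq> {}" for K
    using connected_Int_frontier[OF that(1,3)] that(2) D(5) by blast
  have "D \<inter> outside (path_image c) = {}"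
  proof (rule ccontr)
    assume "D \<inter> outside (path_image c) \<noteq> {}"
    then have "outside (path_image c) \<subseteq> D"
      using J by (intro fr) auto
    then show False using J D(4) bounded_subset by blast
  qed
  then have sub: "D \<subseteq> inside (path_image c)" using J disj by blast
  then have "inside (path_image c) \<inter> D \<noteq> {}" using D(3) by blast
  then have "inside (path_image c) \<subseteq> D" using J by (intro fr) auto
  with sub show ?thesis by blast
qed

text \<open>The frontier of a bounded simply connected open set is connected, so the finitely many
  disjoint closed curves that form it reduce to one.\<close>

lemma smooth_simply_connected_boundary:
  assumes "smooth_and_simply_connected S"
  shows "\<exists>g g'. regular_loop g g' \<and> - S = outside (regular_loop.C g) \<and> regular_loop.C g \<subseteq> S"
proof -
  obtain D where D: "open D" "connected D" "D \<noteq> {}" "bounded D" "simply_connected D" "smooth_boundary D" "S = closure D"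
    using assms unfolding smooth_and_simply_connected_def by blast
  obtain \<Gamma> where \<Gamma>: "finite \<Gamma>" "pairwise disjnt \<Gamma>" "\<And>C. C \<in> \<Gamma> \<Longrightarrow> smooth_jordan_curve C" "frontier D = \<Union>\<Gamma>"
    using D(6) unfolding smooth_boundary_def by blast
  have conn: "connected (frontier D)"
    using D(1,4,5) simply_connected_eq_frontier_properties by auto
  have "D \<noteq> UNIV" using D(4) not_bounded_UNIV by metis
  then have "frontier D \<noteq> {}" using D(3) frontier_eq_empty[of D] by simp
  then obtain C0 where C0: "C0 \<in> \<Gamma>" using \<Gamma>(4) by blast
  have comp: "compact C" "C \<noteq> {}" if C: "C \<in> \<Gamma>" for C
  proof -
    obtain g g' where g: "regular_loop g g'" "regular_loop.C g = C"
      using regular_loop_of_smooth_jordan_curve[OF \<Gamma>(3)[OF C]] by blast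
    show "compact C" "C \<noteq> {}"
      using regular_loop.compact_C[OF g(1)] regular_loop.nonempty_C[OF g(1)] g(2) by auto
  qed
  have "\<Gamma> = {C0}"
  proof (rule ccontr)
    assume "\<Gamma> \<noteq> {C0}"
    then obtain C1 where C1: "C1 \<in> \<Gamma>" "C1 \<noteq> C0" using C0 by blast
    have cl: "closed C0" "closed (\<Union>(\<Gamma> - {C0}))"
      using comp C0 \<Gamma>(1) by (auto intro!: compact_imp_closed closed_Union)
    have disj: "C0 \<inter> \<Union>(\<Gamma> - {C0}) = {}"
      using \<Gamma>(2) C0 unfolding pairwise_def disjnt_def by blast
    have "C0 = {} \<or> \<Union>(\<Gamma> - {C0}) = {}"
      using conn cl disj C0 unfolding \<Gamma>(4) connected_closed by blast
    then show False using comp(2)[OF C0] comp(2)[OF C1(1)] C1 by blast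
  qed
  then have fr: "frontier D = C0" using \<Gamma>(4) by simp
  obtain g g' where g: "regular_loop g g'" "regular_loop.C g = C0"
    using regular_loop_of_smooth_jordan_curve[OF \<Gamma>(3)[OF C0]] by blast
  note sp = regular_loop.simple_path[OF g(1), unfolded g(2)]
  have "D = inside (path_image g)"
    by (rule jordan_domain_eq_inside[OF sp(1,2) D(1-4)]) (simp add: fr sp)
  moreover have "S = D \<union> C0"
    using D(1,7) fr by (metis closure_Un_frontier)
  ultimately have "- S = outside C0"
    using Jordan_inside_outside[OF sp(1,2)] unfolding sp(3) by blast
  moreover have "C0 \<subseteq> S" using \<open>S = D \<union> C0\<close> by blast
  ultimately show ?thesis using g by metis
qed

subsection \<open>Quadrature for the boundary measure\<close>

locale inverted_exterior =
  fixes S :: "complex set" and \<alpha> :: complex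
  assumes S_smooth: "smooth_and_simply_connected S" and \<alpha>: "\<alpha> \<in> interior S"
begin

definition E where "E = sphere_inversion \<alpha> ` sphere_exterior S"

lemma E_eq: "E = insert 0 ((\<lambda>x. inverse (x - \<alpha>)) ` (- S))"
proof -
  have "sphere_exterior S = insert None (Some ` (- S))"
  proof (rule set_eqI)
    show "x \<in> sphere_exterior S \<longleftrightarrow> x \<in> insert None (Some ` (- S))" for x
      by (cases x) (auto simp: sphere_exterior_def)
  qed
  then show ?thesis by (auto simp: E_def image_image)
qed

lemma mem_E: "t \<noteq> 0 \<Longrightarrow> t \<in> E \<longleftrightarrow> inverse t + \<alpha> \<notin> S"
  unfolding E_eq by (auto intro!: image_eqI[of _ _ "inverse t + \<alpha>"])

lemma zero_in_E: "0 \<in> E" by (simp add: E_eq)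

lemma closed_S: "closed S" and bounded_S: "bounded S"
  using S_smooth unfolding smooth_and_simply_connected_def by auto

lemma bounded_E: "bounded E"
proof -
  obtain r where r: "r > 0" "ball \<alpha> r \<subseteq> S" using \<alpha> by (auto simp: mem_interior)
  have "norm t \<le> 1 / r" if "t \<in> E" for t
  proof (cases "t = 0")
    case False
    then have "inverse t + \<alpha> \<notin> ball \<alpha> r" using that mem_E r(2) by blast
    then have "r \<le> norm (inverse t)" by (simp add: dist_norm)
    then have "r \<le> 1 / norm t" by (simp add: inverse_eq_divide norm_divide)
    then show ?thesis using r(1) False by (simp add: field_simps)
  qed (use r in simp)
  then show ?thesis unfolding bounded_iff by blast
qed

lemma cont_inv: "continuous_on (- {0}) (\<lambda>t. inverse t + \<alpha>)"
  by (intro continuous_intros) auto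

lemma open_E: "open E"
proof -
  obtain R where R: "R > 0" "\<And>x. x \<in> S \<Longrightarrow> norm x \<le> R" using bounded_S bounded_pos by blast
  define r where "r = 1 / (R + norm \<alpha> + 1)"
  have r: "r > 0" using R(1) by (simp add: r_def add_pos_nonneg)
  have "E = ((- {0}) \<inter> (\<lambda>t. inverse t + \<alpha>) -` (- S)) \<union> ball 0 r"
  proof -
    have "t \<in> E" if "t \<in> ball 0 r" for t
    proof (cases "t = 0")
      case False
      have "norm t < 1 / (R + norm \<alpha> + 1)" using that by (simp add: r_def)
      then have "R + norm \<alpha> + 1 < 1 / norm t"
        using False R(1) by (simp add: field_simps add_pos_nonneg)
      moreover have "norm (inverse t) \<le> norm (inverse t + \<alpha>) + norm \<alpha>"
        using norm_triangle_ineq4[of "inverse t + \<alpha>" \<alpha>] by simp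
      ultimately have "norm (inverse t + \<alpha>) > R" by (simp add: inverse_eq_divide norm_divide)
      then show ?thesis using R(2) mem_E[OF False] by force
    qed (simp add: zero_in_E)
    then have sub: "ball 0 r \<subseteq> E" by blast
    have "x \<in> E \<longleftrightarrow> x \<in> ((- {0}) \<inter> (\<lambda>t. inverse t + \<alpha>) -` (- S)) \<union> ball 0 r" for x
    proof (cases "x = 0")
      case True
      then show ?thesis using zero_in_E r by simp
    next
      case False
      then show ?thesis using mem_E[OF False] sub by blast
    qed
    then show ?thesis by (intro set_eqI)
  qed
  moreover have "open ((- {0}) \<inter> (\<lambda>t. inverse t + \<alpha>) -` (- S))"
    using cont_inv closed_S by (intro continuous_open_preimage) auto
  ultimately show ?thesis by auto
qed

text \<open>Inversion is a homeomorphism near the exterior of S and carries the boundary loop to a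
  regular loop. E is connected and bounded with this loop as its frontier, hence is its inside, and
  therefore simply connected.\<close>

lemma loop_data:
  obtains g g' where "regular_loop g g'" "regular_loop.C g = frontier E" "simply_connected E" "connected E"
    "\<And>t. t \<in> frontier E \<Longrightarrow> t \<noteq> 0 \<and> inverse t + \<alpha> \<in> S" "\<exists>\<gamma>. positive_boundary_path E \<gamma>"
proof -
  obtain g0 g0' where g0: "regular_loop g0 g0'" "- S = outside (regular_loop.C g0)" "regular_loop.C g0 \<subseteq> S"
    using smooth_simply_connected_boundary[OF S_smooth] by blast
  interpret g0: regular_loop g0 g0' by (rule g0(1))
  note J = Jordan_inside_outside[OF g0.simple_path(1,2), unfolded g0.simple_path(3)]
  have frS: "closure (- S) = - S \<union> g0.C"
    using J unfolding g0(2) by (metis closure_Un_frontier)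
  have \<alpha>_cl: "\<alpha> \<notin> closure (- S)" using \<alpha> by (simp add: interior_closure)
  then have \<alpha>C: "\<alpha> \<notin> g0.C" using frS by blast
  note inv = g0.regular_loop_inversion[OF \<alpha>C]
  have cont: "continuous_on (closure (- S)) (\<lambda>x. inverse (x - \<alpha>))"
    using \<alpha>_cl by (intro continuous_intros) auto
  have fr: "frontier E = (\<lambda>x. inverse (x - \<alpha>)) ` g0.C"
  proof
    show "frontier E \<subseteq> (\<lambda>x. inverse (x - \<alpha>)) ` g0.C"
    proof
      fix t assume "t \<in> frontier E"
      then have t: "t \<in> closure E" "t \<notin> E" using open_E by (auto simp: frontier_def interior_open)
      then have t0: "t \<noteq> 0" using zero_in_E by blast
      have zS: "inverse t + \<alpha> \<in> S" using t(2) mem_E[OF t0] by blast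
      obtain x where x: "\<And>k. x k \<in> E" "x \<longlonglongrightarrow> t" using t(1) closure_sequential by blast
      have "inverse t + \<alpha> \<in> closure (- S)"
      proof (rule Lim_in_closed_set[of _ "\<lambda>k. inverse (x k) + \<alpha>" sequentially])
        have "\<forall>\<^sub>F k in sequentially. x k \<in> - {0}"
          by (rule topological_tendstoD[OF x(2)]) (use t0 in auto)
        then show "\<forall>\<^sub>F k in sequentially. inverse (x k) + \<alpha> \<in> closure (- S)"
          by eventually_elim (use x(1) mem_E closure_subset in blast)
        show "(\<lambda>k. inverse (x k) + \<alpha>) \<longlonglongrightarrow> inverse t + \<alpha>"
          using t0 x(2) by (intro tendsto_intros)
      qed auto
      then have "inverse t + \<alpha> \<in> g0.C" using frS zS by blast
      then show "t \<in> (\<lambda>x. inverse (x - \<alpha>)) ` g0.C"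
        by (intro image_eqI[of _ _ "inverse t + \<alpha>"]) auto
    qed
    show "(\<lambda>x. inverse (x - \<alpha>)) ` g0.C \<subseteq> frontier E"
    proof
      fix t assume "t \<in> (\<lambda>x. inverse (x - \<alpha>)) ` g0.C"
      then obtain x where x: "x \<in> g0.C" "t = inverse (x - \<alpha>)" by blast
      have "x \<noteq> \<alpha>" using x(1) \<alpha>C by blast
      then have t0: "t \<noteq> 0" and "inverse t + \<alpha> = x" using x(2) by auto
      then have "t \<notin> E" using mem_E[OF t0] g0(3) x(1) by auto
      moreover have "t \<in> closure ((\<lambda>x. inverse (x - \<alpha>)) ` (- S))"
      proof -
        have "(\<lambda>x. inverse (x - \<alpha>)) ` closure (- S) \<subseteq> closure ((\<lambda>x. inverse (x - \<alpha>)) ` (- S))"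
          by (rule image_closure_subset[OF cont]) (auto intro: closure_subset[THEN subsetD])
        then show ?thesis using x frS by blast
      qed
      then have "t \<in> closure E" using closure_mono[of "(\<lambda>x. inverse (x - \<alpha>)) ` (- S)" E] E_eq by blast
      ultimately show "t \<in> frontier E" using open_E by (auto simp: frontier_def interior_open)
    qed
  qed
  define g where "g s = inverse (g0 s - \<alpha>)" for s
  obtain g' where g: "regular_loop g g'" using inv(1) unfolding g_def by blast
  interpret g: regular_loop g g' by (rule g)
  have gC: "g.C = frontier E" using inv(2) fr unfolding g_def by simp
  have connE: "connected E"
  proof (rule connected_intermediate_closure[of "(\<lambda>x. inverse (x - \<alpha>)) ` (- S)"])
    have "connected (- S)" using J unfolding g0(2) by blast
    then show "connected ((\<lambda>x. inverse (x - \<alpha>)) ` (- S))"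
      by (rule connected_continuous_image[OF continuous_on_subset[OF cont closure_subset]])
    show "(\<lambda>x. inverse (x - \<alpha>)) ` (- S) \<subseteq> E" unfolding E_eq by blast
    \<comment> \<open>The exterior is unbounded, so its image accumulates at 0, the image of
      infinity; adjoining 0 keeps the image connected.\<close>
    have "0 \<in> closure ((\<lambda>x. inverse (x - \<alpha>)) ` (- S))"
      unfolding closure_approachable
    proof (intro allI impI)
      fix e :: real assume e: "e > 0"
      have "\<not> bounded (- S)" using J unfolding g0(2) by blast
      then have "\<exists>x\<in>- S. \<not> norm x \<le> 1 / e + norm \<alpha>" unfolding bounded_iff by blast
      then obtain x where x: "x \<in> - S" "norm x > 1 / e + norm \<alpha>" by (auto simp only: not_le)
      have "norm (x - \<alpha>) \<ge> norm x - norm \<alpha>" by (rule norm_triangle_ineq2)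
      then have "norm (x - \<alpha>) > 1 / e" using x(2) by linarith
      then have "norm (inverse (x - \<alpha>)) < e"
      proof -
        have "1 / e > 0" using e by simp
        then have "inverse (norm (x - \<alpha>)) < inverse (1 / e)"
          using \<open>norm (x - \<alpha>) > 1 / e\<close> by (intro less_imp_inverse_less)
        then show ?thesis by (simp add: norm_inverse)
      qed
      then have "dist (inverse (x - \<alpha>)) 0 < e" by (simp only: dist_0_norm dist_commute[of _ 0])
      then show "\<exists>y\<in>(\<lambda>x. inverse (x - \<alpha>)) ` (- S). dist y 0 < e"
        by (rule bexI[OF _ imageI[OF x(1)]])
    qed
    then show "E \<subseteq> closure ((\<lambda>x. inverse (x - \<alpha>)) ` (- S))"
      unfolding E_eq by (rule insert_subsetI[OF _ closure_subset])
  qed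
  have E_in: "E = inside (path_image g)"
  proof (rule jordan_domain_eq_inside[OF g.simple_path(1,2) open_E connE _ bounded_E])
    show "E \<noteq> {}" using zero_in_E by blast
    show "frontier E = path_image g" unfolding g.simple_path(3) gC ..
  qed
  have sc: "simply_connected E"
    unfolding E_in by (rule simply_connected_inside_simple_path[OF g.simple_path(1)])
  have pos: "\<exists>\<gamma>. positive_boundary_path E \<gamma>"
  \<comment> \<open>A simple loop winds around its inside once or minus once; in the second case the
    reversed loop is positively oriented.\<close>
  proof (rule simple_closed_path_winding_number_inside[OF g.simple_path(1)])
    assume "\<And>z. z \<in> inside (path_image g) \<Longrightarrow> winding_number g z = 1"
    then show ?thesis
      unfolding positive_boundary_path_def using g.valid_path g.simple_path gC E_in by blast
  next
    assume m: "\<And>z. z \<in> inside (path_image g) \<Longrightarrow> winding_number g z = - 1"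
    have "winding_number (reversepath g) w = 1" if "w \<in> E" for w
    proof -
      have "w \<notin> path_image g" using that E_in inside_no_overlap by blast
      then have "winding_number (reversepath g) w = - winding_number g w"
        using g.simple_path(1) simple_path_imp_path by (intro winding_number_reversepath) auto
      then show ?thesis using m that E_in by simp
    qed
    then show ?thesis
      unfolding positive_boundary_path_def using g.valid_path g.simple_path gC
      by (intro exI[of _ "reversepath g"]) (auto simp: simple_path_reversepath)
  qed
  have frp: "t \<noteq> 0 \<and> inverse t + \<alpha> \<in> S" if "t \<in> frontier E" for t
  proof -
    have "t \<notin> E" using that open_E by (auto simp: frontier_def interior_open)
    moreover from this have "t \<noteq> 0" using zero_in_E by metis
    ultimately show ?thesis using mem_E[of t] by simp
  qed
  show thesis by (rule that[OF g gC sc connE frp pos])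
qed

end

text \<open>On the boundary, X = 0 replaces the non-holomorphic 2 \<partial>Q by boundary values of
  a function meromorphic in E. These values are attained continuously because the Cauchy transform
  of a bounded density is continuous across the boundary of its support.\<close>

lemma (in charged) boundary_quadrature:
  assumes S_smooth: "smooth_and_simply_connected S" and \<alpha>: "\<alpha> \<in> interior S"
    and z: "\<And>j. j \<in> {1..n} \<Longrightarrow> z j \<notin> S"
  defines "E \<equiv> sphere_inversion \<alpha> ` sphere_exterior S"
  shows "quadrature_domain E (has_boundary_integral E (\<lambda>t. inverse t * wirtinger Q (inverse t + \<alpha>)))
     ((\<lambda>j. inverse (z j - \<alpha>)) ` {1..n})"
proof -
  interpret ie: inverted_exterior S \<alpha> by unfold_locales (rule S_smooth, rule \<alpha>)
  have E_def': "ie.E = E" by (simp add: E_def ie.E_def)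
  note open_E = ie.open_E[unfolded E_def'] and bounded_E = ie.bounded_E[unfolded E_def']
    and mem_E = ie.mem_E[unfolded E_def'] and zero_in_E = ie.zero_in_E[unfolded E_def']
  obtain g g' where g: "regular_loop g g'" "regular_loop.C g = frontier E" "simply_connected E" "connected E"
    "\<And>t. t \<in> frontier E \<Longrightarrow> t \<noteq> 0 \<and> inverse t + \<alpha> \<in> S" "\<exists>\<gamma>. positive_boundary_path E \<gamma>"
    using ie.loop_data unfolding E_def' by metis
  obtain M R where bd: "bounded_density \<rho> M R" using bounded_density by blast
  interpret bd: bounded_density \<rho> M R by (rule bd)
  have \<alpha>S: "\<alpha> \<in> S" using \<alpha> interior_subset by blast
  define T where "T j = inverse (z j - \<alpha>)" for j
  have T0: "T j \<noteq> 0" if "j \<in> {1..n}" for j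
    using z[OF that] \<alpha>S by (auto simp: T_def)
  have TE: "T j \<in> E" if "j \<in> {1..n}" for j
    using z[OF that] mem_E[OF T0[OF that]] by (simp add: T_def)
  \<comment> \<open>This is 1 / t times the Cauchy transform at 1 / t + \<alpha>, rewritten so that
    it is holomorphic also at t = 0, the image of infinity.\<close>
  define G0 where "G0 t = (LINT w|lborel. of_real (\<rho> w) / (1 - t * (w - \<alpha>)))" for t
  have G0_eq: "G0 t = inverse t * cauchy_transform \<rho> (inverse t + \<alpha>)" if "t \<noteq> 0" for t
  proof -
    have "of_real (\<rho> w) / (1 - t * (w - \<alpha>)) = inverse t * (of_real (\<rho> w) / (inverse t + \<alpha> - w))" for w
    proof -
      have "1 - t * (w - \<alpha>) = t * (inverse t + \<alpha> - w)" using that by (simp add: algebra_simps)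
      then show ?thesis by (simp add: divide_inverse mult_ac)
    qed
    then show ?thesis
      unfolding G0_def cauchy_transform_def by (simp only: integral_mult_right_zero)
  qed
  have G0_hol: "G0 holomorphic_on E"
  proof (rule holomorphic_onI)
    fix t assume t: "t \<in> E"
    have nz: "1 - t * (w - \<alpha>) \<noteq> 0" if "w \<in> S" for w
    proof
      assume eq: "1 - t * (w - \<alpha>) = 0"
      then have t0: "t \<noteq> 0" by auto
      then have "inverse t + \<alpha> = w" using eq by (simp add: field_simps)
      then show False using mem_E[OF t0] t that by blast
    qed
    have ne: "S \<noteq> {}" using \<alpha>S by blast
    have "continuous_on S (\<lambda>w. norm (1 - t * (w - \<alpha>)))" by (intro continuous_intros)
    from continuous_attains_inf[OF compact_S ne this]
    obtain w0 where w0: "w0 \<in> S" "\<And>w. w \<in> S \<Longrightarrow> norm (1 - t * (w0 - \<alpha>)) \<le> norm (1 - t * (w - \<alpha>))" by blast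
    define \<delta> where "\<delta> = norm (1 - t * (w0 - \<alpha>))"
    have \<delta>: "\<delta> > 0" using nz[OF w0(1)] by (simp add: \<delta>_def)
    obtain B0 where B0: "\<And>x. x \<in> S \<Longrightarrow> norm x \<le> B0"
      using compact_imp_bounded[OF compact_S] bounded_iff by blast
    define B where "B = B0 + norm \<alpha>"
    have B: "norm (w - \<alpha>) \<le> B" if "w \<in> S" for w
      using norm_triangle_ineq4[of w \<alpha>] B0[OF that] by (simp add: B_def)
    have Bnn: "B \<ge> 0" using B[OF w0(1)] norm_ge_zero order_trans by blast
    define e where "e = \<delta> / (2 * (B + 1))"
    have e: "e > 0" using \<delta> Bnn by (simp add: e_def)
    have "((\<lambda>u. LINT w|lborel. of_real (\<rho> w) / ((\<lambda>_. 1) w - u * (w - \<alpha>))) has_field_derivative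
         (LINT w|lborel. of_real (\<rho> w) * (w - \<alpha>) / ((\<lambda>_. 1) w - t * (w - \<alpha>))\<^sup>2)) (at t)"
    proof (rule bd.has_field_derivative_kernel_integral[where e = e and d = "\<delta> / 2" and B = B and b = "\<lambda>w. w - \<alpha>" and p = "\<lambda>_. 1"])
      show "norm (w - \<alpha>) \<le> B" if "\<rho> w \<noteq> 0" for w using that \<rho>_outside B by blast
      show "\<delta> / 2 \<le> norm (1 - u * (w - \<alpha>))" if w: "\<rho> w \<noteq> 0" and u: "norm (u - t) < e" for w u
      proof -
        have wS: "w \<in> S" using w \<rho>_outside by blast
        have "norm ((u - t) * (w - \<alpha>)) \<le> e * B"
          unfolding norm_mult using u B[OF wS] e by (intro mult_mono) auto
        also have "\<dots> \<le> \<delta> / 2"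
        proof -
          have "e * B \<le> e * (B + 1)" using e by simp
          also have "\<dots> = \<delta> / 2" using Bnn by (simp add: e_def field_simps)
          finally show ?thesis .
        qed
        finally have 1: "norm ((u - t) * (w - \<alpha>)) \<le> \<delta> / 2" .
        have "1 - u * (w - \<alpha>) = (1 - t * (w - \<alpha>)) - (u - t) * (w - \<alpha>)" by (simp add: algebra_simps)
        then have "norm (1 - u * (w - \<alpha>)) \<ge> norm (1 - t * (w - \<alpha>)) - norm ((u - t) * (w - \<alpha>))"
          by (simp only: norm_triangle_ineq2)
        then show ?thesis using 1 w0(2)[OF wS] by (simp add: \<delta>_def)
      qed
    qed (use e \<delta> in auto)
    then have "(G0 has_field_derivative (LINT w|lborel. of_real (\<rho> w) * (w - \<alpha>) / (1 - t * (w - \<alpha>))\<^sup>2)) (at t)"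
      unfolding G0_def[abs_def] by simp
    then show "G0 field_differentiable at t within E"
      using field_differentiable_at_within field_differentiable_def by blast
  qed
  have G0_cont: "continuous_on (closure E) G0"
  proof (rule continuous_at_imp_continuous_on, rule ballI)
    fix t
    show "isCont G0 t"
    proof (cases "t = 0")
      case True
      then show ?thesis
        using holomorphic_on_imp_continuous_on[OF G0_hol] open_E zero_in_E
        by (simp add: continuous_on_eq_continuous_at)
    next
      case False
      have "continuous_on (- {0}) (\<lambda>t. inverse t * cauchy_transform \<rho> (inverse t + \<alpha>))"
        by (intro continuous_intros continuous_on_compose2[OF bd.continuous_cauchy_transform]) auto
      moreover have "continuous_on (- {0}) G0 \<longleftrightarrow> continuous_on (- {0}) (\<lambda>t. inverse t * cauchy_transform \<rho> (inverse t + \<alpha>))"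
        by (rule continuous_on_cong[OF refl]) (simp add: G0_eq)
      ultimately have "continuous_on (- {0}) G0" by blast
      then show ?thesis using False by (simp add: continuous_on_eq_continuous_at open_Compl)
    qed
  qed
  \<comment> \<open>The factor 1 / (2 (1 + q)) from solving X = 0 for \<partial>Q, times 2 \<pi>
    \<i> from Cauchy's formula, times the residues - q j * T j of the inverted charges. It is
    nonzero because no node is 0.\<close>
  define c where "c w = - (of_real pi * \<i> / of_real (1 + qs)) * (of_real (\<Sum>j\<in>{j\<in>{1..n}. T j = w}. q j) * w)" for w :: complex
  have qs0: "complex_of_real (1 + qs) \<noteq> 0" using qs_nonneg by (metis add_nonneg_eq_0_iff of_real_eq_0_iff zero_le_one zero_neq_one)
  have c_nz: "c w \<noteq> 0" if w: "w \<in> T ` {1..n}" for w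
  proof -
    have "(\<Sum>j\<in>{j\<in>{1..n}. T j = w}. q j) > 0" by (rule node_weight_pos[OF q_pos w])
    then have "complex_of_real (\<Sum>j\<in>{j\<in>{1..n}. T j = w}. q j) \<noteq> 0" by (simp only: of_real_eq_0_iff)
    moreover obtain j where "j \<in> {1..n}" "w = T j" using w by (rule imageE)
    then have "w \<noteq> 0" using T0 by metis
    ultimately show ?thesis
      using qs0 pi_neq_zero complex_i_not_zero
      unfolding c_def mult_eq_0_iff divide_eq_0_iff neg_equal_0_iff_equal of_real_eq_0_iff by metis
  qed
  have main: "has_boundary_integral E (\<lambda>t. inverse t * wirtinger Q (inverse t + \<alpha>)) f (\<Sum>w\<in>T ` {1..n}. c w * f w)"
    if f: "f \<in> A_infty E" for f
    unfolding has_boundary_integral_def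
  proof (intro conjI allI impI g(6))
    fix \<gamma> assume \<gamma>: "positive_boundary_path E \<gamma>"
    have hol: "f holomorphic_on E" using f by (simp add: A_infty_def)
    obtain F :: "nat \<Rightarrow> complex \<Rightarrow> complex" where
      "\<forall>z\<in>closure E. F 0 z = f z" "\<forall>k. continuous_on (closure E) (F k) \<and> (\<forall>z\<in>E. F k z = (deriv ^^ k) f z)"
      using f unfolding A_infty_def by auto
    then have cont: "continuous_on (closure E) f"
      by (metis (no_types, lifting) continuous_on_cong)
    note cf = regular_loop.cauchy_integral_formula_boundary[OF g(1) open_E g(3) g(2)[symmetric] bounded_E \<gamma>]
    \<comment> \<open>The holomorphic part contributes nothing. Cauchy's theorem is obtained from
      Cauchy's formula at 0 by inserting a factor t, which makes the value at 0 vanish.\<close>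
    have "((\<lambda>t. (f t * G0 t * t) / (t - 0)) has_contour_integral (2 * of_real pi * \<i> * (f 0 * G0 0 * 0))) \<gamma>"
      by (rule cf) (intro holomorphic_intros hol G0_hol continuous_intros cont G0_cont zero_in_E)+
    then have 1: "((\<lambda>t. (f t * G0 t * t) / (t - 0)) has_contour_integral 0) \<gamma>" by simp
    have 2: "((\<lambda>t. f t / (t - T j)) has_contour_integral (2 * of_real pi * \<i> * f (T j))) \<gamma>" if "j \<in> {1..n}" for j
      by (rule cf[OF hol cont TE[OF that]])
    let ?k = "1 / (2 * complex_of_real (1 + qs))"
    have "((\<lambda>t. ?k * ((f t * G0 t * t) / (t - 0) - (\<Sum>j=1..n. of_real (q j) * T j * (f t / (t - T j)))))
       has_contour_integral (?k * (0 - (\<Sum>j=1..n. of_real (q j) * T j * (2 * of_real pi * \<i> * f (T j)))))) \<gamma>"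
      by (intro has_contour_integral_lmul has_contour_integral_diff has_contour_integral_sum 1 2) auto
    moreover have "?k * ((f t * G0 t * t) / (t - 0) - (\<Sum>j=1..n. of_real (q j) * T j * (f t / (t - T j)))) =
        f t * (inverse t * wirtinger Q (inverse t + \<alpha>))" if t: "t \<in> path_image \<gamma>" for t
    proof -
      have "t \<in> frontier E" using t \<gamma> by (simp add: positive_boundary_path_def)
      then have t0: "t \<noteq> 0" and zS: "inverse t + \<alpha> \<in> S" using g(5) by auto
      define x where "x = inverse t + \<alpha>"
      have "X x = 0" using X_S zS by (simp add: x_def)
      then have GX: "of_real (1 + qs) * G x = cauchy_transform \<rho> x + (\<Sum>j=1..n. of_real (q j) / (x - z j))"
        by (simp add: X_def algebra_simps)
      have W: "wirtinger Q x = G x / 2" by (simp add: wirtinger_def G_def)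
      \<comment> \<open>Since x - z j = (T j - t) / (t * T j), the factor 1 / t of the weight
        cancels and leaves a simple pole at T j.\<close>
      have s: "inverse t * (of_real (q j) / (x - z j)) = - (of_real (q j) * T j / (t - T j))" if j: "j \<in> {1..n}" for j
      proof -
        have zj: "z j = inverse (T j) + \<alpha>" by (simp add: T_def)
        have "x - z j \<noteq> 0" using zS z[OF j] by (auto simp: x_def)
        then have "T j \<noteq> t" using zj by (auto simp: x_def)
        have "x - z j = (T j - t) / (t * T j)"
          using t0 T0[OF j] by (simp add: x_def zj field_simps)
        then have "inverse t * (of_real (q j) / (x - z j)) = of_real (q j) * T j / (T j - t)"
          using t0 by (simp only:) (simp add: inverse_eq_divide)
        also have "\<dots> = - (of_real (q j) * T j / (t - T j))"
          by (metis minus_diff_eq minus_divide_right)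
        finally show ?thesis .
      qed
      have "f t * (inverse t * wirtinger Q x) = ?k * (f t * (inverse t * (of_real (1 + qs) * G x)))"
        using qs0 by (simp add: W del: of_real_add)
      also have "inverse t * (of_real (1 + qs) * G x) = G0 t + (\<Sum>j=1..n. inverse t * (of_real (q j) / (x - z j)))"
        unfolding GX G0_eq[OF t0] x_def[symmetric] by (simp add: distrib_left sum_distrib_left)
      also have "(\<Sum>j=1..n. inverse t * (of_real (q j) / (x - z j))) = - (\<Sum>j=1..n. of_real (q j) * T j / (t - T j))"
        unfolding sum_negf[symmetric] by (rule sum.cong[OF refl s])
      also have "f t * (G0 t + - (\<Sum>j=1..n. of_real (q j) * T j / (t - T j))) =
         f t * G0 t - (\<Sum>j=1..n. of_real (q j) * T j * (f t / (t - T j)))"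
        by (simp add: right_diff_distrib sum_distrib_left mult_ac)
      finally show ?thesis using t0 by (simp add: x_def)
    qed
    ultimately have "((\<lambda>t. f t * (inverse t * wirtinger Q (inverse t + \<alpha>)))
       has_contour_integral (?k * (0 - (\<Sum>j=1..n. of_real (q j) * T j * (2 * of_real pi * \<i> * f (T j)))))) \<gamma>"
      by (rule has_contour_integral_eq)
    moreover have "?k * (0 - (\<Sum>j=1..n. of_real (q j) * T j * (2 * of_real pi * \<i> * f (T j)))) = (\<Sum>w\<in>T ` {1..n}. c w * f w)"
    proof -
      have "(\<Sum>w\<in>T ` {1..n}. c w * f w) =
        (\<Sum>w\<in>T ` {1..n} \<inter> UNIV. - (of_real pi * \<i> / of_real (1 + qs)) * (of_real (\<Sum>j\<in>{j\<in>{1..n}. T j = w}. q j) * (w * f w)))"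
        by (simp add: c_def mult_ac del: of_real_sum of_real_add)
      also have "\<dots> = - (of_real pi * \<i> / of_real (1 + qs)) * (\<Sum>j\<in>{j\<in>{1..n}. T j \<in> UNIV}. of_real (q j) * (T j * f (T j)))"
        unfolding sum_distrib_left[symmetric] sum_group_nodes ..
      also have "{j\<in>{1..n}. T j \<in> UNIV} = {1..n}" by auto
      also have "(\<Sum>j=1..n. of_real (q j) * T j * (2 * of_real pi * \<i> * f (T j))) =
        2 * of_real pi * \<i> * (\<Sum>j=1..n. of_real (q j) * (T j * f (T j)))"
        unfolding sum_distrib_left by (rule sum.cong) (simp_all add: mult_ac)
      ultimately show ?thesis using qs0 by (simp del: of_real_add)
    qed
    ultimately show "((\<lambda>t. f t * (inverse t * wirtinger Q (inverse t + \<alpha>))) has_contour_integral (\<Sum>w\<in>T ` {1..n}. c w * f w)) \<gamma>"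
      by simp
  qed
  have "quadrature_domain E (has_boundary_integral E (\<lambda>t. inverse t * wirtinger Q (inverse t + \<alpha>))) (T ` {1..n})"
    unfolding quadrature_domain_def
  proof (intro conjI exI[of _ "\<lambda>_. 0 :: nat"] exI[of _ "\<lambda>w (k::nat). c w"] ballI)
    show "E \<noteq> {}" using zero_in_E by blast
    show "\<exists>k\<le>0::nat. c w \<noteq> 0" if "w \<in> T ` {1..n}" for w using c_nz[OF that] by auto
    show "has_boundary_integral E (\<lambda>t. inverse t * wirtinger Q (inverse t + \<alpha>)) f
        (\<Sum>w\<in>T ` {1..n}. \<Sum>k\<le>0. c w * (deriv ^^ k) f w)" if "f \<in> A_infty E" for f
      using main[OF that] by simp
  qed (use open_E g(4) TE in auto)
  then show ?thesis by (simp add: T_def[abs_def])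
qed

theorem theorem1:
  fixes Q :: "complex \<Rightarrow> real" and n :: nat and z :: "nat \<Rightarrow> complex" and q :: "nat \<Rightarrow> real"
    and q_sum :: real and V :: "complex \<Rightarrow> ereal" and \<mu>Q \<mu>V :: "complex measure"
    and SQ SV :: "complex set"
  assumes "smooth Q" and "subharmonic Q" and "admissible (\<lambda>x. ereal (Q x))"
    and "\<forall>j\<in>{1..n}. q j > 0"
    and "q_sum = (\<Sum>j=1..n. q j)"
    and "V = (\<lambda>x. ereal ((1 + q_sum) * Q x) + (\<Sum>j=1..n. ereal (q j) * log_kernel x (z j)))"
    and "equilibrium_measure (\<lambda>x. ereal (Q x)) \<mu>Q" and "SQ = measure_support \<mu>Q"
    and "equilibrium_measure V \<mu>V" and "SV = measure_support \<mu>V"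
    and "\<mu>Q = density lborel (\<lambda>x. ennreal (1 / (2*pi) * laplacian Q x) * indicator SQ x)"
    and "\<mu>V = density lborel (\<lambda>x. ennreal ((1 + q_sum) / (2*pi) * laplacian Q x) * indicator SV x)"
  shows "(\<forall>\<Omega>. negligible (frontier SQ) \<and> (\<forall>j\<in>{1..n}. z j \<in> interior SQ) \<and>
            open \<Omega> \<and> \<Omega> \<subseteq> SQ \<and> SV = SQ - \<Omega> \<longrightarrow>
            (\<forall>U\<in>components \<Omega>.
               quadrature_domain U (has_area_integral U (\<lambda>x. of_real (laplacian Q x)))
                 (z ` {1..n} \<inter> U))) \<and>
         (\<forall>\<alpha>. smooth_and_simply_connected SV \<and> (\<forall>j\<in>{1..n}. z j \<notin> SV) \<and> \<alpha> \<in> interior SV \<longrightarrow>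
            (let E = sphere_inversion \<alpha> ` sphere_exterior SV in
               quadrature_domain E
                 (has_boundary_integral E (\<lambda>t. inverse t * wirtinger Q (inverse t + \<alpha>)))
                 ((\<lambda>j. inverse (z j - \<alpha>)) ` {1..n})))"
proof (intro conjI allI impI ballI)
  have q: "\<And>j. j \<in> {1..n} \<Longrightarrow> q j > 0" using assms(4) by blast
  {
    fix \<Omega> U
    assume \<Omega>: "negligible (frontier SQ) \<and> (\<forall>j\<in>{1..n}. z j \<in> interior SQ) \<and>
            open \<Omega> \<and> \<Omega> \<subseteq> SQ \<and> SV = SQ - \<Omega>" and U: "U \<in> components \<Omega>"
    have "z j \<in> SQ" if "j \<in> {1..n}" for j using \<Omega> that interior_subset by blast
    then show "quadrature_domain U (has_area_integral U (\<lambda>x. of_real (laplacian Q x))) (z ` {1..n} \<inter> U)"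
      using area_quadrature_domain[OF assms(1,3) q assms(5-12)] \<Omega> U by blast
  }
  fix \<alpha>
  assume \<alpha>: "smooth_and_simply_connected SV \<and> (\<forall>j\<in>{1..n}. z j \<notin> SV) \<and> \<alpha> \<in> interior SV"
  obtain K where "charged V (charged_field Q n z q)
     (\<lambda>x. max 0 ((1 + q_sum) / (2 * pi) * laplacian Q x) * indicator SV x)
     (z ` {1..n}) K (\<lambda>x. (1 + q_sum) / (2 * pi) * laplacian Q x) SV Q n z q"
    using charged_equilibrium_measure[OF assms(1,3) q assms(6)[unfolded assms(5)] assms(9,10) assms(12)[unfolded assms(5)]]
    unfolding assms(5) by blast
  then show "let E = sphere_inversion \<alpha> ` sphere_exterior SV in
               quadrature_domain E
                 (has_boundary_integral E (\<lambda>t. inverse t * wirtinger Q (inverse t + \<alpha>)))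
                 ((\<lambda>j. inverse (z j - \<alpha>)) ` {1..n})"
    unfolding Let_def using \<alpha> by (intro charged.boundary_quadrature) auto
qed

end
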